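(* Let $D$ be an irreducible Hermitian symmetric domain of tube type, i.e. one of $\mathrm{I}_{p,p}$ ($p\ge 2$), $\mathrm{II}_{2m}$ ($m\geq 2$), $\mathrm{III}_n$ ($n\ge 1$), $\mathrm{IV}_{2n-1}$ ($n\ge 3$), $\mathrm{IV}_{2n-2}$ ($n\geq 4$), $\mathrm{EVII}$, and let $\lambda=\sum_i m_i\omega_i$ ($m_i\in\mathbb{Z}_{\ge0}$) be a dominant integral weight such that the homogeneous real variation of Hodge structure $\tilde{\mathcal V}^{\lambda}$ has odd level at least $3$. If $\tilde{\mathcal V}^{\lambda}$ admits an infinitesimal normal function, then $(D,\lambda)$ is either one of the level-3 Calabi--Yau variations $$(\mathrm{I}_{3,3},\omega_3),\quad (\mathrm{II}_6,\omega_6),\quad (\mathrm{III}_3,\omega_3),\quad (\mathrm{EVII},\omega_7),$$ or a member of one of the following infinite families parametrized by $a\in\mathbb{Z}_{\ge 0}$: $$(\mathrm{I}_{2,2},\ \omega_1+a\omega_2\ \text{or}\ \omega_3+a\omega_2),\quad (\mathrm{II}_4,\ \omega_1+a\omega_4\ \text{or}\ \omega_3+a\omega_4),$$ $$(\mathrm{III}_1,(2a+1)\omega_1),\quad (\mathrm{III}_2,\omega_1+a\omega_2),\quad (\mathrm{IV}_{2n-1},a\omega_1+\omega_n),\quad (\mathrm{IV}_{2n-2},\ a\omega_1+\omega_{n-1}\ \text{or}\ a\omega_1+\omega_n).$$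
   Context: Notation. $\mathfrak g$ is a complex simple Lie algebra of rank $n$ with Cartan subalgebra $\mathfrak t$, simple roots $\sigma_1,\dots,\sigma_n$ and fundamental weights $\omega_1,\dots,\omega_n$ (Bourbaki numbering), $\rho=\sum_i\omega_i$. Fix a special simple root $\sigma_{\mathtt I}$ (one with coefficient $1$ in the highest root) and let $\mathtt E\in\mathfrak t$ be the element with $\mathtt E(\sigma_{\mathtt I})=-2$, $\mathtt E(\sigma_j)=0$ for $j\ne\mathtt I$. The pair (root system, $\sigma_{\mathtt I}$) determines a real form $\mathfrak g_{\mathbb R}$ with compact Cartan subalgebra (roots $\alpha$ with $\mathtt E(\alpha)=0$ are compact, the others noncompact) and an irreducible Hermitian symmetric domain $D$, the conjugation orbit, under the group of real points of the simply connected group with Lie algebra $\mathfrak g_{\mathbb R}$, of the cocharacter with differential $\mathtt E$. The names are: $\mathrm I_{p,n-p+1}=(A_n,\sigma_p)$, $\mathrm{II}_n=(D_n,\sigma_n)$, $\mathrm{III}_n=(C_n,\sigma_n)$, $\mathrm{IV}_{2n-1}=(B_n,\sigma_1)$, $\mathrm{IV}_{2n-2}=(D_n,\sigma_1)$, $\mathrm{EVII}=(E_7,\sigma_7)$. (In the claim, $n$ and $\omega_i$ for each domain refer to the corresponding root system; e.g. $\mathrm I_{p,p}=(A_{2p-1},\sigma_p)$ and $\mathrm{II}_{2m}=(D_{2m},\sigma_{2m})$.) For a dominant integral $\lambda$, let $V^\lambda$ be the irreducible $\mathfrak g$-representation of highest weight $\lambda$, and let $\tau$ be the involution of the weight lattice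 given by $-w_0$, $w_0$ the longest Weyl group element, so $\overline{V^\lambda}\cong V^{\tau(\lambda)}$. Put $\tilde V^\lambda=V^\lambda$ if $V^\lambda$ is the complexification of a real $\mathfrak g_{\mathbb R}$-representation, and $\tilde V^\lambda=V^\lambda\oplus V^{\tau(\lambda)}$ otherwise; $\tilde V^\lambda$ is the complexification of an irreducible real $\mathfrak g_{\mathbb R}$-representation. If $\mathtt E(\lambda)$ is odd, letting $(\tilde V^\lambda)^{p,-p-1}$ be the $(2p+1)$-eigenspace of $\mathtt E$ (suitably conjugated at the other points of $D$) defines a homogeneous polarized real variation of Hodge structure $\tilde{\mathcal V}^\lambda$ of weight $-1$ over $D$ and its arithmetic quotients. Its level is $\max\{-\mathtt E(\lambda),-\mathtt E(\tau(\lambda))\}$. A variation is Calabi--Yau if its first and last nonzero Hodge numbers are $1$. Let $\mathtt s$ be the reflection in $\sigma_{\mathtt I}$, $\mathtt s\cdot\lambda=\mathtt s(\lambda+\rho)-\rho$, and $\mu(\lambda)=\tfrac12(\mathtt E(\mathtt s\cdot\lambda)-1)$. One says $\tilde{\mathcal V}^\lambda$ admits an infinitesimal normal function if $\mu(\lambda)\ge0$. *)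

theory Defs
  imports Complex_Main "HOL-Library.Function_Algebras" "Jordan_Normal_Form.Matrix_Kernel"
begin

section \<open>Cartan types\<close>

datatype cartan_type = TypeA nat | TypeB nat | TypeC nat | TypeD nat | TypeE7

fun lie_rank :: "cartan_type \<Rightarrow> nat" where
  "lie_rank (TypeA n) = n"
| "lie_rank (TypeB n) = n"
| "lie_rank (TypeC n) = n"
| "lie_rank (TypeD n) = n"
| "lie_rank TypeE7 = 7"

text \<open>The entry \<open>cartan X i j\<close> is the integer \<open>\<langle>\<sigma>\<^sub>i, \<sigma>\<^sub>j\<^sup>\<or>\<rangle>\<close>, in Bourbaki's numbering
  of the simple roots (indices run over \<open>{1..lie_rank X}\<close>). So \<open>\<sigma>\<^sub>n\<close> is the short simple root in type
  \<open>B\<^sub>n\<close> and the long one in type \<open>C\<^sub>n\<close>; in type \<open>D\<^sub>n\<close> the nodes \<open>n - 1\<close> and \<open>n\<close> are both joined to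
  \<open>n - 2\<close>; in type \<open>E\<^sub>7\<close> the chain is 1, 3, 4, 5, 6, 7 and node 2 is joined to node 4.\<close>

fun cartan :: "cartan_type \<Rightarrow> nat \<Rightarrow> nat \<Rightarrow> int" where
  "cartan (TypeA n) i j =
     (if i = j then 2 else if Suc i = j \<or> Suc j = i then -1 else 0)"
| "cartan (TypeB n) i j =
     (if i = j then 2
      else if Suc i = j \<and> j = n then -2
      else if Suc i = j \<or> Suc j = i then -1 else 0)"
| "cartan (TypeC n) i j =
     (if i = j then 2
      else if Suc j = i \<and> i = n then -2
      else if Suc i = j \<or> Suc j = i then -1 else 0)"
| "cartan (TypeD n) i j =
     (if i = j then 2
      else if (Suc i = j \<and> j < n) \<or> (Suc j = i \<and> i < n) then -1
      else if (i + 2 = j \<and> j = n) \<or> (j + 2 = i \<and> i = n) then -1 else 0)"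
| "cartan TypeE7 i j =
     (if i = j then 2
      else if {i, j} \<in> {{1, 3}, {3, 4}, {2, 4}, {4, 5}, {5, 6}, {6, 7}} then -1 else 0)"


section \<open>Weights and the Weyl group\<close>

text \<open>An element \<open>\<nu>\<close> of the real span of the weight lattice is given by its coordinates
  \<open>\<nu> i = \<langle>\<nu>, \<sigma>\<^sub>i\<^sup>\<or>\<rangle>\<close> in the basis of fundamental weights, and is zero outside \<open>{1..lie_rank X}\<close>.
  Addition, subtraction and negation of weights are pointwise.\<close>

type_synonym weight = "nat \<Rightarrow> real"

definition wscale :: "real \<Rightarrow> weight \<Rightarrow> weight" (infixr "*\<^sub>W" 75) where
  "c *\<^sub>W \<nu> = (\<lambda>j. c * \<nu> j)"

definition fund_weight :: "nat \<Rightarrow> weight" ("\<omega>") where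
  "\<omega> i = (\<lambda>j. if j = i then 1 else 0)"

definition simple_root :: "cartan_type \<Rightarrow> nat \<Rightarrow> weight" where
  "simple_root X i = (\<Sum>j\<in>{1..lie_rank X}. of_int (cartan X i j) *\<^sub>W \<omega> j)"

definition rho :: "cartan_type \<Rightarrow> weight" where
  "rho X = (\<Sum>i\<in>{1..lie_rank X}. \<omega> i)"

text \<open>The reflection \<open>\<nu> \<mapsto> \<nu> - \<langle>\<nu>, \<sigma>\<^sub>i\<^sup>\<or>\<rangle> \<sigma>\<^sub>i\<close>.\<close>

definition simple_refl :: "cartan_type \<Rightarrow> nat \<Rightarrow> weight \<Rightarrow> weight" where
  "simple_refl X i \<nu> = \<nu> - \<nu> i *\<^sub>W simple_root X i"

definition dot_refl :: "cartan_type \<Rightarrow> nat \<Rightarrow> weight \<Rightarrow> weight" where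
  "dot_refl X i \<nu> = simple_refl X i (\<nu> + rho X) - rho X"

definition weyl_word :: "cartan_type \<Rightarrow> nat list \<Rightarrow> weight \<Rightarrow> weight" where
  "weyl_word X is = foldr (\<lambda>i w. simple_refl X i \<circ> w) is id"

definition weyl_group :: "cartan_type \<Rightarrow> (weight \<Rightarrow> weight) set" where
  "weyl_group X = {weyl_word X is | is. set is \<subseteq> {1..lie_rank X}}"

definition weyl_length :: "cartan_type \<Rightarrow> (weight \<Rightarrow> weight) \<Rightarrow> nat" where
  "weyl_length X w =
     (LEAST k. \<exists>is. length is = k \<and> set is \<subseteq> {1..lie_rank X} \<and> weyl_word X is = w)"

definition longest_element :: "cartan_type \<Rightarrow> weight \<Rightarrow> weight" where
  "longest_element X =
     (THE w. w \<in> weyl_group X \<and> (\<forall>w'\<in>weyl_group X. weyl_length X w' \<le> weyl_length X w))"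

definition tau :: "cartan_type \<Rightarrow> weight \<Rightarrow> weight" where
  "tau X \<nu> = - longest_element X \<nu>"


section \<open>Hermitian symmetric domains\<close>

text \<open>A domain is represented by the pair (root system, index of the special simple root) that
  determines it.\<close>

type_synonym hs_domain = "cartan_type \<times> nat"

definition dom_I :: "nat \<Rightarrow> nat \<Rightarrow> hs_domain" where
  "dom_I p q = (TypeA (p + q - 1), p)"

definition dom_II :: "nat \<Rightarrow> hs_domain" where
  "dom_II n = (TypeD n, n)"

definition dom_III :: "nat \<Rightarrow> hs_domain" where
  "dom_III n = (TypeC n, n)"

text \<open>The index is the dimension \<open>k\<close>: \<open>IV\<^bsub>2n-1\<^esub>\<close> has type \<open>B\<^sub>n\<close> and \<open>IV\<^bsub>2n-2\<^esub>\<close> has type \<open>D\<^sub>n\<close>.\<close>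

definition dom_IV :: "nat \<Rightarrow> hs_domain" where
  "dom_IV k = (if odd k then (TypeB ((k + 1) div 2), 1) else (TypeD ((k + 2) div 2), 1))"

definition dom_EVII :: hs_domain where
  "dom_EVII = (TypeE7, 7)"

definition tube_type_domains :: "hs_domain set" where
  "tube_type_domains =
     {dom_I p p | p. p \<ge> 2} \<union> {dom_II (2 * m) | m. m \<ge> 2} \<union> {dom_III n | n. n \<ge> 1} \<union>
     {dom_IV (2 * n - 1) | n. n \<ge> 3} \<union> {dom_IV (2 * n - 2) | n. n \<ge> 4} \<union> {dom_EVII}"


section \<open>The grading element\<close>

text \<open>An element of the real span of the coroots in the Cartan subalgebra is given by its coordinates in the basis
  \<open>\<sigma>\<^sub>1\<^sup>\<or>, \<dots>, \<sigma>\<^sub>n\<^sup>\<or>\<close>, which is dual to the basis of fundamental weights.\<close>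

definition pairing :: "cartan_type \<Rightarrow> (nat \<Rightarrow> real) \<Rightarrow> weight \<Rightarrow> real" where
  "pairing X h \<nu> = (\<Sum>i\<in>{1..lie_rank X}. h i * \<nu> i)"

definition grading_element :: "hs_domain \<Rightarrow> nat \<Rightarrow> real" where
  "grading_element D =
     (THE h. (\<forall>i. i \<notin> {1..lie_rank (fst D)} \<longrightarrow> h i = 0) \<and>
             (\<forall>j\<in>{1..lie_rank (fst D)}.
                pairing (fst D) h (simple_root (fst D) j) = (if j = snd D then -2 else 0)))"

definition E_val :: "hs_domain \<Rightarrow> weight \<Rightarrow> real" where
  "E_val D \<nu> = pairing (fst D) (grading_element D) \<nu>"

definition odd_integer :: "real \<Rightarrow> bool" where
  "odd_integer x \<longleftrightarrow> (\<exists>k::int. odd k \<and> x = of_int k)"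

definition dominant_integral :: "cartan_type \<Rightarrow> weight \<Rightarrow> bool" where
  "dominant_integral X lam \<longleftrightarrow> (\<exists>m :: nat \<Rightarrow> nat. lam = (\<Sum>i\<in>{1..lie_rank X}. real (m i) *\<^sub>W \<omega> i))"


section \<open>Representations of the simple Lie algebra\<close>

text \<open>By Serre's theorem the simple Lie algebra of type \<open>X\<close> is presented by Chevalley generators
  \<open>e\<^sub>i, f\<^sub>i, h\<^sub>i\<close> (\<open>e\<^sub>i\<close> of weight \<open>\<sigma>\<^sub>i\<close>, \<open>f\<^sub>i\<close> of weight \<open>-\<sigma>\<^sub>i\<close>, and \<open>h\<^sub>i = \<sigma>\<^sub>i\<^sup>\<or>\<close>). So a
  finite-dimensional representation is a family of complex square matrices that satisfies Serre's
  relations; the matrices act on the space \<open>carrier_vec (rep_dim V)\<close>.\<close>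

record lie_rep =
  rep_dim :: nat
  rep_e :: "nat \<Rightarrow> complex mat"
  rep_f :: "nat \<Rightarrow> complex mat"
  rep_h :: "nat \<Rightarrow> complex mat"

definition bracket :: "complex mat \<Rightarrow> complex mat \<Rightarrow> complex mat" where
  "bracket A B = A * B - B * A"

definition is_rep :: "cartan_type \<Rightarrow> lie_rep \<Rightarrow> bool" where
  "is_rep X V \<longleftrightarrow>
     (\<forall>i\<in>{1..lie_rank X}.
        {rep_e V i, rep_f V i, rep_h V i} \<subseteq> carrier_mat (rep_dim V) (rep_dim V)) \<and>
     (\<forall>i\<in>{1..lie_rank X}. \<forall>j\<in>{1..lie_rank X}.
        bracket (rep_h V i) (rep_h V j) = 0\<^sub>m (rep_dim V) (rep_dim V) \<and>
        bracket (rep_h V i) (rep_e V j) = of_int (cartan X j i) \<cdot>\<^sub>m rep_e V j \<and>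
        bracket (rep_h V i) (rep_f V j) = of_int (- cartan X j i) \<cdot>\<^sub>m rep_f V j \<and>
        bracket (rep_e V i) (rep_f V j) =
          (if i = j then rep_h V i else 0\<^sub>m (rep_dim V) (rep_dim V)) \<and>
        (i \<noteq> j \<longrightarrow>
          (bracket (rep_e V i) ^^ nat (1 - cartan X j i)) (rep_e V j) =
            0\<^sub>m (rep_dim V) (rep_dim V) \<and>
          (bracket (rep_f V i) ^^ nat (1 - cartan X j i)) (rep_f V j) =
            0\<^sub>m (rep_dim V) (rep_dim V)))"

definition is_subrep :: "cartan_type \<Rightarrow> lie_rep \<Rightarrow> complex vec set \<Rightarrow> bool" where
  "is_subrep X V W \<longleftrightarrow>
     W \<subseteq> carrier_vec (rep_dim V) \<and> 0\<^sub>v (rep_dim V) \<in> W \<and>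
     (\<forall>v\<in>W. \<forall>w\<in>W. v + w \<in> W) \<and> (\<forall>c. \<forall>v\<in>W. c \<cdot>\<^sub>v v \<in> W) \<and>
     (\<forall>i\<in>{1..lie_rank X}. \<forall>v\<in>W.
        rep_e V i *\<^sub>v v \<in> W \<and> rep_f V i *\<^sub>v v \<in> W \<and> rep_h V i *\<^sub>v v \<in> W)"

definition irreducible_rep :: "cartan_type \<Rightarrow> lie_rep \<Rightarrow> bool" where
  "irreducible_rep X V \<longleftrightarrow>
     is_rep X V \<and> rep_dim V > 0 \<and>
     (\<forall>W. is_subrep X V W \<longrightarrow> W = {0\<^sub>v (rep_dim V)} \<or> W = carrier_vec (rep_dim V))"

definition has_highest_weight :: "cartan_type \<Rightarrow> lie_rep \<Rightarrow> weight \<Rightarrow> bool" where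
  "has_highest_weight X V lam \<longleftrightarrow>
     (\<exists>v\<in>carrier_vec (rep_dim V). v \<noteq> 0\<^sub>v (rep_dim V) \<and>
        (\<forall>i\<in>{1..lie_rank X}. rep_e V i *\<^sub>v v = 0\<^sub>v (rep_dim V) \<and>
           rep_h V i *\<^sub>v v = complex_of_real (lam i) \<cdot>\<^sub>v v))"

definition is_irrep :: "cartan_type \<Rightarrow> weight \<Rightarrow> lie_rep \<Rightarrow> bool" where
  "is_irrep X lam V \<longleftrightarrow> irreducible_rep X V \<and> has_highest_weight X V lam"

text \<open>The real form is the fixed Lie algebra of the antilinear involution \<open>\<theta>\<close> with
  \<open>\<theta> h\<^sub>i = -h\<^sub>i\<close> (the Cartan subalgebra is compact), \<open>\<theta> e\<^sub>i = -f\<^sub>i\<close> for the compact simple roots and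
  \<open>\<theta> e\<^sub>I = f\<^sub>I\<close> for the noncompact one; then a root is noncompact iff its coefficient at
  \<open>\<sigma>\<^sub>I\<close>, which is 0, 1 or -1, is nonzero. A representation is the complexification of a real
  representation of the real form iff it has an antilinear involution \<open>J\<close> with
  \<open>J \<circ> x = \<theta> x \<circ> J\<close> for all \<open>x\<close>; the real representation is then the set of fixed points of \<open>J\<close>.\<close>

definition theta_sign :: "hs_domain \<Rightarrow> nat \<Rightarrow> complex" where
  "theta_sign D i = (if i = snd D then 1 else -1)"

definition real_structure :: "hs_domain \<Rightarrow> lie_rep \<Rightarrow> (complex vec \<Rightarrow> complex vec) \<Rightarrow> bool" where
  "real_structure D V J \<longleftrightarrow>
     (\<forall>v\<in>carrier_vec (rep_dim V). J v \<in> carrier_vec (rep_dim V) \<and> J (J v) = v) \<and>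
     (\<forall>v\<in>carrier_vec (rep_dim V). \<forall>w\<in>carrier_vec (rep_dim V). J (v + w) = J v + J w) \<and>
     (\<forall>c. \<forall>v\<in>carrier_vec (rep_dim V). J (c \<cdot>\<^sub>v v) = cnj c \<cdot>\<^sub>v J v) \<and>
     (\<forall>i\<in>{1..lie_rank (fst D)}. \<forall>v\<in>carrier_vec (rep_dim V).
        J (rep_e V i *\<^sub>v v) = theta_sign D i \<cdot>\<^sub>v (rep_f V i *\<^sub>v J v) \<and>
        J (rep_f V i *\<^sub>v v) = theta_sign D i \<cdot>\<^sub>v (rep_e V i *\<^sub>v J v) \<and>
        J (rep_h V i *\<^sub>v v) = - (rep_h V i *\<^sub>v J v))"

definition is_real_rep :: "hs_domain \<Rightarrow> lie_rep \<Rightarrow> bool" where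
  "is_real_rep D V \<longleftrightarrow> (\<exists>J. real_structure D V J)"


section \<open>Homogeneous variations of Hodge structure\<close>

text \<open>The Hodge summand of type \<open>(p, -p-1)\<close> is the \<open>(2p+1)\<close>-eigenspace of \<open>E\<close>. The variation (of
  weight -1) exists when \<open>lam\<close> is dominant integral and \<open>E(lam)\<close> is odd. Its level does not depend
  on whether the underlying representation is \<open>V\<close> or \<open>V \<oplus> V'\<close>.\<close>

definition defines_VHS :: "hs_domain \<Rightarrow> weight \<Rightarrow> bool" where
  "defines_VHS D lam \<longleftrightarrow> dominant_integral (fst D) lam \<and> odd_integer (E_val D lam)"

definition VHS_level :: "hs_domain \<Rightarrow> weight \<Rightarrow> real" where
  "VHS_level D lam = max (- E_val D lam) (- E_val D (tau (fst D) lam))"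

definition E_matrix :: "hs_domain \<Rightarrow> lie_rep \<Rightarrow> complex mat" where
  "E_matrix D V = mat (rep_dim V) (rep_dim V)
     (\<lambda>rc. \<Sum>i\<in>{1..lie_rank (fst D)}. complex_of_real (grading_element D i) * rep_h V i $$ rc)"

definition E_eigenspace_dim :: "hs_domain \<Rightarrow> lie_rep \<Rightarrow> int \<Rightarrow> nat" where
  "E_eigenspace_dim D V k = kernel_dim (E_matrix D V - of_int k \<cdot>\<^sub>m 1\<^sub>m (rep_dim V))"

text \<open>The Hodge number of type \<open>(p, -p-1)\<close>, where \<open>V\<close> has highest weight \<open>lam\<close> and \<open>V'\<close> has highest
  weight \<open>tau lam\<close>. The underlying representation is \<open>V\<close> if it is the complexification of a real
  representation, and \<open>V \<oplus> V'\<close> otherwise.\<close>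

definition hodge_number :: "hs_domain \<Rightarrow> lie_rep \<Rightarrow> lie_rep \<Rightarrow> int \<Rightarrow> nat" where
  "hodge_number D V V' p =
     (if is_real_rep D V then E_eigenspace_dim D V (2 * p + 1)
      else E_eigenspace_dim D V (2 * p + 1) + E_eigenspace_dim D V' (2 * p + 1))"

text \<open>The representations \<open>V\<close> and \<open>V'\<close> exist and are unique up to isomorphism, so the choice below is
  immaterial.\<close>

definition calabi_yau :: "hs_domain \<Rightarrow> weight \<Rightarrow> bool" where
  "calabi_yau D lam \<longleftrightarrow>
     (\<exists>V V'. is_irrep (fst D) lam V \<and> is_irrep (fst D) (tau (fst D) lam) V' \<and>
        (\<exists>p q. hodge_number D V V' p = 1 \<and> hodge_number D V V' q = 1 \<and>
           (\<forall>r. hodge_number D V V' r \<noteq> 0 \<longrightarrow> p \<le> r \<and> r \<le> q)))"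

definition mu :: "hs_domain \<Rightarrow> weight \<Rightarrow> real" where
  "mu D lam = (E_val D (dot_refl (fst D) (snd D) lam) - 1) / 2"

definition admits_inf_normal_function :: "hs_domain \<Rightarrow> weight \<Rightarrow> bool" where
  "admits_inf_normal_function D lam \<longleftrightarrow> mu D lam \<ge> 0"

end

theory Submission
  imports Defs
begin

text \<open>
  Write \<open>w i = -E(\<omega>\<^sub>i)\<close>; these are positive integers, twice the entries of the inverse Cartan
  matrix in the row of the special node \<open>k\<close>. Since \<open>E(\<sigma>\<^sub>k) = -2\<close>, the condition \<open>\<mu>(\<lambda>) \<ge> 0\<close> says
  \<open>\<Sum>i\<noteq>k. w i * m i + (w k - 2) * m k \<le> 1\<close>. With the parity condition this leaves the infinite
  families when \<open>w k \<le> 2\<close>, and \<open>\<lambda> = \<omega>\<^sub>k\<close> with \<open>w k = 3\<close> or \<open>\<lambda> = \<omega>\<^sub>a\<close> with \<open>w a = 1\<close> when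
  \<open>w k \<ge> 3\<close>. The last possibility only occurs for the standard representation and its dual; their
  weights are permuted up to sign by the Weyl group and take the values 1 and -1 at \<open>E\<close>, so the
  level is 1.

  The longest Weyl group element is controlled by counting inversions of positive coroots. In the
  root systems concerned the coroots are the lattice vectors of norm 2 (of norm 2 or 4 in type
  \<open>C\<close>), so positivity and finiteness follow from the positive definiteness of the form.

  In the four exceptional cases all weight spaces of \<open>V\<close> are one-dimensional, which gives explicit
  Chevalley generators and an explicit real structure \<open>v\<^sub>\<mu> \<mapsto> \<plusminus>v\<^bsub>-\<mu>\<^esub>\<close>; the Hodge numbers are then
  counts of weights.
\<close>

section \<open>The Cartan matrices\<close>

text \<open>What shapes the proof is \<open>tau\<close>: the level and the second representation
  depend on a longest element defined by maximal word length, in arbitrary rank. It is never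
  computed. Two facts suffice: \<open>- tau X lam\<close> lies in the Weyl orbit of
  \<open>lam\<close>, and \<open>tau X lam\<close> is dominant when \<open>lam\<close> is. The first
  bounds the level of standard weights; both together give tau(\<omega>) = \<omega> in the
  exceptional cases, where the orbit has a single antidominant member. To obtain them, words act on
  integer coroot vectors, where signs are read off coordinatewise and the invariant form is
  integral. Definiteness of the form comes from one positive vector, the sum of the positive
  coroots, and also makes the grading element unique. The Calabi-Yau property requires actual
  irreducible representations, so their weights are kept as literal integer lists and every relation
  becomes an identity of integer coefficients, derived from the minuscule property or evaluated. The
  sign of the real structure is a character of the root lattice, evaluated through the sum of the
  positive coroots plus E.\<close>

definition cartan_apply :: "cartan_type \<Rightarrow> (nat \<Rightarrow> 'a::comm_ring_1) \<Rightarrow> nat \<Rightarrow> 'a" where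
  "cartan_apply X x i = (\<Sum>j\<in>{1..lie_rank X}. of_int (cartan X i j) * x j)"

lemma cartan_diag: "cartan X i i = 2"
  by (cases X) auto

lemma cartan_nonpos: "i \<noteq> j \<Longrightarrow> cartan X i j \<le> 0"
  by (cases X) auto

lemma sum_delta_mult:
  fixes x :: "nat \<Rightarrow> 'a::comm_ring_1"
  assumes "finite A"
  shows "(\<Sum>j\<in>A. (if j = k then c else 0) * x j) = (if k \<in> A then c * x k else 0)"
  using assms by (simp add: if_distrib[of "\<lambda>c. c * _"] cong: if_cong)

text \<open>Here \<open>cartan_apply X x i\<close> is the value of the simple root
  \<sigma>\<open>\<^sub>i\<close> on the vector with coroot coordinates \<open>x\<close>. The rows
  are computed over any commutative ring, so that they serve both the integer coroots and the real
  grading element.\<close>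

lemma cartan_apply_A:
  fixes x :: "nat \<Rightarrow> 'a::comm_ring_1"
  assumes "i \<in> {1..n}"
  shows "cartan_apply (TypeA n) x i =
    2 * x i - (if 1 < i then x (i - 1) else 0) - (if i < n then x (Suc i) else 0)"
proof -
  have **: "cartan_apply (TypeA n) x i = (\<Sum>j\<in>{1..n}. (if j = i then 2 else 0) * x j
      + (if j = i - 1 then -1 else 0) * x j + (if j = Suc i then -1 else 0) * x j)"
    unfolding cartan_apply_def using assms by (intro sum.cong) auto
  then show ?thesis
    using assms by (simp add: sum.distrib sum_delta_mult; auto)
qed

lemma cartan_apply_B:
  fixes x :: "nat \<Rightarrow> 'a::comm_ring_1"
  assumes "i \<in> {1..n}" "n \<ge> 2"
  shows "cartan_apply (TypeB n) x i = 2 * x i - (if 1 < i then x (i - 1) else 0)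
    - (if i < n then (if Suc i = n then 2 else 1) * x (Suc i) else 0)"
proof -
  have *: "cartan_apply (TypeB n) x i = (\<Sum>j\<in>{1..n}. (if j = i then 2 else 0) * x j
      + (if j = i - 1 then -1 else 0) * x j
      + (if j = Suc i then (if Suc i = n then -2 else -1) else 0) * x j)"
    unfolding cartan_apply_def using assms by (intro sum.cong) auto
  have **: "cartan_apply (TypeB n) x i = (if i \<in> {1..n} then 2 * x i else 0)
      + (if i - 1 \<in> {1..n} then -1 * x (i - 1) else 0)
      + (if Suc i \<in> {1..n} then (if Suc i = n then -2 else -1) * x (Suc i) else 0)"
    unfolding * by (simp only: sum.distrib sum_delta_mult finite_atLeastAtMost)
  have m: "i - 1 \<in> {1..n} \<longleftrightarrow> 1 < i" "Suc i \<in> {1..n} \<longleftrightarrow> i < n" "i \<in> {1..n}"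
    using assms by auto
  show ?thesis
    unfolding ** using m
    by (cases "1 < i"; cases "i < n"; cases "Suc i = n"; simp only: if_True if_False; simp)
qed

lemma cartan_apply_C:
  fixes x :: "nat \<Rightarrow> 'a::comm_ring_1"
  assumes "i \<in> {1..n}"
  shows "cartan_apply (TypeC n) x i = 2 * x i
    - (if 1 < i then (if i = n then 2 else 1) * x (i - 1) else 0) - (if i < n then x (Suc i) else 0)"
proof -
  have *: "cartan_apply (TypeC n) x i = (\<Sum>j\<in>{1..n}. (if j = i then 2 else 0) * x j
      + (if j = i - 1 then (if i = n then -2 else -1) else 0) * x j
      + (if j = Suc i then -1 else 0) * x j)"
    unfolding cartan_apply_def lie_rank.simps
  proof (rule sum.cong[OF refl], goal_cases)
    case (1 j)
    then have "j = i - 1 \<longleftrightarrow> Suc j = i" using assms by auto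
    then show ?case
      by (cases "j = i"; cases "Suc j = i"; cases "Suc i = j"; cases "i = n") simp_all
  qed
  have **: "cartan_apply (TypeC n) x i = (if i \<in> {1..n} then 2 * x i else 0)
      + (if i - 1 \<in> {1..n} then (if i = n then -2 else -1) * x (i - 1) else 0)
      + (if Suc i \<in> {1..n} then -1 * x (Suc i) else 0)"
    unfolding * by (simp only: sum.distrib sum_delta_mult finite_atLeastAtMost)
  have m: "i - 1 \<in> {1..n} \<longleftrightarrow> 1 < i" "Suc i \<in> {1..n} \<longleftrightarrow> i < n" "i \<in> {1..n}"
    using assms by auto
  show ?thesis
    unfolding ** using m
    by (cases "1 < i"; cases "i < n"; cases "Suc i = n"; simp only: if_True if_False; simp)
qed

lemma cartan_apply_D:
  fixes x :: "nat \<Rightarrow> 'a::comm_ring_1"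
  assumes "i \<in> {1..n}" "n \<ge> 4"
  shows "cartan_apply (TypeD n) x i = 2 * x i
    - (if i = n then x (n - 2) else (if 1 < i then x (i - 1) else 0)
        + (if Suc i < n then x (Suc i) else 0) + (if i + 2 = n then x n else 0))"
proof -
  \<comment> \<open>With this shift the branch node is \<open>k + 2\<close> and the two spin nodes
    are \<open>k + 3\<close> and \<open>k + 4\<close>; each kind of row is summed over its own
    support.\<close>
  obtain k where n: "n = k + 4" using assms(2) by (metis add.commute le_Suc_ex)
  have supp: "cartan_apply (TypeD n) x i = (\<Sum>j\<in>S. of_int (cartan (TypeD n) i j) * x j)"
    if "S \<subseteq> {1..n}" "\<And>j. j \<in> {1..n} - S \<Longrightarrow> cartan (TypeD n) i j = 0" for S
    unfolding cartan_apply_def lie_rank.simps using that by (intro sum.mono_neutral_right) auto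
  consider "i = 1" | "2 \<le> i" "i < k + 2" | "i = k + 2" | "i = k + 3" | "i = k + 4"
    using assms n by fastforce
  then show ?thesis
  proof cases
    case 1
    have "cartan_apply (TypeD n) x i = (\<Sum>j\<in>{1, 2}. of_int (cartan (TypeD n) i j) * x j)"
      by (rule supp) (auto simp: 1 n)
    then show ?thesis using 1 n by (simp add: eval_nat_numeral)
  next
    case 2
    then obtain m where m: "i = m + 2" "m < k" by (metis add.commute add_less_cancel_right le_Suc_ex)
    have "cartan_apply (TypeD n) x i =
        (\<Sum>j\<in>{m + 1, m + 2, m + 3}. of_int (cartan (TypeD n) i j) * x j)"
      using m by (intro supp) (auto simp: n)
    then show ?thesis using m n by (simp add: eval_nat_numeral)
  next
    case 3
    have "cartan_apply (TypeD n) x i =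
        (\<Sum>j\<in>{k + 1, k + 2, k + 3, k + 4}. of_int (cartan (TypeD n) i j) * x j)"
      by (rule supp) (auto simp: n 3)
    then show ?thesis by (simp add: 3 n numeral_3_eq_3)
  next
    case 4
    have "cartan_apply (TypeD n) x i =
        (\<Sum>j\<in>{k + 2, k + 3}. of_int (cartan (TypeD n) i j) * x j)"
      by (rule supp) (auto simp: n 4)
    then show ?thesis by (simp add: 4 n)
  next
    case 5
    have "cartan_apply (TypeD n) x i =
        (\<Sum>j\<in>{k + 2, k + 4}. of_int (cartan (TypeD n) i j) * x j)"
      by (rule supp) (auto simp: n 5)
    then show ?thesis by (simp add: 5 n)
  qed
qed

lemma atLeast1_atMost7: "{1..7::nat} = {1, 2, 3, 4, 5, 6, 7}"
  by auto

lemma cartan_apply_E7: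
  fixes x :: "nat \<Rightarrow> 'a::comm_ring_1"
  shows "cartan_apply TypeE7 x 1 = 2 * x 1 - x 3"
    "cartan_apply TypeE7 x 2 = 2 * x 2 - x 4"
    "cartan_apply TypeE7 x 3 = 2 * x 3 - x 1 - x 4"
    "cartan_apply TypeE7 x 4 = 2 * x 4 - x 2 - x 3 - x 5"
    "cartan_apply TypeE7 x 5 = 2 * x 5 - x 4 - x 6"
    "cartan_apply TypeE7 x 6 = 2 * x 6 - x 5 - x 7"
    "cartan_apply TypeE7 x 7 = 2 * x 7 - x 6"
  unfolding cartan_apply_def lie_rank.simps atLeast1_atMost7
  by (simp_all add: doubleton_eq_iff)

text \<open>The coordinates of \<open>2\<rho>\<^sup>\<or>\<close>; the values in types \<open>B\<close> and \<open>D\<close> are doubled once more.\<close>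

fun two_rho_check :: "cartan_type \<Rightarrow> nat \<Rightarrow> real" where
  "two_rho_check (TypeA n) i = real i * (real n + 1 - real i)"
| "two_rho_check (TypeB n) i =
     (if i = n then real n * (real n + 1) else 2 * real i * (2 * real n + 1 - real i))"
| "two_rho_check (TypeC n) i = real i * (2 * real n - real i)"
| "two_rho_check (TypeD n) i =
     (if i + 1 \<ge> n then real n * (real n - 1) else 2 * real i * (2 * real n - 1 - real i))"
| "two_rho_check TypeE7 i =
     (if i = 1 then 34 else if i = 2 then 49 else if i = 3 then 66 else if i = 4 then 96
      else if i = 5 then 75 else if i = 6 then 52 else 27)"

text \<open>The bounds keep the end rows of types B and D in their generic shape, while
  \<open>TypeC 1\<close> stays available for the domain III of rank one.\<close>

fun good_type :: "cartan_type \<Rightarrow> bool" where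
  "good_type (TypeA n) = (n \<ge> 1)"
| "good_type (TypeB n) = (n \<ge> 2)"
| "good_type (TypeC n) = (n \<ge> 1)"
| "good_type (TypeD n) = (n \<ge> 4)"
| "good_type TypeE7 = True"

text \<open>The sum of the positive coroots pairs to 2 with every simple root, hence to 4 in the
  doubled types. A positive vector with positive image is what makes a matrix with nonpositive
  off-diagonal entries definite.\<close>

lemma cartan_apply_two_rho_check:
  assumes "good_type X" "i \<in> {1..lie_rank X}"
  shows "cartan_apply X (two_rho_check X) i \<ge> 2"
proof (cases X)
  case (TypeA n)
  with assms have i: "i \<in> {1..n}" by simp
  then obtain k where k: "i = Suc k" using Suc_le_D by force
  with i obtain l where l: "n = Suc (k + l)" by (auto simp: le_iff_add)
  show ?thesis
    unfolding TypeA cartan_apply_A[OF i] unfolding k l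
    by (cases "l = 0"; cases "k = 0"; simp add: algebra_simps)
next
  case (TypeB n)
  with assms have i: "i \<in> {1..n}" and n: "2 \<le> n" by simp_all
  then obtain k where k: "i = Suc k" using Suc_le_D by force
  with i obtain l where l: "n = Suc (k + l)" by (auto simp: le_iff_add)
  show ?thesis
    unfolding TypeB cartan_apply_B[OF i n] unfolding k l using n[unfolded l]
    by (cases "l = 0"; cases "l = 1"; cases "k = 0"; simp add: algebra_simps)
next
  case (TypeC n)
  with assms have i: "i \<in> {1..n}" by simp
  then obtain k where k: "i = Suc k" using Suc_le_D by force
  with i obtain l where l: "n = Suc (k + l)" by (auto simp: le_iff_add)
  show ?thesis
    unfolding TypeC cartan_apply_C[OF i] unfolding k l
    by (cases "l = 0"; cases "k = 0"; simp add: algebra_simps)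
next
  case (TypeD n)
  with assms have i: "i \<in> {1..n}" and n: "4 \<le> n" by simp_all
  then obtain k where k: "i = Suc k" using Suc_le_D by force
  with i obtain l where l: "n = Suc (k + l)" by (auto simp: le_iff_add)
  show ?thesis
    unfolding TypeD cartan_apply_D[OF i n] unfolding k l using n[unfolded l]
    by (cases "l = 0"; cases "l = 1"; cases "l = 2"; cases "l = 3"; cases "k = 0"; simp add: algebra_simps)
next
  case TypeE7
  with assms have "i \<in> {1, 2, 3, 4, 5, 6, 7}" by (simp only: lie_rank.simps atLeast1_atMost7)
  with TypeE7 show ?thesis
    by (auto simp: cartan_apply_E7 cartan_apply_E7[unfolded One_nat_def])
qed

lemma two_rho_check_pos:
  assumes "good_type X" "i \<in> {1..lie_rank X}"
  shows "two_rho_check X i > 0"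
  using assms by (cases X) (auto intro!: mult_pos_pos)

section \<open>The invariant form and the grading element\<close>

text \<open>Half the squared norm of the simple coroot. Coroot lengths are inverse to root lengths,
  so the long coroot of type B sits at the short root \<open>n\<close>, and the short coroot of type
  C at the long root \<open>n\<close>.\<close>

fun symmetrizer :: "cartan_type \<Rightarrow> nat \<Rightarrow> int" where
  "symmetrizer (TypeB n) i = (if i = n then 2 else 1)"
| "symmetrizer (TypeC n) i = (if i = n then 1 else 2)"
| "symmetrizer X i = 1"

lemma symmetrizer_ge_1: "symmetrizer X i \<ge> 1"
  by (cases X) auto

lemma symmetrizer_sym:
  assumes "i \<in> {1..lie_rank X}" "j \<in> {1..lie_rank X}"
  shows "symmetrizer X i * cartan X i j = symmetrizer X j * cartan X j i"
  using assms by (cases X) (auto simp: insert_commute)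

text \<open>The Weyl-invariant form on the span of the coroots, scaled so that short coroots have
  norm 2.\<close>

definition cartan_form :: "cartan_type \<Rightarrow> (nat \<Rightarrow> 'a::comm_ring_1) \<Rightarrow> (nat \<Rightarrow> 'a) \<Rightarrow> 'a" where
  "cartan_form X x y = (\<Sum>i\<in>{1..lie_rank X}. of_int (symmetrizer X i) * x i * cartan_apply X y i)"

lemma cartan_apply_scale: "cartan_apply X (\<lambda>i. c * x i) j = c * cartan_apply X x j"
  by (simp add: cartan_apply_def sum_distrib_left mult_ac)

lemma cartan_apply_diff:
  "cartan_apply X (\<lambda>i. x i - y i) j = cartan_apply X x j - cartan_apply X y j"
  by (simp add: cartan_apply_def right_diff_distrib sum_subtractf)

lemma cartan_apply_of_int: "cartan_apply X (\<lambda>i. of_int (x i)) j = of_int (cartan_apply X x j)"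
  by (simp add: cartan_apply_def)

lemma cartan_form_double_sum:
  "cartan_form X x y = (\<Sum>i\<in>{1..lie_rank X}. \<Sum>j\<in>{1..lie_rank X}.
     of_int (symmetrizer X i * cartan X i j) * (x i * y j))"
  by (simp add: cartan_form_def cartan_apply_def sum_distrib_left mult_ac)

lemma cartan_form_sym: "cartan_form X x y = cartan_form X y x"
proof -
  let ?A = "{1..lie_rank X}"
  have "cartan_form X x y = (\<Sum>j\<in>?A. \<Sum>i\<in>?A. of_int (symmetrizer X i * cartan X i j) * (x i * y j))"
    unfolding cartan_form_double_sum by (rule sum.swap)
  also have "\<dots> = cartan_form X y x"
    unfolding cartan_form_double_sum
    by (intro sum.cong refl) (simp only: symmetrizer_sym mult.commute[of "x _"])
  finally show ?thesis .
qed

lemma cartan_form_scale_left: "cartan_form X (\<lambda>i. c * x i) z = c * cartan_form X x z"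
  by (simp add: cartan_form_def sum_distrib_left mult_ac)

lemma cartan_form_diff_left:
  "cartan_form X (\<lambda>i. x i - y i) z = cartan_form X x z - cartan_form X y z"
  by (simp add: cartan_form_def algebra_simps sum_subtractf)

lemma cartan_form_diff_right:
  "cartan_form X z (\<lambda>i. x i - y i) = cartan_form X z x - cartan_form X z y"
  using cartan_form_diff_left cartan_form_sym by metis

lemma cartan_form_scale_right: "cartan_form X z (\<lambda>i. c * x i) = c * cartan_form X z x"
  using cartan_form_scale_left cartan_form_sym by metis

lemma cartan_form_of_int:
  "cartan_form X (\<lambda>i. of_int (x i)) (\<lambda>i. of_int (y i)) = of_int (cartan_form X x y)"
  by (simp add: cartan_form_def cartan_apply_of_int)

text \<open>AM-GM: \<open>2 x\<^sub>i x\<^sub>j \<le> x\<^sub>i\<^sup>2 u\<^sub>j / u\<^sub>i + x\<^sub>j\<^sup>2 u\<^sub>i / u\<^sub>j\<close>, with the off-diagonal coefficients nonpositive.\<close>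

lemma symmetric_form_lower_bound:
  fixes b :: "nat \<Rightarrow> nat \<Rightarrow> real"
  assumes sym: "\<And>i j. i \<in> A \<Longrightarrow> j \<in> A \<Longrightarrow> b i j = b j i"
    and nonpos: "\<And>i j. i \<noteq> j \<Longrightarrow> b i j \<le> 0"
    and pos: "\<And>i. i \<in> A \<Longrightarrow> u i > 0"
  shows "(\<Sum>i\<in>A. (\<Sum>j\<in>A. b i j * u j) * (x i)\<^sup>2 / u i) \<le> (\<Sum>i\<in>A. \<Sum>j\<in>A. b i j * (x i * x j))"
proof -
  let ?f = "\<lambda>i j. b i j * ((x i)\<^sup>2 * u j / u i)"
  have "(\<Sum>i\<in>A. (\<Sum>j\<in>A. b i j * u j) * (x i)\<^sup>2 / u i) = (\<Sum>i\<in>A. \<Sum>j\<in>A. ?f i j)"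
    by (simp add: sum_distrib_right sum_distrib_left sum_divide_distrib mult_ac)
  moreover have "(\<Sum>i\<in>A. \<Sum>j\<in>A. ?f i j) = (\<Sum>i\<in>A. \<Sum>j\<in>A. b i j * ((x j)\<^sup>2 * u i / u j))"
    by (subst sum.swap) (auto intro!: sum.cong simp: sym)
  moreover have "(\<Sum>i\<in>A. \<Sum>j\<in>A. ?f i j + b i j * ((x j)\<^sup>2 * u i / u j))
      \<le> (\<Sum>i\<in>A. \<Sum>j\<in>A. 2 * (b i j * (x i * x j)))"
  proof (intro sum_mono)
    fix i j assume ij: "i \<in> A" "j \<in> A"
    show "?f i j + b i j * ((x j)\<^sup>2 * u i / u j) \<le> 2 * (b i j * (x i * x j))"
    proof (cases "i = j")
      case True
      then show ?thesis using pos[OF ij(1)] by (simp add: power2_eq_square)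
    next
      case False
      have u: "u i > 0" "u j > 0" using pos ij by auto
      have "0 \<le> (x i * u j - x j * u i)\<^sup>2 / (u i * u j)" using u by simp
      also have "\<dots> = (x i)\<^sup>2 * u j / u i + (x j)\<^sup>2 * u i / u j - 2 * (x i * x j)"
        using u by (simp add: power2_eq_square field_simps)
      finally have "b i j * ((x i)\<^sup>2 * u j / u i + (x j)\<^sup>2 * u i / u j - 2 * (x i * x j)) \<le> 0"
        using nonpos[OF False] by (simp add: mult_nonpos_nonneg)
      then show ?thesis by (simp add: algebra_simps)
    qed
  qed
  ultimately show ?thesis
    by (simp add: sum.distrib sum_distrib_left[symmetric])
qed

text \<open>The AM-GM bound with the sum of the positive coroots as its positive vector: each
  weighted row sum is \<open>symmetrizer X i * cartan_apply X (two_rho_check X) i\<close>, at least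
  2. A bound by squares of coordinates gives definiteness and also finiteness of the sets of bounded
  norm.\<close>

lemma cartan_form_lower_bound:
  fixes x :: "nat \<Rightarrow> real"
  assumes "good_type X"
  shows "(\<Sum>i\<in>{1..lie_rank X}. 2 * (x i)\<^sup>2 / two_rho_check X i) \<le> cartan_form X x x"
proof -
  let ?A = "{1..lie_rank X}" and ?b = "\<lambda>i j. real_of_int (symmetrizer X i * cartan X i j)"
    and ?u = "two_rho_check X"
  have "(\<Sum>i\<in>?A. 2 * (x i)\<^sup>2 / ?u i) \<le> (\<Sum>i\<in>?A. (\<Sum>j\<in>?A. ?b i j * ?u j) * (x i)\<^sup>2 / ?u i)"
  proof (rule sum_mono)
    fix i assume i: "i \<in> ?A"
    have "(\<Sum>j\<in>?A. ?b i j * ?u j) = real_of_int (symmetrizer X i) * cartan_apply X ?u i"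
      by (simp add: cartan_apply_def sum_distrib_left mult_ac)
    moreover have "1 * 2 \<le> real_of_int (symmetrizer X i) * cartan_apply X ?u i"
      using cartan_apply_two_rho_check[OF assms i] symmetrizer_ge_1[of X i]
      by (intro mult_mono) auto
    ultimately show "2 * (x i)\<^sup>2 / ?u i \<le> (\<Sum>j\<in>?A. ?b i j * ?u j) * (x i)\<^sup>2 / ?u i"
      using two_rho_check_pos[OF assms i] by (intro divide_right_mono mult_right_mono) auto
  qed
  also have "\<dots> \<le> (\<Sum>i\<in>?A. \<Sum>j\<in>?A. ?b i j * (x i * x j))"
  proof (rule symmetric_form_lower_bound)
    fix i j :: nat assume "i \<noteq> j"
    then have "symmetrizer X i * cartan X i j \<le> 0"
      using symmetrizer_ge_1[of X i] cartan_nonpos[of i j X] by (intro mult_nonneg_nonpos) auto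
    then show "?b i j \<le> 0" by linarith
  qed (use two_rho_check_pos[OF assms] in \<open>simp_all only: symmetrizer_sym\<close>)
  finally show ?thesis unfolding cartan_form_double_sum .
qed

lemma cartan_form_eq_0D:
  fixes x :: "nat \<Rightarrow> real"
  assumes X: "good_type X" and 0: "cartan_form X x x \<le> 0" and i: "i \<in> {1..lie_rank X}"
  shows "x i = 0"
proof -
  let ?f = "\<lambda>i. 2 * (x i)\<^sup>2 / two_rho_check X i"
  have "?f i \<le> sum ?f {1..lie_rank X}"
    using two_rho_check_pos[OF X] i by (intro member_le_sum) (auto simp: less_imp_le)
  also have "\<dots> \<le> 0"
    using cartan_form_lower_bound[OF X, of x] 0 by simp
  finally have "(x i)\<^sup>2 \<le> 0"
    using two_rho_check_pos[OF X i] by (simp add: divide_le_0_iff del: power2_less_eq_zero_iff)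
  then show ?thesis by simp
qed

lemma simple_root_apply:
  "simple_root X i j = (if j \<in> {1..lie_rank X} then of_int (cartan X i j) else 0)"
proof -
  have "simple_root X i j = (\<Sum>k\<in>{1..lie_rank X}. (of_int (cartan X i k) *\<^sub>W \<omega> k) j)"
    unfolding simple_root_def by (induction rule: infinite_finite_induct) auto
  also have "\<dots> = (\<Sum>k\<in>{1..lie_rank X}. if k = j then of_int (cartan X i k) else 0)"
    by (intro sum.cong) (auto simp: wscale_def fund_weight_def)
  finally show ?thesis by simp
qed

lemma pairing_simple_root: "pairing X h (simple_root X j) = cartan_apply X h j"
  unfolding pairing_def cartan_apply_def by (intro sum.cong) (auto simp: simple_root_apply)

text \<open>Two solutions of the defining equations differ by a vector killed by the Cartan matrix.
  Such a vector has norm 0, so it vanishes; this discharges the definite description.\<close>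

lemma grading_element_eqI:
  assumes X: "good_type X" and supp: "\<And>i. i \<notin> {1..lie_rank X} \<Longrightarrow> h i = 0"
    and h: "\<And>j. j \<in> {1..lie_rank X} \<Longrightarrow> cartan_apply X h j = (if j = k then -2 else 0)"
  shows "grading_element (X, k) = h"
  unfolding grading_element_def fst_conv snd_conv pairing_simple_root
proof (rule the_equality)
  fix h' :: "nat \<Rightarrow> real"
  assume h': "(\<forall>i. i \<notin> {1..lie_rank X} \<longrightarrow> h' i = 0) \<and>
    (\<forall>j\<in>{1..lie_rank X}. cartan_apply X h' j = (if j = k then - 2 else 0))"
  let ?d = "\<lambda>i. h' i - h i"
  have "cartan_form X ?d ?d = 0"
    unfolding cartan_form_def using h h' by (simp add: cartan_apply_diff)
  then have "h' i = h i" if "i \<in> {1..lie_rank X}" for i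
    using cartan_form_eq_0D[OF X _ that, of ?d] by linarith
  then show "h' = h" using h' supp by (metis ext)
qed (use supp h in auto)

section \<open>Grading elements of the tube-type domains\<close>

lemma grading_element_A:
  assumes "p \<ge> 1"
  shows "grading_element (TypeA (2 * p - 1), p) =
    (\<lambda>i. if i \<le> p then - real i else if i < 2 * p then real i - 2 * real p else 0)"
proof (rule grading_element_eqI)
  fix i assume "i \<in> {1..lie_rank (TypeA (2 * p - 1))}"
  then have i: "i \<in> {1..2 * p - 1}" by simp
  then obtain k where k: "i = Suc k" using Suc_le_D by force
  have "(\<exists>l. p = Suc (Suc (k + l))) \<or> p = Suc k \<or> (\<exists>l. k = p + l)"
    by presburger
  then consider l where "p = Suc (Suc (k + l))" | "p = Suc k" | l where "k = p + l"
    by blast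
  then show "cartan_apply (TypeA (2 * p - 1))
      (\<lambda>i. if i \<le> p then - real i else if i < 2 * p then real i - 2 * real p else 0) i
      = (if i = p then - 2 else 0)"
    unfolding cartan_apply_A[OF i] using i unfolding k by cases auto
qed (use assms in auto)

lemma grading_element_B:
  assumes "n \<ge> 2"
  shows "grading_element (TypeB n, 1) =
    (\<lambda>i. if i \<in> {1..n} then if i = n then -1 else -2 else 0)"
proof (rule grading_element_eqI)
  fix i assume "i \<in> {1..lie_rank (TypeB n)}"
  then have i: "i \<in> {1..n}" by simp
  then show "cartan_apply (TypeB n) (\<lambda>i. if i \<in> {1..n} then if i = n then -1 else -2 else 0) i
      = (if i = 1 then - 2 else 0)"
    unfolding cartan_apply_B[OF i assms] using assms by auto
qed (use assms in auto)

lemma grading_element_C: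
  assumes "n \<ge> 1"
  shows "grading_element (TypeC n, n) = (\<lambda>i. if i \<le> n then - real i else 0)"
proof (rule grading_element_eqI)
  fix i assume "i \<in> {1..lie_rank (TypeC n)}"
  then have i: "i \<in> {1..n}" by simp
  then obtain k where k: "i = Suc k" using Suc_le_D by force
  show "cartan_apply (TypeC n) (\<lambda>i. if i \<le> n then - real i else 0) i = (if i = n then - 2 else 0)"
    unfolding cartan_apply_C[OF i] using i unfolding k by auto
qed (use assms in auto)

lemma grading_element_D_last:
  assumes "n \<ge> 4"
  shows "grading_element (TypeD n, n) = (\<lambda>i. if i + 2 \<le> n then - real i
    else if i + 1 = n then 1 - real n / 2 else if i = n then - real n / 2 else 0)"
proof (rule grading_element_eqI)
  fix i assume "i \<in> {1..lie_rank (TypeD n)}"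
  then have i: "i \<in> {1..n}" by simp
  then obtain k where k: "i = Suc k" using Suc_le_D by force
  with i obtain l where l: "n = Suc (k + l)" by (auto simp: le_iff_add)
  show "cartan_apply (TypeD n) (\<lambda>i. if i + 2 \<le> n then - real i
    else if i + 1 = n then 1 - real n / 2 else if i = n then - real n / 2 else 0) i
    = (if i = n then - 2 else 0)"
    unfolding cartan_apply_D[OF i assms] unfolding k l using assms[unfolded l]
    by (cases "l = 0"; cases "l = 1"; cases "l = 2"; cases "l = 3"; cases "k = 0";
        simp add: field_simps)
qed (use assms in auto)

lemma grading_element_D_first:
  assumes "n \<ge> 4"
  shows "grading_element (TypeD n, 1) =
    (\<lambda>i. if i \<in> {1..n} then if i + 2 \<le> n then -2 else -1 else 0)"
proof (rule grading_element_eqI)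
  fix i assume "i \<in> {1..lie_rank (TypeD n)}"
  then have i: "i \<in> {1..n}" by simp
  then obtain k where k: "i = Suc k" using Suc_le_D by force
  with i obtain l where l: "n = Suc (k + l)" by (auto simp: le_iff_add)
  show "cartan_apply (TypeD n) (\<lambda>i. if i \<in> {1..n} then if i + 2 \<le> n then -2 else -1 else 0) i
    = (if i = 1 then - 2 else 0)"
    unfolding cartan_apply_D[OF i assms] unfolding k l using assms[unfolded l]
    by (cases "l = 0"; cases "l = 1"; cases "l = 2"; cases "l = 3"; cases "k = 0";
        (simp; fail) | (simp, arith))
qed (use assms in auto)

lemma grading_element_E7:
  "grading_element (TypeE7, 7) = (\<lambda>i. if i = 1 then -2 else if i = 2 then -3 else if i = 3 then -4
    else if i = 4 then -6 else if i = 5 then -5 else if i = 6 then -4 else if i = 7 then -3 else 0)"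
proof (rule grading_element_eqI)
  fix i assume "i \<in> {1..lie_rank TypeE7}"
  then have "i \<in> {1, 2, 3, 4, 5, 6, 7}" by (simp only: lie_rank.simps atLeast1_atMost7)
  then show "cartan_apply TypeE7 (\<lambda>i. if i = 1 then -2 else if i = 2 then -3 else if i = 3 then -4
    else if i = 4 then -6 else if i = 5 then -5 else if i = 6 then -4 else if i = 7 then -3 else 0) i
    = (if i = 7 then - 2 else (0::real))"
    by (auto simp: cartan_apply_E7 cartan_apply_E7[unfolded One_nat_def])
qed auto

section \<open>The longest Weyl group element\<close>

definition unit_coroot :: "nat \<Rightarrow> nat \<Rightarrow> int" where
  "unit_coroot i = (\<lambda>j. if j = i then 1 else 0)"

definition coroot_lattice :: "cartan_type \<Rightarrow> (nat \<Rightarrow> int) set" where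
  "coroot_lattice X = {x. \<forall>i. i \<notin> {1..lie_rank X} \<longrightarrow> x i = 0}"

definition coroot_refl :: "cartan_type \<Rightarrow> nat \<Rightarrow> (nat \<Rightarrow> int) \<Rightarrow> nat \<Rightarrow> int" where
  "coroot_refl X i x = (\<lambda>j. x j - cartan_apply X x i * unit_coroot i j)"

text \<open>The action of a word on coroots is the transpose of its action on weights, so the letters are
  applied in the opposite order.\<close>

abbreviation coroot_word :: "cartan_type \<Rightarrow> nat list \<Rightarrow> (nat \<Rightarrow> int) \<Rightarrow> nat \<Rightarrow> int" where
  "coroot_word X \<equiv> fold (coroot_refl X)"

lemma cartan_apply_unit:
  "i \<in> {1..lie_rank X} \<Longrightarrow> cartan_apply X (unit_coroot i) j = cartan X j i"
  by (simp add: cartan_apply_def unit_coroot_def if_distrib cong: if_cong)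

lemma cartan_form_unit:
  "i \<in> {1..lie_rank X} \<Longrightarrow> cartan_form X (unit_coroot i) x = symmetrizer X i * cartan_apply X x i"
  unfolding cartan_form_def unit_coroot_def
  by (subst sum.remove[of _ i]) (auto intro!: sum.neutral)

lemma cartan_form_unit_unit:
  "i \<in> {1..lie_rank X} \<Longrightarrow> cartan_form X (unit_coroot i) (unit_coroot i) = 2 * symmetrizer X i"
  by (simp add: cartan_form_unit cartan_apply_unit cartan_diag)

lemma unit_coroot_lattice: "i \<in> {1..lie_rank X} \<Longrightarrow> unit_coroot i \<in> coroot_lattice X"
  by (auto simp: coroot_lattice_def unit_coroot_def)

lemma coroot_refl_lattice:
  "i \<in> {1..lie_rank X} \<Longrightarrow> x \<in> coroot_lattice X \<Longrightarrow> coroot_refl X i x \<in> coroot_lattice X"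
  by (auto simp: coroot_lattice_def coroot_refl_def unit_coroot_def)

lemma coroot_word_lattice:
  "set is \<subseteq> {1..lie_rank X} \<Longrightarrow> x \<in> coroot_lattice X \<Longrightarrow> coroot_word X is x \<in> coroot_lattice X"
  by (induction "is" arbitrary: x) (auto simp: coroot_refl_lattice)

lemma coroot_refl_refl:
  "i \<in> {1..lie_rank X} \<Longrightarrow> coroot_refl X i (coroot_refl X i x) = x"
  by (auto simp: coroot_refl_def fun_eq_iff cartan_apply_diff cartan_apply_scale cartan_apply_unit cartan_diag)

lemma coroot_refl_unit:
  "i \<in> {1..lie_rank X} \<Longrightarrow> coroot_refl X i (unit_coroot i) = (\<lambda>j. - unit_coroot i j)"
  by (auto simp: coroot_refl_def cartan_apply_unit cartan_diag)

lemma coroot_word_rev: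
  assumes "set is \<subseteq> {1..lie_rank X}"
  shows "coroot_word X (rev is) (coroot_word X is x) = x"
  using assms by (induction "is" arbitrary: x) (auto simp: coroot_refl_refl)

lemma coroot_word_rev':
  assumes "set is \<subseteq> {1..lie_rank X}"
  shows "coroot_word X is (coroot_word X (rev is) x) = x"
  using coroot_word_rev[of "rev is" X x] assms by simp

text \<open>The form of \<sigma>\<open>\<^sub>i\<^sup>\<or>\<close> with \<open>x\<close> is
  \<open>symmetrizer X i * cartan_apply X x i\<close>, and
  \<sigma>\<open>\<^sub>i\<^sup>\<or>\<close> has norm \<open>2 * symmetrizer X i\<close>; thus
  \<open>coroot_refl\<close> is the orthogonal reflection of the form.\<close>

lemma cartan_form_refl:
  assumes i: "i \<in> {1..lie_rank X}"
  shows "cartan_form X (coroot_refl X i x) (coroot_refl X i y) = cartan_form X x y"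
  unfolding coroot_refl_def cartan_form_diff_left cartan_form_diff_right
    cartan_form_scale_left cartan_form_scale_right
  using i by (simp add: cartan_form_sym[of X x "unit_coroot i"] cartan_form_unit cartan_form_unit_unit
      cartan_apply_unit cartan_diag algebra_simps)

lemma cartan_form_word:
  assumes "set is \<subseteq> {1..lie_rank X}"
  shows "cartan_form X (coroot_word X is x) (coroot_word X is y) = cartan_form X x y"
  using assms by (induction "is" arbitrary: x y) (auto simp: cartan_form_refl)

text \<open>Linearity in the one shape that occurs: a reflection subtracts a multiple of a simple
  coroot, and negation is the case of 0 minus once the vector.\<close>

lemma coroot_word_diff:
  "coroot_word X is (\<lambda>j. x j - c * y j) = (\<lambda>j. coroot_word X is x j - c * coroot_word X is y j)"
proof (induction "is" arbitrary: x y)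
  case (Cons i "is")
  have "coroot_refl X i (\<lambda>j. x j - c * y j) = (\<lambda>j. coroot_refl X i x j - c * coroot_refl X i y j)"
    by (simp add: coroot_refl_def cartan_apply_diff cartan_apply_scale algebra_simps)
  then show ?case using Cons by simp
qed simp

lemma coroot_word_minus: "coroot_word X is (\<lambda>j. - x j) = (\<lambda>j. - coroot_word X is x j)"
proof -
  have "coroot_word X is (\<lambda>j. 0 - 1 * x j) = (\<lambda>j. coroot_word X is (\<lambda>j. 0) j - 1 * coroot_word X is x j)"
    by (rule coroot_word_diff)
  moreover have "coroot_word X is (\<lambda>j. 0) = (\<lambda>j. 0)"
    by (induction "is") (auto simp: coroot_refl_def cartan_apply_def)
  ultimately show ?thesis by simp
qed

text \<open>Reduces the sign of the image of a positive coroot to the signs of the images of the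
  simple ones. The induction is from the right because \<open>fold\<close> applies the last letter
  last.\<close>

lemma coroot_word_expand:
  assumes x: "x \<in> coroot_lattice X"
  shows "coroot_word X is x k = (\<Sum>i\<in>{1..lie_rank X}. x i * coroot_word X is (unit_coroot i) k)"
proof (induction "is" arbitrary: k rule: rev_induct)
  case Nil
  then show ?case using x
    by (auto simp: unit_coroot_def coroot_lattice_def if_distrib cong: if_cong)
next
  case (snoc j "is")
  let ?A = "{1..lie_rank X}"
  let ?y = "\<lambda>i. coroot_word X is (unit_coroot i)"
  have "coroot_word X is x = (\<lambda>k. \<Sum>i\<in>?A. x i * ?y i k)" using snoc by auto
  moreover have "cartan_apply X (\<lambda>k. \<Sum>i\<in>?A. x i * ?y i k) j = (\<Sum>i\<in>?A. x i * cartan_apply X (?y i) j)"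
    unfolding cartan_apply_def sum_distrib_left by (subst sum.swap) (simp add: mult_ac)
  ultimately show ?case
    by (simp add: coroot_refl_def[of X j] sum_subtractf sum_distrib_left right_diff_distrib mult_ac)
qed

section \<open>The Weyl group on weights and on coroots\<close>

lemma weyl_word_Cons: "weyl_word X (i # is) = simple_refl X i \<circ> weyl_word X is"
  by (simp add: weyl_word_def)

lemma pairing_diff_scale_left: "pairing X (\<lambda>j. a j - c * b j) \<nu> = pairing X a \<nu> - c * pairing X b \<nu>"
  by (simp add: pairing_def sum_subtractf sum_distrib_left algebra_simps)

lemma pairing_unit: "i \<in> {1..lie_rank X} \<Longrightarrow> pairing X (\<lambda>j. of_int (unit_coroot i j)) \<nu> = \<nu> i"
  by (simp add: pairing_def unit_coroot_def if_distrib[of real_of_int] if_distrib[of "\<lambda>c. c * _"] cong: if_cong)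

lemma pairing_simple_refl:
  "pairing X h (simple_refl X i \<nu>) = pairing X h \<nu> - \<nu> i * cartan_apply X h i"
  unfolding pairing_simple_root[symmetric] simple_refl_def
  by (simp add: pairing_def wscale_def sum_subtractf sum_distrib_left algebra_simps)

lemma pairing_word:
  assumes "set is \<subseteq> {1..lie_rank X}"
  shows "pairing X (\<lambda>j. of_int (x j)) (weyl_word X is \<nu>) =
    pairing X (\<lambda>j. of_int (coroot_word X is x j)) \<nu>"
  using assms
proof (induction "is" arbitrary: x)
  case (Cons i "is")
  let ?\<mu> = "weyl_word X is \<nu>"
  have i: "i \<in> {1..lie_rank X}" using Cons.prems by simp
  have "pairing X (\<lambda>j. of_int (x j)) (weyl_word X (i # is) \<nu>)
      = pairing X (\<lambda>j. of_int (x j)) (simple_refl X i ?\<mu>)"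
    by (simp add: weyl_word_def)
  also have "\<dots> = pairing X (\<lambda>j. of_int (x j)) ?\<mu> - of_int (cartan_apply X x i) * ?\<mu> i"
    by (simp add: pairing_simple_refl cartan_apply_of_int)
  also have "\<dots> = pairing X (\<lambda>j. of_int (coroot_refl X i x j)) ?\<mu>"
    using pairing_unit[OF i] by (simp add: coroot_refl_def pairing_diff_scale_left)
  finally show ?case using Cons by simp
qed (simp add: weyl_word_def)

lemma weyl_word_apply:
  assumes "set is \<subseteq> {1..lie_rank X}" "j \<in> {1..lie_rank X}"
  shows "weyl_word X is \<nu> j = pairing X (\<lambda>k. of_int (coroot_word X is (unit_coroot j) k)) \<nu>"
  using pairing_word[OF assms(1), of "unit_coroot j"] pairing_unit[OF assms(2)] by simp

lemma weyl_word_outside: "j \<notin> {1..lie_rank X} \<Longrightarrow> weyl_word X is \<nu> j = \<nu> j"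
  by (induction "is") (auto simp: weyl_word_def simple_refl_def wscale_def simple_root_apply)

text \<open>Pairing with the fundamental weights recovers the coefficients of a coroot vector, and
  pairing with the simple coroots recovers the coordinates of a weight; words fix all coordinates
  outside the index range. Equality in \<open>weyl_group\<close> can therefore be tested on integer
  vectors.\<close>

lemma weyl_word_eq_iff:
  assumes "is": "set is \<subseteq> {1..lie_rank X}" and js: "set js \<subseteq> {1..lie_rank X}"
  shows "weyl_word X is = weyl_word X js \<longleftrightarrow>
    (\<forall>x\<in>coroot_lattice X. coroot_word X is x = coroot_word X js x)"
proof
  assume eq: "weyl_word X is = weyl_word X js"
  show "\<forall>x\<in>coroot_lattice X. coroot_word X is x = coroot_word X js x"
  proof (intro ballI ext)
    fix x k assume x: "x \<in> coroot_lattice X"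
    have pairing_fund: "pairing X h (\<omega> k) = h k" if "k \<in> {1..lie_rank X}" for h
      using that by (simp add: pairing_def fund_weight_def if_distrib cong: if_cong)
    show "coroot_word X is x k = coroot_word X js x k"
    proof (cases "k \<in> {1..lie_rank X}")
      case True
      have "real_of_int (coroot_word X is x k) = of_int (coroot_word X js x k)"
        using pairing_word[OF "is", of x "\<omega> k"] pairing_word[OF js, of x "\<omega> k"] eq
        by (simp add: pairing_fund[OF True])
      then show ?thesis by linarith
    next
      case False
      then show ?thesis
        using coroot_word_lattice[OF "is" x] coroot_word_lattice[OF js x]
        by (simp add: coroot_lattice_def)
    qed
  qed
next
  assume eq: "\<forall>x\<in>coroot_lattice X. coroot_word X is x = coroot_word X js x"
  show "weyl_word X is = weyl_word X js"
  proof (intro ext)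
    fix \<nu> j
    show "weyl_word X is \<nu> j = weyl_word X js \<nu> j"
    proof (cases "j \<in> {1..lie_rank X}")
      case True
      then show ?thesis
        using eq unit_coroot_lattice[OF True] weyl_word_apply[OF "is" True] weyl_word_apply[OF js True]
        by metis
    qed (simp add: weyl_word_outside)
  qed
qed

text \<open>What counting inversions uses of a coroot system. Reducedness enters only through
  \<open>multiple_R\<close>, for multiples of simple coroots. The abstraction covers the simply
  laced types, with one norm, and type C, with two.\<close>

locale finite_coroots =
  fixes X :: cartan_type and R :: "(nat \<Rightarrow> int) set"
  assumes finite_R: "finite R"
    and R_lattice: "R \<subseteq> coroot_lattice X"
    and unit_R: "i \<in> {1..lie_rank X} \<Longrightarrow> unit_coroot i \<in> R"
    and refl_R: "i \<in> {1..lie_rank X} \<Longrightarrow> x \<in> R \<Longrightarrow> coroot_refl X i x \<in> R"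
    and minus_R: "x \<in> R \<Longrightarrow> (\<lambda>j. - x j) \<in> R"
    and sign_R: "x \<in> R \<Longrightarrow> (\<forall>i. 0 \<le> x i) \<or> (\<forall>i. x i \<le> 0)"
    and multiple_R: "(\<lambda>j. c * unit_coroot i j) \<in> R \<Longrightarrow> i \<in> {1..lie_rank X} \<Longrightarrow> c = 1 \<or> c = -1"
    and zero_R: "(\<lambda>j. 0) \<notin> R"
begin

abbreviation "I \<equiv> {1..lie_rank X}"

definition positive :: "(nat \<Rightarrow> int) set" where
  "positive = {x \<in> R. \<forall>i. 0 \<le> x i}"

definition inversions :: "nat list \<Rightarrow> nat" where
  "inversions is = card {x \<in> positive. \<forall>i. coroot_word X is x i \<le> 0}"

lemma finite_positive: "finite positive"
  by (simp add: positive_def finite_R)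

lemma word_R: "set is \<subseteq> I \<Longrightarrow> x \<in> R \<Longrightarrow> coroot_word X is x \<in> R"
  by (induction "is" arbitrary: x) (auto simp: refl_R)

lemma not_both_signs:
  assumes "x \<in> R" "\<forall>i. 0 \<le> x i" "\<forall>i. x i \<le> 0"
  shows False
proof -
  have "x = (\<lambda>j. 0)" using assms(2,3) by (intro ext antisym) auto
  then show False using assms(1) zero_R by simp
qed

lemma unit_positive: "i \<in> I \<Longrightarrow> unit_coroot i \<in> positive"
  using unit_R[of i] by (simp add: positive_def) (simp add: unit_coroot_def)

text \<open>A positive coroot that is not \<sigma>\<open>\<^sub>i\<^sup>\<or>\<close> has a positive
  coefficient at some other node, since multiples of \<sigma>\<open>\<^sub>i\<^sup>\<or>\<close> are
  excluded. The reflection changes only the coefficient at \<open>i\<close>, so this one survives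
  and decides the sign.\<close>

lemma refl_positive:
  assumes i: "i \<in> I" and x: "x \<in> positive" "x \<noteq> unit_coroot i"
  shows "coroot_refl X i x \<in> positive - {unit_coroot i}"
proof -
  have xR: "x \<in> R" "\<forall>i. 0 \<le> x i" using x by (auto simp: positive_def)
  have "\<exists>k. k \<noteq> i \<and> x k \<noteq> 0"
  proof (rule ccontr)
    assume "\<nexists>k. k \<noteq> i \<and> x k \<noteq> 0"
    then have eq: "(\<lambda>j. x i * unit_coroot i j) = x" by (intro ext) (auto simp: unit_coroot_def)
    have "(\<lambda>j. x i * unit_coroot i j) \<in> R" unfolding eq by (rule xR(1))
    from multiple_R[OF this i] have "x i = 1" using xR(2)[rule_format, of i] by linarith
    then have "x = unit_coroot i" using eq by simp
    with x show False by simp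
  qed
  then obtain k where k: "k \<noteq> i" "x k > 0" using xR(2) by (metis order_le_less)
  then have pos: "coroot_refl X i x k > 0" by (simp add: coroot_refl_def unit_coroot_def)
  have "coroot_refl X i x \<in> R" using i xR by (simp add: refl_R)
  with sign_R[OF this] pos have "coroot_refl X i x \<in> positive"
    by (auto simp: positive_def) (metis not_less)
  moreover have "coroot_refl X i x \<noteq> unit_coroot i"
    using pos k by (auto simp: unit_coroot_def)
  ultimately show ?thesis by simp
qed

text \<open>The reflection in \<open>i\<close> permutes the positive coroots other than
  \<sigma>\<open>\<^sub>i\<^sup>\<or>\<close> and negates that one, so a prepended letter changes
  the count by exactly one. Correction terms on both sides avoid subtraction of naturals.\<close>

lemma inversions_Cons:
  assumes "is": "set is \<subseteq> I" and i: "i \<in> I"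
  shows "inversions (i # is) + (if \<forall>k. coroot_word X is (unit_coroot i) k \<le> 0 then 1 else 0) =
    inversions is + (if \<forall>k. coroot_word X is (unit_coroot i) k \<le> 0 then 0 else 1)"
proof -
  let ?N = "\<lambda>x. \<forall>k. coroot_word X is x k \<le> 0" and ?g = "coroot_refl X i" and ?u = "unit_coroot i"
  let ?B = "{y \<in> positive - {?u}. ?N y}" and ?C = "{y \<in> positive - {?u}. ?N (?g y)}"
  have "?C = ?g ` ?B"
  proof (intro equalityI subsetI)
    fix y assume "y \<in> ?C"
    then have "?g y \<in> ?B" using refl_positive[OF i, of y] by blast
    then have "?g (?g y) \<in> ?g ` ?B" by (rule imageI)
    then show "y \<in> ?g ` ?B" unfolding coroot_refl_refl[OF i] .
  next
    fix y assume "y \<in> ?g ` ?B"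
    then obtain z where z: "z \<in> ?B" "y = ?g z" by blast
    then have "?g z \<in> positive - {?u}" using refl_positive[OF i, of z] by blast
    then show "y \<in> ?C" using z coroot_refl_refl[OF i, of z] by simp
  qed
  moreover have "inj_on ?g ?B" by (rule inj_on_inverseI[of _ ?g]) (rule coroot_refl_refl[OF i])
  ultimately have card: "card ?C = card ?B" by (simp add: card_image)
  have uR: "coroot_word X is ?u \<in> R" using "is" i by (simp add: word_R unit_R)
  have N: "?N (?g ?u) \<longleftrightarrow> \<not> ?N ?u"
    using not_both_signs[OF uR] sign_R[OF uR]
    by (auto simp: coroot_refl_unit[OF i] coroot_word_minus)
  have fin: "finite ?B" "finite ?C" using finite_positive by auto
  have "{x \<in> positive. ?N x} = (if ?N ?u then insert ?u ?B else ?B)"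
    using unit_positive[OF i] by auto
  then have 1: "inversions is = card ?B + (if ?N ?u then 1 else 0)"
    unfolding inversions_def using fin by simp
  have "{x \<in> positive. ?N (?g x)} = (if ?N (?g ?u) then insert ?u ?C else ?C)"
    using unit_positive[OF i] by auto
  then have 2: "inversions (i # is) = card ?C + (if ?N (?g ?u) then 1 else 0)"
    unfolding inversions_def using fin by simp
  show ?thesis using 1 2 card N by simp
qed

text \<open>At the first letter \<open>j\<close> that turns the image of \<open>\<sigma>\<^sub>i\<^sup>\<or>\<close> negative, this image is \<open>\<sigma>\<^sub>j\<^sup>\<or>\<close>;
  then the letter \<open>j\<close> and the prepended letter \<open>i\<close> cancel.\<close>

lemma exchange:
  assumes "set is \<subseteq> I" "i \<in> I" "\<forall>k. coroot_word X is (unit_coroot i) k \<le> 0"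
  shows "\<exists>js. length is = Suc (length js) \<and> set js \<subseteq> I \<and>
    (\<forall>x. coroot_word X js x = coroot_word X (i # is) x)"
  using assms
proof (induction "is" rule: rev_induct)
  case Nil
  then show ?case by (auto simp: unit_coroot_def dest: spec[of _ i])
next
  case (snoc j "is")
  have "is": "set is \<subseteq> I" and j: "j \<in> I" and i: "i \<in> I" using snoc.prems by auto
  let ?y = "coroot_word X is (unit_coroot i)"
  show ?case
  proof (cases "\<forall>k. ?y k \<le> 0")
    case True
    with snoc obtain js where "length is = Suc (length js)" "set js \<subseteq> I"
      "\<forall>x. coroot_word X js x = coroot_word X (i # is) x" by auto
    then show ?thesis using j by (intro exI[of _ "js @ [j]"]) auto
  next
    case False
    have yR: "?y \<in> R" using "is" i by (simp add: word_R unit_R)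
    with sign_R[OF yR] False have y: "?y \<in> positive" by (auto simp: positive_def)
    have yj: "?y = unit_coroot j"
    proof (rule ccontr)
      assume "?y \<noteq> unit_coroot j"
      from refl_positive[OF j y this] have "coroot_refl X j ?y \<in> R" "\<forall>k. 0 \<le> coroot_refl X j ?y k"
        by (auto simp: positive_def)
      then show False using not_both_signs snoc.prems(3) by auto
    qed
    have "coroot_word X is x = coroot_word X (i # is @ [j]) x" for x
    proof -
      let ?z = "coroot_word X is x"
      \<comment> \<open>The word sends \<sigma>\<open>\<^sub>i\<^sup>\<or>\<close> to
        \<sigma>\<open>\<^sub>j\<^sup>\<or>\<close>, so their norms agree. Invariance of the form
        then transports the value of the root \<open>i\<close> to that of the root \<open>j\<close>,
        which says that the word conjugates one reflection into the other.\<close>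
      have "2 * symmetrizer X j = 2 * symmetrizer X i"
        using cartan_form_word[OF "is", of "unit_coroot i" "unit_coroot i"]
        unfolding yj cartan_form_unit_unit[OF i] cartan_form_unit_unit[OF j] .
      then have ji: "symmetrizer X j = symmetrizer X i" by linarith
      have "symmetrizer X j * cartan_apply X ?z j = symmetrizer X i * cartan_apply X x i"
        using cartan_form_word[OF "is", of "unit_coroot i" x]
        unfolding yj cartan_form_unit[OF i] cartan_form_unit[OF j] .
      then have eq: "cartan_apply X ?z j = cartan_apply X x i"
        unfolding ji using symmetrizer_ge_1[of X i] by (simp only: mult_cancel_left) linarith
      have "coroot_word X is (coroot_refl X i x) = coroot_refl X j ?z"
        unfolding coroot_refl_def[of X i] coroot_word_diff yj by (simp add: coroot_refl_def[of X j] eq)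
      then show ?thesis by (simp add: coroot_refl_refl[OF j])
    qed
    then have "\<forall>x. coroot_word X is x = coroot_word X (i # is @ [j]) x" by blast
    moreover have "length (is @ [j]) = Suc (length is)" by simp
    ultimately show ?thesis using "is" by blast
  qed
qed

lemma weyl_length_le:
  "set is \<subseteq> I \<Longrightarrow> weyl_length X (weyl_word X is) \<le> length is"
  unfolding weyl_length_def by (intro Least_le) blast

lemma reduced_word:
  assumes "set is \<subseteq> I"
  obtains js where "set js \<subseteq> I" "weyl_word X js = weyl_word X is"
    "length js = weyl_length X (weyl_word X is)"
  using LeastI_ex[of "\<lambda>k. \<exists>js. length js = k \<and> set js \<subseteq> I \<and> weyl_word X js = weyl_word X is"]
    assms that unfolding weyl_length_def by blast

text \<open>The tail of a reduced word is reduced. If its first letter removed an inversion instead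
  of adding one, \<open>exchange\<close> would produce a shorter word for the same element.\<close>

lemma inversions_reduced:
  assumes "set is \<subseteq> I" "length is = weyl_length X (weyl_word X is)"
  shows "inversions is = length is"
  using assms
proof (induction "is")
  case Nil
  have "{x \<in> positive. \<forall>i. coroot_word X [] x i \<le> 0} = {}"
    using not_both_signs by (auto simp: positive_def)
  then show ?case by (simp only: inversions_def card.empty list.size)
next
  case (Cons i "is")
  have "is": "set is \<subseteq> I" and i: "i \<in> I" using Cons.prems by auto
  obtain ks where ks: "set ks \<subseteq> I" "weyl_word X ks = weyl_word X is"
    "length ks = weyl_length X (weyl_word X is)" using reduced_word[OF "is"] by blast
  have "weyl_word X (i # ks) = weyl_word X (i # is)" by (simp only: weyl_word_Cons ks(2))
  then have "length (i # is) \<le> length (i # ks)"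
    using weyl_length_le[of "i # ks"] ks(1) i Cons.prems(2) by simp
  then have "length is = weyl_length X (weyl_word X is)"
    using ks(3) weyl_length_le[OF "is"] by simp
  then have IH: "inversions is = length is" using Cons.IH "is" by simp
  have neg: "\<not> (\<forall>k. coroot_word X is (unit_coroot i) k \<le> 0)"
  proof
    assume "\<forall>k. coroot_word X is (unit_coroot i) k \<le> 0"
    from exchange[OF "is" i this] obtain js where js: "length is = Suc (length js)" "set js \<subseteq> I"
      "\<forall>x. coroot_word X js x = coroot_word X (i # is) x" by blast
    then have "weyl_word X js = weyl_word X (i # is)"
      using weyl_word_eq_iff[of js X "i # is"] "is" i by auto
    then show False using weyl_length_le[OF js(2)] js(1) Cons.prems by simp
  qed
  show ?case using inversions_Cons[OF "is" i] IH unfolding if_not_P[OF neg] by simp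
qed

lemma inversions_cong:
  assumes "set is \<subseteq> I" "set js \<subseteq> I" "weyl_word X is = weyl_word X js"
  shows "inversions is = inversions js"
proof -
  have "coroot_word X is x = coroot_word X js x" if "x \<in> positive" for x
    using that assms weyl_word_eq_iff R_lattice by (auto simp: positive_def)
  then show ?thesis unfolding inversions_def by (metis (no_types, lifting))
qed

lemma weyl_length_eq_inversions:
  assumes "set is \<subseteq> I"
  shows "weyl_length X (weyl_word X is) = inversions is"
proof -
  obtain js where js: "set js \<subseteq> I" "weyl_word X js = weyl_word X is"
    "length js = weyl_length X (weyl_word X is)" using reduced_word[OF assms] by blast
  then have "inversions js = length js" using inversions_reduced[OF js(1)] by metis
  then show ?thesis using inversions_cong[OF js(1) assms js(2)] js(3) by linarith
qed

lemma inversions_le: "inversions is \<le> card positive"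
  unfolding inversions_def by (intro card_mono finite_positive) auto

lemma inversions_max_iff:
  assumes "is": "set is \<subseteq> I"
  shows "inversions is = card positive \<longleftrightarrow> (\<forall>i\<in>I. \<forall>k. coroot_word X is (unit_coroot i) k \<le> 0)"
proof
  assume "inversions is = card positive"
  then have "{x \<in> positive. \<forall>i. coroot_word X is x i \<le> 0} = positive"
    unfolding inversions_def by (intro card_subset_eq finite_positive) auto
  then show "\<forall>i\<in>I. \<forall>k. coroot_word X is (unit_coroot i) k \<le> 0" using unit_positive by blast
next
  assume neg: "\<forall>i\<in>I. \<forall>k. coroot_word X is (unit_coroot i) k \<le> 0"
  have "coroot_word X is x k \<le> 0" if x: "x \<in> positive" for x k
    using x R_lattice neg by (subst coroot_word_expand)
      (auto simp: positive_def intro!: sum_nonpos mult_nonneg_nonpos)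
  then have "{x \<in> positive. \<forall>i. coroot_word X is x i \<le> 0} = positive" by auto
  then show "inversions is = card positive" by (simp add: inversions_def)
qed

text \<open>Take a word with the most inversions, which exists because the count is bounded. If it
  left some simple coroot positive, prepending that letter would add an inversion.\<close>

lemma ex_inversions_max: "\<exists>is. set is \<subseteq> I \<and> inversions is = card positive"
proof -
  obtain l where l: "set l \<subseteq> I" "\<forall>is. set is \<subseteq> I \<longrightarrow> inversions is \<le> inversions l"
    using ex_has_greatest_nat[of "\<lambda>is. set is \<subseteq> I" "[]" inversions "Suc (card positive)"] inversions_le
    by (auto simp only: less_Suc_eq_le list.set empty_subsetI)
  have "\<forall>k. coroot_word X l (unit_coroot i) k \<le> 0" if i: "i \<in> I" for i
  proof (rule ccontr)
    assume neg: "\<not> ?thesis"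
    have "inversions (i # l) = inversions l + 1"
      using inversions_Cons[OF l(1) i] unfolding if_not_P[OF neg] by simp
    moreover have "inversions (i # l) \<le> inversions l" using l i by (metis insert_subset list.set(2))
    ultimately show False by simp
  qed
  then show ?thesis using inversions_max_iff[OF l(1)] l(1) by blast
qed

text \<open>Applying \<open>js\<close> and then undoing \<open>l\<close> maps positive coroots to
  positive ones. The composite has no inversions, hence length 0, hence is the identity.\<close>

lemma inversions_max_unique:
  assumes l: "set l \<subseteq> I" "inversions l = card positive"
    and js: "set js \<subseteq> I" "inversions js = card positive"
  shows "weyl_word X js = weyl_word X l"
proof -
  have neg: "\<forall>k. coroot_word X is x k \<le> 0"
    if "set is \<subseteq> I" "inversions is = card positive" "x \<in> positive" for "is" x
  proof -
    have "{x \<in> positive. \<forall>i. coroot_word X is x i \<le> 0} = positive"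
      using that unfolding inversions_def by (intro card_subset_eq finite_positive) auto
    then show ?thesis using that by blast
  qed
  let ?m = "\<lambda>x j. - (x :: nat \<Rightarrow> int) j"
  have minus_pos: "?m (coroot_word X is x) \<in> positive"
    if "set is \<subseteq> I" "inversions is = card positive" "x \<in> positive" for "is" x
    using neg[OF that] that by (auto simp: positive_def intro!: minus_R word_R)
  have "inj_on (\<lambda>x. ?m (coroot_word X l x)) positive"
  proof (rule inj_on_inverseI[of _ "\<lambda>x. coroot_word X (rev l) (?m x)"])
    fix x show "coroot_word X (rev l) (?m (?m (coroot_word X l x))) = x"
      using coroot_word_rev[OF l(1), of x] by simp
  qed
  \<comment> \<open>An injective self-map of a finite set is onto, so every negative coroot is hit
    by \<open>l\<close>; this is what allows \<open>js\<close> to be compared with \<open>l\<close>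
    coroot by coroot.\<close>
  then have surj: "(\<lambda>x. ?m (coroot_word X l x)) ` positive = positive"
    using minus_pos[OF l] by (intro card_subset_eq finite_positive) (auto simp: card_image)
  let ?k = "js @ rev l"
  have "\<not> (\<forall>i. coroot_word X ?k x i \<le> 0)" if x: "x \<in> positive" for x
  proof -
    from minus_pos[OF js x] surj obtain z where z: "z \<in> positive"
      "?m (coroot_word X js x) = ?m (coroot_word X l z)" by (metis (no_types, lifting) imageE)
    then have "coroot_word X js x = coroot_word X l z" by (auto simp: fun_eq_iff)
    then have "coroot_word X ?k x = z" using coroot_word_rev[OF l(1)] by simp
    then show ?thesis using z not_both_signs[of z] by (auto simp: positive_def)
  qed
  then have "{x \<in> positive. \<forall>i. coroot_word X ?k x i \<le> 0} = {}" by blast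
  then have "inversions ?k = 0" by (simp only: inversions_def card.empty)
  have kI: "set ?k \<subseteq> I" using l js by simp
  obtain ks where ks: "weyl_word X ks = weyl_word X ?k" "length ks = weyl_length X (weyl_word X ?k)"
    using reduced_word[OF kI] by blast
  with \<open>inversions ?k = 0\<close> have "ks = []" unfolding weyl_length_eq_inversions[OF kI] by simp
  then have "weyl_word X [] = weyl_word X ?k" using ks(1) by simp
  with weyl_word_eq_iff[OF _ kI, of "[]"]
  have "\<forall>x\<in>coroot_lattice X. coroot_word X [] x = coroot_word X ?k x" by simp
  then have id: "coroot_word X (rev l) (coroot_word X js x) = x" if "x \<in> coroot_lattice X" for x
    using that by simp
  have "coroot_word X js x = coroot_word X l x" if "x \<in> coroot_lattice X" for x
    using id[OF that] coroot_word_rev'[OF l(1), of "coroot_word X js x"] by simp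
  then show ?thesis using weyl_word_eq_iff l js by blast
qed

text \<open>Replaces the definite description by a word that makes every simple coroot nonpositive,
  the form in which the longest element is used from here on.\<close>

lemma longest_element_word:
  obtains l where "set l \<subseteq> I" "longest_element X = weyl_word X l"
    "\<And>i k. i \<in> I \<Longrightarrow> coroot_word X l (unit_coroot i) k \<le> 0"
proof -
  obtain l where l: "set l \<subseteq> I" "inversions l = card positive" using ex_inversions_max by blast
  have "longest_element X = weyl_word X l"
    unfolding longest_element_def
  proof (rule the_equality)
    show "weyl_word X l \<in> weyl_group X \<and>
        (\<forall>w'\<in>weyl_group X. weyl_length X w' \<le> weyl_length X (weyl_word X l))"
      using l inversions_le by (auto simp: weyl_group_def weyl_length_eq_inversions)
  next
    fix w assume w: "w \<in> weyl_group X \<and> (\<forall>w'\<in>weyl_group X. weyl_length X w' \<le> weyl_length X w)"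
    then obtain js where js: "set js \<subseteq> I" "w = weyl_word X js" by (auto simp: weyl_group_def)
    have "weyl_word X l \<in> weyl_group X" using l by (auto simp: weyl_group_def)
    with w js l have "card positive \<le> inversions js" by (auto simp: weyl_length_eq_inversions)
    with inversions_le[of js] have "inversions js = card positive" by simp
    then show "w = weyl_word X l" using inversions_max_unique[OF l js(1)] js(2) by simp
  qed
  then show thesis using that l inversions_max_iff[OF l(1)] by blast
qed

end

section \<open>Coroots of bounded norm and the standard weights\<close>

definition coroots_of_norm :: "cartan_type \<Rightarrow> int set \<Rightarrow> (nat \<Rightarrow> int) set" where
  "coroots_of_norm X N = {x \<in> coroot_lattice X. cartan_form X x x \<in> N}"

lemma cartan_form_pos:
  assumes X: "good_type X" and x: "x \<in> coroot_lattice X" "x \<noteq> (\<lambda>_. 0)"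
  shows "cartan_form X x x > (0::int)"
proof (rule ccontr)
  assume "\<not> ?thesis"
  then have "cartan_form X (\<lambda>i. real_of_int (x i)) (\<lambda>i. real_of_int (x i)) \<le> 0"
    unfolding cartan_form_of_int by linarith
  then have "real_of_int (x i) = 0" if "i \<in> {1..lie_rank X}" for i
    using cartan_form_eq_0D[OF X, of "\<lambda>i. real_of_int (x i)"] that by blast
  then have "x i = 0" for i using x(1) unfolding coroot_lattice_def by (cases "i \<in> {1..lie_rank X}") auto
  with x(2) show False by auto
qed

lemma finite_coroots_of_norm:
  assumes X: "good_type X" and N: "\<And>m. m \<in> N \<Longrightarrow> m \<le> 4"
  shows "finite (coroots_of_norm X N)"
proof -
  let ?A = "{1..lie_rank X}" and ?u = "two_rho_check X"
  \<comment> \<open>A sum instead of a maximum: all terms are nonnegative, so it bounds every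
    coordinate at once. Norm at most 4 gives
    \<open>(x i)\<^sup>2 \<le> 2 * two_rho_check X i\<close>.\<close>
  define K where "K = (\<Sum>i\<in>?A. \<lceil>2 * ?u i\<rceil>)"
  have "\<bar>x i\<bar> \<le> K" if x: "x \<in> coroots_of_norm X N" and i: "i \<in> ?A" for x i
  proof -
    have u: "?u i > 0" by (rule two_rho_check_pos[OF X i])
    have "2 * (real_of_int (x i))\<^sup>2 / ?u i \<le> (\<Sum>i\<in>?A. 2 * (real_of_int (x i))\<^sup>2 / ?u i)"
      using two_rho_check_pos[OF X] i by (intro member_le_sum) (auto simp: less_imp_le)
    also have "\<dots> \<le> real_of_int (cartan_form X x x)"
      using cartan_form_lower_bound[OF X, of "\<lambda>i. real_of_int (x i)"] by (simp add: cartan_form_of_int)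
    also have "\<dots> \<le> 4" using N x by (force simp: coroots_of_norm_def)
    finally have "(real_of_int (x i))\<^sup>2 \<le> 2 * ?u i" using u by (simp add: field_simps)
    then have "(x i)\<^sup>2 \<le> \<lceil>2 * ?u i\<rceil>" by (metis ceiling_mono ceiling_of_int of_int_power)
    moreover have "\<bar>x i\<bar> \<le> (x i)\<^sup>2"
    proof (cases "x i = 0")
      case False
      then have "\<bar>x i\<bar> * 1 \<le> \<bar>x i\<bar> * \<bar>x i\<bar>" by (intro mult_left_mono) auto
      then show ?thesis by (simp add: power2_eq_square)
    qed simp
    moreover have "0 \<le> \<lceil>2 * ?u j\<rceil>" if "j \<in> ?A" for j
      using two_rho_check_pos[OF X that] by (simp add: zero_le_ceiling)
    then have "\<lceil>2 * ?u i\<rceil> \<le> K"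
      unfolding K_def using i by (intro member_le_sum) auto
    ultimately show ?thesis by linarith
  qed
  then have "coroots_of_norm X N \<subseteq> {x. \<forall>i. (i \<in> ?A \<longrightarrow> x i \<in> {-K..K}) \<and> (i \<notin> ?A \<longrightarrow> x i = 0)}"
    by (auto simp: coroots_of_norm_def coroot_lattice_def abs_le_iff minus_le_iff)
  moreover have "finite {x. \<forall>i. (i \<in> ?A \<longrightarrow> x i \<in> {-K..K}) \<and> (i \<notin> ?A \<longrightarrow> x i = (0::int))}"
    by (rule finite_set_of_finite_funs) auto
  ultimately show ?thesis by (rule finite_subset)
qed

text \<open>Off-diagonal terms occur in equal pairs, so modulo 2 only the diagonal remains.\<close>

lemma even_symmetric_form:
  fixes b :: "nat \<Rightarrow> nat \<Rightarrow> int"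
  assumes "finite A" "\<And>i j. i \<in> A \<Longrightarrow> j \<in> A \<Longrightarrow> b i j = b j i" "\<And>i. i \<in> A \<Longrightarrow> even (b i i)"
  shows "even (\<Sum>i\<in>A. \<Sum>j\<in>A. b i j * (x i * x j))"
  using assms
proof (induction A)
  case (insert a A)
  have "(\<Sum>i\<in>A. b i a * (x i * x a)) = (\<Sum>j\<in>A. b a j * (x a * x j))"
    using insert.prems by (intro sum.cong) auto
  then have "(\<Sum>i\<in>insert a A. \<Sum>j\<in>insert a A. b i j * (x i * x j)) =
      b a a * (x a * x a) + 2 * (\<Sum>j\<in>A. b a j * (x a * x j)) + (\<Sum>i\<in>A. \<Sum>j\<in>A. b i j * (x i * x j))"
    using insert.hyps by (simp add: sum.distrib)
  then show ?case using insert by simp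
qed simp

lemma even_cartan_form: "even (cartan_form X x (x :: nat \<Rightarrow> int))"
proof -
  have "even (\<Sum>i\<in>{1..lie_rank X}. \<Sum>j\<in>{1..lie_rank X}.
      symmetrizer X i * cartan X i j * (x i * x j))"
    by (rule even_symmetric_form[where b = "\<lambda>i j. symmetrizer X i * cartan X i j"])
      (simp_all only: symmetrizer_sym cartan_diag finite_atLeastAtMost even_mult_iff even_numeral simp_thms)
  then show ?thesis by (simp add: cartan_form_double_sum)
qed

text \<open>In type \<open>C\<close> all coefficients of the form are even, and halving leaves the odd diagonal entry
  1 only at \<open>n\<close>.\<close>

lemma cartan_form_C_parity:
  fixes x :: "nat \<Rightarrow> int"
  assumes "n \<ge> 1"
  shows "\<exists>k. cartan_form (TypeC n) x x = 4 * k + 2 * (x n)\<^sup>2"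
proof -
  let ?A = "{1..n}"
  let ?c = "\<lambda>i j. if i = n \<and> j = n then 0 else symmetrizer (TypeC n) i * cartan (TypeC n) i j"
  let ?b = "\<lambda>i j. ?c i j div 2"
  have sym: "symmetrizer (TypeC n) i * cartan (TypeC n) i j =
      symmetrizer (TypeC n) j * cartan (TypeC n) j i" if "i \<in> ?A" "j \<in> ?A" for i j
    using symmetrizer_sym[of i "TypeC n" j] that by simp
  have "even (\<Sum>i\<in>?A. \<Sum>j\<in>?A. ?b i j * (x i * x j))"
    by (rule even_symmetric_form) (use sym in auto)
  then obtain k where k: "(\<Sum>i\<in>?A. \<Sum>j\<in>?A. ?b i j * (x i * x j)) = 2 * k" by (rule evenE)
  have "cartan_form (TypeC n) x x =
      (\<Sum>i\<in>?A. \<Sum>j\<in>?A. 2 * (?b i j * (x i * x j)) + (if j = n then if i = n then 2 * (x n)\<^sup>2 else 0 else 0))"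
    unfolding cartan_form_double_sum lie_rank.simps
  proof (intro sum.cong refl)
    fix i j assume "i \<in> ?A" "j \<in> ?A"
    then have "even (?c i j)" by auto
    then have "?c i j = 2 * ?b i j" by simp
    then show "of_int (symmetrizer (TypeC n) i * cartan (TypeC n) i j) * (x i * x j) =
        2 * (?b i j * (x i * x j)) + (if j = n then if i = n then 2 * (x n)\<^sup>2 else 0 else 0)"
      by (cases "i = n \<and> j = n") (auto simp: power2_eq_square)
  qed
  also have "\<dots> = 2 * (2 * k) + 2 * (x n)\<^sup>2"
    unfolding k[symmetric] using assms by (simp add: sum.distrib sum_distrib_left)
  finally show ?thesis by (intro exI[of _ k]) simp
qed

text \<open>Disjoint supports leave only off-diagonal entries, and these are nonpositive.\<close>

lemma cartan_form_disjoint_nonpos: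
  fixes p m :: "nat \<Rightarrow> int"
  assumes "\<And>i. 0 \<le> p i" "\<And>i. 0 \<le> m i" "\<And>i. p i * m i = 0"
  shows "cartan_form X p m \<le> 0"
  unfolding cartan_form_double_sum
proof (intro sum_nonpos)
  fix i j
  show "of_int (symmetrizer X i * cartan X i j) * (p i * m j) \<le> 0"
  proof (cases "i = j")
    case False
    then have "symmetrizer X i * cartan X i j \<le> 0"
      using symmetrizer_ge_1[of X i] cartan_nonpos by (intro mult_nonneg_nonpos) auto
    then show ?thesis using assms by (simp add: mult_nonpos_nonneg)
  qed (simp add: assms)
qed

text \<open>The positive and negative parts of \<open>x\<close> have disjoint supports, so their norms add up to at most
  the norm of \<open>x\<close>; norms are positive and even.\<close>

lemma mixed_sign_norms:
  assumes X: "good_type X" and x: "x \<in> coroot_lattice X"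
    and mixed: "\<not> (\<forall>i. 0 \<le> x i)" "\<not> (\<forall>i. x i \<le> 0)"
  obtains p m where "\<And>i. p i * m i = 0" "cartan_form X p p \<ge> 2" "cartan_form X m m \<ge> 2"
    "cartan_form X p p + cartan_form X m m \<le> cartan_form X x x"
proof -
  define p where "p = (\<lambda>i. max (x i) 0)"
  define m where "m = (\<lambda>i. max (- x i) 0)"
  have pm: "p i * m i = 0" for i by (simp add: p_def m_def max_def)
  have "p \<in> coroot_lattice X" "m \<in> coroot_lattice X"
    using x by (auto simp: coroot_lattice_def p_def m_def)
  moreover have "p \<noteq> (\<lambda>_. 0)" "m \<noteq> (\<lambda>_. 0)"
    using mixed by (auto simp: p_def m_def fun_eq_iff not_le max_def split: if_splits)
  ultimately have "cartan_form X p p > 0" "cartan_form X m m > 0"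
    using cartan_form_pos[OF X] by auto
  then have ge: "cartan_form X p p \<ge> 2" "cartan_form X m m \<ge> 2"
    using even_cartan_form[of X p] even_cartan_form[of X m] by (auto elim!: evenE)
  have "x = (\<lambda>i. p i - m i)" by (auto simp: p_def m_def fun_eq_iff)
  then have "cartan_form X x x = cartan_form X p p + cartan_form X m m - 2 * cartan_form X p m"
    by (simp add: cartan_form_diff_left cartan_form_diff_right cartan_form_sym[of X m p])
  moreover have "cartan_form X p m \<le> 0"
    by (rule cartan_form_disjoint_nonpos) (auto simp: pm, auto simp: p_def m_def)
  ultimately have "cartan_form X p p + cartan_form X m m \<le> cartan_form X x x" by linarith
  then show thesis by (rule that[OF pm ge])
qed

text \<open>Reflections and negation preserve norms, so a set given by norms is automatically
  stable. What depends on the type is left as hypotheses: the sign alternative, and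
  \<open>mult\<close>, which says that the set is reduced at the simple coroots.\<close>

lemma finite_coroots_coroots_of_norm:
  assumes X: "good_type X" and N: "N \<subseteq> {2, 4}"
    and norms: "\<And>i. i \<in> {1..lie_rank X} \<Longrightarrow> 2 * symmetrizer X i \<in> N"
    and sign: "\<And>x. x \<in> coroots_of_norm X N \<Longrightarrow> (\<forall>i. 0 \<le> x i) \<or> (\<forall>i. x i \<le> 0)"
    and mult: "\<And>c i. i \<in> {1..lie_rank X} \<Longrightarrow> c\<^sup>2 * (2 * symmetrizer X i) \<in> N \<Longrightarrow> c\<^sup>2 = 1"
  shows "finite_coroots X (coroots_of_norm X N)"
proof
  show "finite (coroots_of_norm X N)"
    by (rule finite_coroots_of_norm[OF X]) (use N in auto)
  show "coroots_of_norm X N \<subseteq> coroot_lattice X" by (auto simp: coroots_of_norm_def)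
next
  fix i assume i: "i \<in> {1..lie_rank X}"
  show "unit_coroot i \<in> coroots_of_norm X N"
    using norms[OF i] unit_coroot_lattice[OF i] cartan_form_unit_unit[OF i]
    by (simp add: coroots_of_norm_def)
  fix x assume "x \<in> coroots_of_norm X N"
  then show "coroot_refl X i x \<in> coroots_of_norm X N"
    using coroot_refl_lattice[OF i] cartan_form_refl[OF i] by (simp add: coroots_of_norm_def)
next
  fix x assume x: "x \<in> coroots_of_norm X N"
  have minus: "(\<lambda>j. - x j) = (\<lambda>j. (-1) * x j)" by simp
  have "cartan_form X (\<lambda>j. - x j) (\<lambda>j. - x j) = cartan_form X x x"
    unfolding minus cartan_form_scale_left cartan_form_scale_right by simp
  with x show "(\<lambda>j. - x j) \<in> coroots_of_norm X N"
    by (auto simp: coroots_of_norm_def coroot_lattice_def)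
  from sign[OF x] show "(\<forall>i. 0 \<le> x i) \<or> (\<forall>i. x i \<le> 0)" .
next
  fix c :: int and i
  assume c: "(\<lambda>j. c * unit_coroot i j) \<in> coroots_of_norm X N" and i: "i \<in> {1..lie_rank X}"
  have "cartan_form X (\<lambda>j. c * unit_coroot i j) (\<lambda>j. c * unit_coroot i j) = c\<^sup>2 * (2 * symmetrizer X i)"
    unfolding cartan_form_scale_left cartan_form_scale_right cartan_form_unit_unit[OF i]
    by (simp add: power2_eq_square)
  with c mult[OF i, of c] have "c\<^sup>2 = 1" by (simp add: coroots_of_norm_def)
  then show "c = 1 \<or> c = -1" by (simp add: power2_eq_1_iff)
next
  have "cartan_form X (\<lambda>j. 0) (\<lambda>j. 0) = (0::int)" by (simp add: cartan_form_def)
  then show "(\<lambda>j. 0) \<notin> coroots_of_norm X N" using N by (auto simp: coroots_of_norm_def)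
qed

text \<open>Mixed signs would split the vector into two parts of norm at least 2 each, too much for
  norm 2.\<close>

lemma finite_coroots_simply_laced:
  assumes X: "good_type X" and sl: "\<And>i. symmetrizer X i = 1"
  shows "finite_coroots X (coroots_of_norm X {2})"
proof (rule finite_coroots_coroots_of_norm[OF X])
  fix x assume x: "x \<in> coroots_of_norm X {2}"
  show "(\<forall>i. 0 \<le> x i) \<or> (\<forall>i. x i \<le> 0)"
  proof (rule ccontr)
    assume "\<not> ((\<forall>i. 0 \<le> x i) \<or> (\<forall>i. x i \<le> 0))"
    then have mixed: "\<not> (\<forall>i. 0 \<le> x i)" "\<not> (\<forall>i. x i \<le> 0)" by auto
    have "x \<in> coroot_lattice X" "cartan_form X x x = 2" using x by (auto simp: coroots_of_norm_def)
    then show False using mixed_sign_norms[OF X _ mixed] by force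
  qed
qed (auto simp: sl)

text \<open>For norm 4 the splitting 2 + 2 is not excluded by size. It is excluded by parity: a
  vector of norm 2 has an odd coefficient at \<open>n\<close>, so two of them cannot have disjoint
  supports.\<close>

lemma finite_coroots_C:
  assumes n: "n \<ge> 1"
  shows "finite_coroots (TypeC n) (coroots_of_norm (TypeC n) {2, 4})"
proof (rule finite_coroots_coroots_of_norm)
  fix x assume x: "x \<in> coroots_of_norm (TypeC n) {2, 4}"
  show "(\<forall>i. 0 \<le> x i) \<or> (\<forall>i. x i \<le> 0)"
  proof (rule ccontr)
    assume "\<not> ((\<forall>i. 0 \<le> x i) \<or> (\<forall>i. x i \<le> 0))"
    then have mixed: "\<not> (\<forall>i. 0 \<le> x i)" "\<not> (\<forall>i. x i \<le> 0)" by auto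
    have "good_type (TypeC n)" "x \<in> coroot_lattice (TypeC n)"
      using x n by (auto simp: coroots_of_norm_def)
    then obtain p m where pm: "\<And>i. p i * m i = 0" "cartan_form (TypeC n) p p \<ge> 2"
      "cartan_form (TypeC n) m m \<ge> 2"
      "cartan_form (TypeC n) p p + cartan_form (TypeC n) m m \<le> cartan_form (TypeC n) x x"
      using mixed_sign_norms[OF _ _ mixed] by blast
    moreover have "cartan_form (TypeC n) x x \<le> 4" using x by (auto simp: coroots_of_norm_def)
    ultimately have 2: "cartan_form (TypeC n) p p = 2" "cartan_form (TypeC n) m m = 2" by auto
    have "odd (y n)" if y: "cartan_form (TypeC n) y y = 2" for y :: "nat \<Rightarrow> int"
    proof -
      obtain k where "2 = 4 * k + 2 * (y n)\<^sup>2"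
        using cartan_form_C_parity[OF n, of y] unfolding y by blast
      then have "(y n)\<^sup>2 = 1 - 2 * k" by simp
      then have "odd ((y n)\<^sup>2)" by simp
      then show ?thesis by simp
    qed
    then have "odd (p n * m n)" using 2 by simp
    then show False using pm(1)[of n] by simp
  qed
next
  fix c :: int and i
  assume "c\<^sup>2 * (2 * symmetrizer (TypeC n) i) \<in> {2, 4}"
  \<comment> \<open>The value 2 would come from a multiple of the short coroot at \<open>n\<close>,
    of norm 2, reaching norm 4.\<close>
  then have "c\<^sup>2 = 1 \<or> c\<^sup>2 = 2" by (auto split: if_splits)
  moreover have "c\<^sup>2 \<noteq> 2"
  proof
    assume c: "c\<^sup>2 = 2"
    then have "\<bar>c\<bar> < 2" using abs_le_square_iff[of 2 c] by simp
    then have "c \<in> {-1, 0, 1}" by auto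
    with c show False by auto
  qed
  ultimately show "c\<^sup>2 = 1" by simp
qed (use n in auto)

section \<open>Dominance of tau, Weyl orbits and standard weights\<close>

lemma simple_refl_apply:
  "simple_refl X i \<nu> j = \<nu> j - \<nu> i * simple_root X i j"
  by (simp add: simple_refl_def wscale_def)

context finite_coroots
begin

text \<open>A coordinate of the image of \<open>lam\<close> under the longest element is its pairing
  with the image of a simple coroot, a combination with nonpositive coefficients.\<close>

lemma tau_nonneg:
  assumes "\<And>j. j \<in> I \<Longrightarrow> lam j \<ge> 0" "i \<in> I"
  shows "tau X lam i \<ge> 0"
proof -
  obtain l where l: "set l \<subseteq> I" "longest_element X = weyl_word X l"
    "\<And>i k. i \<in> I \<Longrightarrow> coroot_word X l (unit_coroot i) k \<le> 0" using longest_element_word by blast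
  have "longest_element X lam i \<le> 0"
    unfolding l(2) weyl_word_apply[OF l(1) assms(2)] pairing_def
    using l(3)[OF assms(2)] assms(1) by (intro sum_nonpos mult_nonpos_nonneg) auto
  then show ?thesis by (simp add: tau_def)
qed

text \<open>Any set stable under the simple reflections will do, so the orbit never has to be
  described exactly: standard weights up to sign in arbitrary rank, a literal list in the
  exceptional cases.\<close>

lemma tau_orbit:
  assumes "lam \<in> S" and closed: "\<And>i \<nu>. i \<in> I \<Longrightarrow> \<nu> \<in> S \<Longrightarrow> simple_refl X i \<nu> \<in> S"
  shows "- tau X lam \<in> S"
proof -
  obtain l where l: "set l \<subseteq> I" "longest_element X = weyl_word X l"
    "\<And>i k. i \<in> I \<Longrightarrow> coroot_word X l (unit_coroot i) k \<le> 0" using longest_element_word by blast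
  have "weyl_word X is lam \<in> S" if "set is \<subseteq> I" for "is"
    using that
  proof (induction "is")
    case (Cons i "is")
    then show ?case using closed[of i "weyl_word X is lam"] by (simp add: weyl_word_Cons)
  qed (simp add: weyl_word_def assms(1))
  then show ?thesis using l by (simp add: tau_def)
qed

end

text \<open>The weights \<open>\<epsilon>\<^sub>k\<close> of the standard representation.\<close>

definition std_weight :: "cartan_type \<Rightarrow> nat \<Rightarrow> weight" where
  "std_weight X k = (\<lambda>j. if j \<in> {1..lie_rank X} then
     (if j = k then 1 else 0) - (if Suc j = k then 1 else 0) +
     (if X = TypeD (lie_rank X) \<and> Suc k = lie_rank X \<and> j = lie_rank X then 1 else 0) else 0)"

text \<open>Closing up under sign provides the negative weights of types C and D and the dual
  representation in type A, and turns membership of \<open>- tau X lam\<close> into membership of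
  \<open>tau X lam\<close>.\<close>

definition std_weights :: "cartan_type \<Rightarrow> nat set \<Rightarrow> weight set" where
  "std_weights X K = {\<nu>. \<exists>k\<in>K. \<nu> = std_weight X k \<or> \<nu> = - std_weight X k}"

lemma simple_refl_minus: "simple_refl X i (- \<nu>) = - simple_refl X i \<nu>"
  by (simp add: fun_eq_iff simple_refl_apply)

lemma std_weights_closedI:
  assumes "\<And>k. k \<in> K \<Longrightarrow> simple_refl X i (std_weight X k) \<in> std_weights X K" "\<nu> \<in> std_weights X K"
  shows "simple_refl X i \<nu> \<in> std_weights X K"
proof -
  have minus: "- \<mu> \<in> std_weights X K" if "\<mu> \<in> std_weights X K" for \<mu>
    using that by (auto simp: std_weights_def)
  from assms(2) obtain k where k: "k \<in> K" "\<nu> = std_weight X k \<or> \<nu> = - std_weight X k"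
    by (auto simp: std_weights_def)
  then show ?thesis using assms(1)[OF k(1)] minus by (auto simp: simple_refl_minus)
qed

text \<open>The reflection in \<epsilon>\<open>\<^sub>i\<close> -
  \<epsilon>\<open>\<^sub>i\<^sub>+\<^sub>1\<close> is a transposition of the standard
  weights.\<close>

lemma simple_refl_std_weight:
  assumes i: "i \<in> {1..lie_rank X}"
    and root: "simple_root X i = std_weight X i - std_weight X (Suc i)"
    and val: "std_weight X k i = (if k = i then 1 else if k = Suc i then -1 else 0)"
  shows "simple_refl X i (std_weight X k) =
    std_weight X (if k = i then Suc i else if k = Suc i then i else k)"
  unfolding fun_eq_iff simple_refl_apply root val by simp

lemma simple_root_A:
  "i \<in> {1..n} \<Longrightarrow> simple_root (TypeA n) i = std_weight (TypeA n) i - std_weight (TypeA n) (Suc i)"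
  by (rule ext) (simp add: simple_root_apply std_weight_def)

lemma std_weights_A_closed:
  assumes i: "i \<in> {1..lie_rank (TypeA n)}" and \<nu>: "\<nu> \<in> std_weights (TypeA n) {1..Suc n}"
  shows "simple_refl (TypeA n) i \<nu> \<in> std_weights (TypeA n) {1..Suc n}"
proof (rule std_weights_closedI[OF _ \<nu>])
  fix k assume k: "k \<in> {1..Suc n}"
  have "std_weight (TypeA n) k i = (if k = i then 1 else if k = Suc i then -1 else 0)"
    using i by (simp add: std_weight_def)
  moreover have "(if k = i then Suc i else if k = Suc i then i else k) \<in> {1..Suc n}"
    using i k by auto
  ultimately show "simple_refl (TypeA n) i (std_weight (TypeA n) k) \<in> std_weights (TypeA n) {1..Suc n}"
    using simple_refl_std_weight[OF i simple_root_A] i unfolding std_weights_def by auto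
qed

lemma std_weights_C_closed:
  assumes i: "i \<in> {1..lie_rank (TypeC n)}" and \<nu>: "\<nu> \<in> std_weights (TypeC n) {1..n}"
  shows "simple_refl (TypeC n) i \<nu> \<in> std_weights (TypeC n) {1..n}"
proof (rule std_weights_closedI[OF _ \<nu>])
  fix k assume k: "k \<in> {1..n}"
  show "simple_refl (TypeC n) i (std_weight (TypeC n) k) \<in> std_weights (TypeC n) {1..n}"
  proof (cases "i = n")
    case True
    \<comment> \<open>The long root is 2\<epsilon>\<open>\<^sub>n\<close>, so its reflection only
      changes the sign of \<epsilon>\<open>\<^sub>n\<close>.\<close>
    have "simple_root (TypeC n) n = (\<lambda>j. 2 * std_weight (TypeC n) n j)"
      by (rule ext) (use i in \<open>simp add: simple_root_apply std_weight_def\<close>)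
    moreover have "std_weight (TypeC n) k n = (if k = n then 1 else 0)"
      using i k by (simp add: std_weight_def)
    ultimately have "simple_refl (TypeC n) i (std_weight (TypeC n) k) =
        (if k = n then - std_weight (TypeC n) n else std_weight (TypeC n) k)"
      unfolding True by (simp add: fun_eq_iff simple_refl_apply)
    then show ?thesis using k by (auto simp: std_weights_def)
  next
    case False
    have "simple_root (TypeC n) i = std_weight (TypeC n) i - std_weight (TypeC n) (Suc i)"
      by (rule ext) (use i False in \<open>simp add: simple_root_apply std_weight_def\<close>)
    moreover have "std_weight (TypeC n) k i = (if k = i then 1 else if k = Suc i then -1 else 0)"
      using i by (simp add: std_weight_def)
    moreover have "(if k = i then Suc i else if k = Suc i then i else k) \<in> {1..n}"
      using i k False by auto
    ultimately show ?thesis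
      using simple_refl_std_weight[OF i] unfolding std_weights_def by auto
  qed
qed

lemma std_weights_D_closed:
  assumes n: "n \<ge> 4" and i: "i \<in> {1..lie_rank (TypeD n)}" and \<nu>: "\<nu> \<in> std_weights (TypeD n) {1..n}"
  shows "simple_refl (TypeD n) i \<nu> \<in> std_weights (TypeD n) {1..n}"
proof (rule std_weights_closedI[OF _ \<nu>])
  fix k assume k: "k \<in> {1..n}"
  have "n = Suc (Suc (n - 2))" using n by simp
  then obtain r where r: "n = Suc (Suc r)" by blast
  show "simple_refl (TypeD n) i (std_weight (TypeD n) k) \<in> std_weights (TypeD n) {1..n}"
  proof (cases "i = n")
    case True
    \<comment> \<open>The last root is \<epsilon>\<open>\<^sub>n\<^sub>-\<^sub>1\<close> +
      \<epsilon>\<open>\<^sub>n\<close>; its reflection exchanges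
      \<epsilon>\<open>\<^sub>n\<^sub>-\<^sub>1\<close> with -\<epsilon>\<open>\<^sub>n\<close>. The
      additional term in \<open>std_weight\<close> records that
      \<epsilon>\<open>\<^sub>n\<^sub>-\<^sub>1\<close> pairs to 1 with both spin nodes.\<close>
    have "simple_root (TypeD n) n = std_weight (TypeD n) (Suc r) + std_weight (TypeD n) n"
      by (rule ext) (use n in \<open>simp add: simple_root_apply std_weight_def r\<close>)
    moreover have "std_weight (TypeD n) k n = (if k = Suc r \<or> k = n then 1 else 0)"
      using k by (simp add: std_weight_def r)
    ultimately have "simple_refl (TypeD n) i (std_weight (TypeD n) k) =
        (if k = Suc r then - std_weight (TypeD n) n else if k = n then - std_weight (TypeD n) (Suc r)
         else std_weight (TypeD n) k)"
      unfolding True by (auto simp: fun_eq_iff simple_refl_apply)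
    then show ?thesis using k n by (auto simp: std_weights_def r)
  next
    case False
    have "simple_root (TypeD n) i = std_weight (TypeD n) i - std_weight (TypeD n) (Suc i)"
      by (rule ext) (use i False in \<open>simp add: simple_root_apply std_weight_def\<close>)
    moreover have "std_weight (TypeD n) k i = (if k = i then 1 else if k = Suc i then -1 else 0)"
      using i False by (simp add: std_weight_def)
    moreover have "(if k = i then Suc i else if k = Suc i then i else k) \<in> {1..n}"
      using i k False by auto
    ultimately show ?thesis
      using simple_refl_std_weight[OF i] unfolding std_weights_def by auto
  qed
qed

lemma pairing_minus: "pairing X h (- \<nu>) = - pairing X h \<nu>"
  by (simp add: pairing_def sum_negf)

text \<open>As \<open>h\<close> vanishes outside the index range, the difference formula holds at
  both ends as well, including the last standard weight in type A, where \<open>k\<close> exceeds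
  the rank.\<close>

lemma pairing_std_weight:
  assumes "\<And>m. X \<noteq> TypeD m" "1 \<le> k" "k \<le> Suc (lie_rank X)" "\<And>i. i \<notin> {1..lie_rank X} \<Longrightarrow> h i = 0"
  shows "pairing X h (std_weight X k) = h k - h (k - 1)"
proof -
  let ?A = "{1..lie_rank X}"
  obtain r where r: "k = Suc r" using assms(2) Suc_le_D by force
  have "pairing X h (std_weight X k) = (\<Sum>j\<in>?A. (if j = k then 1 else 0) * h j - (if j = r then 1 else 0) * h j)"
    unfolding pairing_def by (intro sum.cong) (auto simp: std_weight_def assms(1) r)
  also have "\<dots> = (if k \<in> ?A then h k else 0) - (if r \<in> ?A then h r else 0)"
    unfolding sum_subtractf using sum_delta_mult[of ?A k 1 h] sum_delta_mult[of ?A r 1 h] by simp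
  also have "\<dots> = h k - h r" using assms(4)[of k] assms(4)[of r] by auto
  finally show ?thesis by (simp add: r)
qed

lemma pairing_std_weight_D:
  assumes "n \<ge> 2" "1 \<le> k" "k \<le> n" "\<And>i. i \<notin> {1..n} \<Longrightarrow> h i = 0"
  shows "pairing (TypeD n) h (std_weight (TypeD n) k) = h k - h (k - 1) + (if Suc k = n then h n else 0)"
proof -
  let ?A = "{1..n}"
  obtain r where r: "k = Suc r" using assms(2) Suc_le_D by force
  have "pairing (TypeD n) h (std_weight (TypeD n) k) = (\<Sum>j\<in>?A. (if j = k then 1 else 0) * h j
      - (if j = r then 1 else 0) * h j + (if j = n then (if Suc k = n then 1 else 0) else 0) * h j)"
    unfolding pairing_def lie_rank.simps by (intro sum.cong) (auto simp: std_weight_def r algebra_simps)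
  also have "\<dots> = (if k \<in> ?A then h k else 0) - (if r \<in> ?A then h r else 0) + (if Suc k = n then h n else 0)"
    unfolding sum_subtractf sum.distrib using assms(1) sum_delta_mult[of ?A k 1 h]
      sum_delta_mult[of ?A r 1 h] sum_delta_mult[of ?A n "if Suc k = n then 1 else 0" h] by simp
  also have "\<dots> = h k - h r + (if Suc k = n then h n else 0)" using assms(4)[of k] assms(4)[of r] by auto
  finally show ?thesis by (simp add: r)
qed

lemma VHS_level_le_1:
  assumes "finite_coroots (fst D) R" "lam \<in> std_weights (fst D) K"
    and "\<And>i \<nu>. i \<in> {1..lie_rank (fst D)} \<Longrightarrow> \<nu> \<in> std_weights (fst D) K \<Longrightarrow>
      simple_refl (fst D) i \<nu> \<in> std_weights (fst D) K"
    and E: "\<And>k. k \<in> K \<Longrightarrow> \<bar>E_val D (std_weight (fst D) k)\<bar> \<le> 1"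
  shows "VHS_level D lam \<le> 1"
proof -
  have "\<bar>E_val D \<nu>\<bar> \<le> 1" if "\<nu> \<in> std_weights (fst D) K" for \<nu>
    using that E by (auto simp: std_weights_def E_val_def pairing_minus)
  moreover have "- tau (fst D) lam \<in> std_weights (fst D) K"
    by (rule finite_coroots.tau_orbit[OF assms(1-3)])
  then have "tau (fst D) lam \<in> std_weights (fst D) K"
    by (auto simp: std_weights_def minus_equation_iff) (metis minus_minus)+
  ultimately show ?thesis using assms(2) by (auto simp: VHS_level_def abs_le_iff)
qed

lemma VHS_level_A:
  assumes p: "p \<ge> 1" and lam: "lam \<in> std_weights (TypeA (2 * p - 1)) {1..Suc (2 * p - 1)}"
  shows "VHS_level (TypeA (2 * p - 1), p) lam \<le> 1"
proof (rule VHS_level_le_1[where R = "coroots_of_norm (TypeA (2 * p - 1)) {2}" and K = "{1..Suc (2 * p - 1)}"])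
  show "finite_coroots (fst (TypeA (2 * p - 1), p)) (coroots_of_norm (TypeA (2 * p - 1)) {2})"
    using p by (simp add: finite_coroots_simply_laced)
  fix k assume k: "k \<in> {1..Suc (2 * p - 1)}"
  then obtain r where r: "k = Suc r" using Suc_le_D by force
  show "\<bar>E_val (TypeA (2 * p - 1), p) (std_weight (fst (TypeA (2 * p - 1), p)) k)\<bar> \<le> 1"
    unfolding E_val_def grading_element_A[OF p] fst_conv
    by (subst pairing_std_weight) (use k in \<open>auto simp: r\<close>)
qed (use lam std_weights_A_closed in auto)

lemma VHS_level_C:
  assumes n: "n \<ge> 1" and lam: "lam \<in> std_weights (TypeC n) {1..n}"
  shows "VHS_level (TypeC n, n) lam \<le> 1"
proof (rule VHS_level_le_1[where R = "coroots_of_norm (TypeC n) {2, 4}" and K = "{1..n}"])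
  show "finite_coroots (fst (TypeC n, n)) (coroots_of_norm (TypeC n) {2, 4})"
    using n by (simp add: finite_coroots_C)
  fix k assume k: "k \<in> {1..n}"
  show "\<bar>E_val (TypeC n, n) (std_weight (fst (TypeC n, n)) k)\<bar> \<le> 1"
    unfolding E_val_def grading_element_C[OF n] fst_conv
    by (subst pairing_std_weight) (use k in \<open>auto simp: of_nat_diff\<close>)
qed (use lam std_weights_C_closed in auto)

lemma VHS_level_D:
  assumes n: "n \<ge> 4" and lam: "lam \<in> std_weights (TypeD n) {1..n}"
  shows "VHS_level (TypeD n, n) lam \<le> 1"
proof (rule VHS_level_le_1[where R = "coroots_of_norm (TypeD n) {2}" and K = "{1..n}"])
  show "finite_coroots (fst (TypeD n, n)) (coroots_of_norm (TypeD n) {2})"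
    using n by (simp add: finite_coroots_simply_laced)
  fix k assume k: "k \<in> {1..n}"
  then obtain r where r: "k = Suc r" using Suc_le_D by force
  with k obtain l where l: "n = Suc (r + l)" by (auto simp: le_iff_add)
  have eq: "pairing (TypeD n) h (std_weight (TypeD n) k) =
      h k - h (k - 1) + (if Suc k = n then h n else 0)" if "\<And>i. i \<notin> {1..n} \<Longrightarrow> h i = 0" for h
    by (rule pairing_std_weight_D) (use k n that in auto)
  have "E_val (TypeD n, n) (std_weight (TypeD n) k) \<in> {-1, 1}"
    unfolding E_val_def grading_element_D_last[OF n] fst_conv
  proof (subst eq, goal_cases)
    case 2
    show ?case
      unfolding r l using n[unfolded l]
      by (cases "l = 0"; cases "l = 1"; cases "l = 2"; cases "r = 0"; simp add: field_simps)
  qed (use n in auto)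
  then show "\<bar>E_val (TypeD n, n) (std_weight (fst (TypeD n, n)) k)\<bar> \<le> 1" by auto
qed (use lam n std_weights_D_closed in auto)

section \<open>Representations with one-dimensional weight spaces\<close>

text \<open>E is diagonal on weight vectors, so Hodge numbers are kernel dimensions of diagonal
  matrices. The Calabi-Yau condition asks only for the values 1 at the two ends and 0 beyond
  them.\<close>

lemma kernel_dim_diag_eq_0:
  fixes d :: "nat \<Rightarrow> 'a::field"
  assumes "\<And>r. r < n \<Longrightarrow> d r \<noteq> 0"
  shows "kernel_dim (mat n n (\<lambda>(r, c). if r = c then d r else 0)) = 0"
proof -
  let ?A = "mat n n (\<lambda>(r, c). if r = c then d r else 0)"
  have A: "?A \<in> carrier_mat n n" by simp
  interpret kernel n n ?A by unfold_locales (rule A)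
  have "0 \<notin> set (diag_mat ?A)" using assms by (auto simp: diag_mat_def)
  then show ?thesis
    using kernel_upper_triangular(1)[OF A] by (simp add: upper_triangular_def)
qed

lemma kernel_dim_diag_eq_1:
  fixes d :: "nat \<Rightarrow> 'a::field"
  assumes k: "k < n" and d: "\<And>r. r < n \<Longrightarrow> d r = 0 \<longleftrightarrow> r = k"
  shows "kernel_dim (mat n n (\<lambda>(r, c). if r = c then d r else 0)) = 1"
proof -
  let ?A = "mat n n (\<lambda>(r, c). if r = c then d r else 0)"
  have A: "?A \<in> carrier_mat n n" by simp
  interpret kernel n n ?A by unfold_locales (rule A)
  let ?u = "unit_vec n k :: 'a vec"
  have mult: "?A *\<^sub>v v = vec n (\<lambda>r. d r * v $ r)" if "v \<in> carrier_vec n" for v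
    using that by (intro eq_vecI)
      (simp_all add: scalar_prod_def if_distrib[of "\<lambda>c. c * _"] cong: if_cong)
  have u: "{?u} \<subseteq> mat_kernel ?A"
    using k d by (auto simp: mat_kernel[OF A] mult)
  have "\<not> NC.lin_dep {?u}"
  proof (rule NC.subset_li_is_li)
    show "\<not> NC.lin_dep (set (unit_vecs n))" using NC.unit_vecs_basis by (simp add: NC.basis_def)
    show "{?u} \<subseteq> set (unit_vecs n)" using k by (auto simp: unit_vecs_def)
  qed
  moreover have "v \<in> span {?u}" if v: "v \<in> mat_kernel ?A" for v
  proof -
    have vc: "v \<in> carrier_vec n" and v0: "?A *\<^sub>v v = 0\<^sub>v n" using v by (auto simp: mat_kernel[OF A])
    have "v $ r = 0" if r: "r < n" "r \<noteq> k" for r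
    proof -
      have "(?A *\<^sub>v v) $ r = d r * v $ r" unfolding mult[OF vc] using r by simp
      then have "d r * v $ r = 0" unfolding v0 using r by simp
      then show ?thesis using d r by simp
    qed
    then have "v = (v $ k) \<cdot>\<^sub>v ?u" using vc k by (intro eq_vecI) auto
    moreover have "(v $ k) \<cdot>\<^sub>v ?u \<in> NC.span {?u}"
      by (intro NC.smult_in_span NC.span_mem) auto
    ultimately show ?thesis unfolding span_same[OF u] by simp
  qed
  then have "span {?u} = mat_kernel ?A"
    using Ker.span_is_subset2[OF u] by auto
  ultimately have "basis {?u}"
    using u by (simp add: Ker.basis_def lindep_same[OF u])
  then have "dim = card {?u}" by (intro Ker.dim_basis) auto
  then show ?thesis by simp
qed

section \<open>Operators on weight vectors, with weights as integer lists\<close>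

abbreviation ladd :: "int list \<Rightarrow> int list \<Rightarrow> int list" where
  "ladd \<equiv> map2 (+)"

text \<open>No length hypothesis: \<open>map2\<close> cuts to the shortest argument in either
  bracketing.\<close>

lemma ladd_assoc: "ladd (ladd a b) c = ladd a (ladd b c)"
  by (rule nth_equalityI) (auto simp: add.assoc)

lemma ladd_commute: "ladd a b = ladd b a"
  by (rule nth_equalityI) (auto simp: add.commute)

definition coord :: "int list \<Rightarrow> nat \<Rightarrow> int" where
  "coord \<mu> i = \<mu> ! (i - 1)"

text \<open>The simple root \<open>\<sigma>\<^sub>i\<close> times a sign \<open>s\<close>; raising operators have \<open>s = 1\<close>, lowering ones \<open>s = -1\<close>.\<close>

definition root_list :: "cartan_type \<Rightarrow> int \<Rightarrow> nat \<Rightarrow> int list" where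
  "root_list X s i = map (\<lambda>j. s * cartan X i j) [1..<Suc (lie_rank X)]"

lemma length_root_list [simp]: "length (root_list X s i) = lie_rank X"
  by (simp add: root_list_def)

lemma coord_ladd:
  assumes "length \<mu> = lie_rank X" "length \<nu> = lie_rank X" "j \<in> {1..lie_rank X}"
  shows "coord (ladd \<mu> \<nu>) j = coord \<mu> j + coord \<nu> j"
proof -
  have "j - 1 < lie_rank X" using assms(3) by auto
  then show ?thesis using assms by (simp add: coord_def)
qed

lemma coord_root_list:
  assumes "j \<in> {1..lie_rank X}"
  shows "coord (root_list X s i) j = s * cartan X i j"
proof -
  have "j - 1 < lie_rank X" "Suc 0 + (j - 1) = j" using assms by auto
  then show ?thesis by (simp add: coord_def root_list_def del: upt_Suc)
qed

text \<open>The commutator of two weight-shifting operators with shifts \<open>\<beta>\<close>, \<open>\<gamma>\<close> and coefficients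
  \<open>\<kappa>\<close>, \<open>\<kappa>'\<close> is again one, with shift \<open>\<beta> + \<gamma>\<close> and these coefficients.\<close>

definition comm_coef :: "int list \<Rightarrow> (int list \<Rightarrow> int) \<Rightarrow> int list \<Rightarrow> (int list \<Rightarrow> int) \<Rightarrow> int list \<Rightarrow> int" where
  "comm_coef \<beta> \<kappa> \<gamma> \<kappa>' \<mu> = \<kappa> (ladd \<mu> \<gamma>) * \<kappa>' \<mu> - \<kappa>' (ladd \<mu> \<beta>) * \<kappa> \<mu>"

definition ad_coef :: "int list \<Rightarrow> (int list \<Rightarrow> int) \<Rightarrow> nat \<Rightarrow> int list \<times> (int list \<Rightarrow> int) \<Rightarrow>
    int list \<times> (int list \<Rightarrow> int)" where
  "ad_coef \<beta> \<kappa> k = (\<lambda>(\<gamma>, \<kappa>'). (ladd \<beta> \<gamma>, comm_coef \<beta> \<kappa> \<gamma> \<kappa>')) ^^ k"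

text \<open>All weight spaces have dimension one and the strings through them have length at most 3, so
  these coefficients can be taken to be 1, or 2 when leaving the middle of a string of length 3.\<close>

definition step_coef :: "cartan_type \<Rightarrow> int list list \<Rightarrow> int \<Rightarrow> nat \<Rightarrow> int list \<Rightarrow> int" where
  "step_coef X ws s i \<mu> =
     (if ladd \<mu> (root_list X s i) \<in> set ws then if coord \<mu> i = 0 then 2 else 1 else 0)"

text \<open>The operator taking the basis vector of weight \<mu> to \<kappa>(\<mu>) times that of
  weight \<mu> + \<beta>, and to 0 if \<mu> + \<beta> is not in the list. Both the Chevalley
  generators and their iterated brackets have this shape.\<close>

definition shift_mat :: "int list list \<Rightarrow> int list \<Rightarrow> (int list \<Rightarrow> int) \<Rightarrow> complex mat" where
  "shift_mat ws \<beta> \<kappa> = mat (length ws) (length ws)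
     (\<lambda>(r, c). if ws ! r = ladd (ws ! c) \<beta> then of_int (\<kappa> (ws ! c)) else 0)"

definition weight_rep :: "cartan_type \<Rightarrow> int list list \<Rightarrow> lie_rep" where
  "weight_rep X ws = \<lparr>rep_dim = length ws,
     rep_e = \<lambda>i. shift_mat ws (root_list X 1 i) (step_coef X ws 1 i),
     rep_f = \<lambda>i. shift_mat ws (root_list X (-1) i) (step_coef X ws (-1) i),
     rep_h = \<lambda>i. shift_mat ws (replicate (lie_rank X) 0) (\<lambda>\<mu>. coord \<mu> i)\<rparr>"

locale weight_list =
  fixes X :: cartan_type and ws :: "int list list"
  assumes distinct_ws: "distinct ws"
    and length_ws: "\<And>\<mu>. \<mu> \<in> set ws \<Longrightarrow> length \<mu> = lie_rank X"
begin

abbreviation "N \<equiv> length ws"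
abbreviation "I \<equiv> {1..lie_rank X}"
abbreviation "zero_wt \<equiv> replicate (lie_rank X) (0::int)"
abbreviation "rt \<equiv> root_list X"
abbreviation "sc \<equiv> step_coef X ws"

text \<open>The coefficient vanishes wherever the shift leaves the list. Without this, a product of
  operators could lose a path through a missing intermediate weight while the product of
  coefficients still counts it.\<close>

definition admissible :: "int list \<Rightarrow> (int list \<Rightarrow> int) \<Rightarrow> bool" where
  "admissible \<beta> \<kappa> \<longleftrightarrow> (\<forall>\<mu>\<in>set ws. \<kappa> \<mu> \<noteq> 0 \<longrightarrow> ladd \<mu> \<beta> \<in> set ws)"

lemma ladd_zero: "length \<mu> = lie_rank X \<Longrightarrow> ladd \<mu> zero_wt = \<mu>"
  by (rule nth_equalityI) auto

lemma admissible_step: "admissible (rt s i) (sc s i)"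
  by (simp add: admissible_def step_coef_def)

lemma admissible_zero: "admissible zero_wt \<kappa>"
  by (simp add: admissible_def ladd_zero length_ws)

lemma admissible_comm:
  assumes "admissible \<beta> \<kappa>" "admissible \<gamma> \<kappa>'"
  shows "admissible (ladd \<beta> \<gamma>) (comm_coef \<beta> \<kappa> \<gamma> \<kappa>')"
  unfolding admissible_def
proof (intro ballI impI)
  fix \<mu> assume \<mu>: "\<mu> \<in> set ws" "comm_coef \<beta> \<kappa> \<gamma> \<kappa>' \<mu> \<noteq> 0"
  then have "\<kappa> (ladd \<mu> \<gamma>) * \<kappa>' \<mu> \<noteq> 0 \<or> \<kappa>' (ladd \<mu> \<beta>) * \<kappa> \<mu> \<noteq> 0"
    by (auto simp: comm_coef_def)
  then consider "\<kappa> (ladd \<mu> \<gamma>) \<noteq> 0" "\<kappa>' \<mu> \<noteq> 0" | "\<kappa>' (ladd \<mu> \<beta>) \<noteq> 0" "\<kappa> \<mu> \<noteq> 0"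
    by auto
  then have "ladd (ladd \<mu> \<gamma>) \<beta> \<in> set ws \<or> ladd (ladd \<mu> \<beta>) \<gamma> \<in> set ws"
    using assms \<mu>(1) unfolding admissible_def by cases blast+
  then show "ladd \<mu> (ladd \<beta> \<gamma>) \<in> set ws" by (simp add: ladd_assoc ladd_commute[of \<gamma> \<beta>])
qed

lemma shift_mat_carrier [simp]: "shift_mat ws \<beta> \<kappa> \<in> carrier_mat N N"
  by (simp add: shift_mat_def)

text \<open>Distinctness leaves at most one intermediate weight in the matrix product, and
  admissibility provides it whenever the coefficient is nonzero.\<close>

lemma shift_mat_mult:
  assumes adm: "admissible \<gamma> \<kappa>'"
  shows "shift_mat ws \<beta> \<kappa> * shift_mat ws \<gamma> \<kappa>' = shift_mat ws (ladd \<beta> \<gamma>) (\<lambda>\<mu>. \<kappa> (ladd \<mu> \<gamma>) * \<kappa>' \<mu>)"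
proof (rule eq_matI)
  fix r c assume "r < dim_row (shift_mat ws (ladd \<beta> \<gamma>) (\<lambda>\<mu>. \<kappa> (ladd \<mu> \<gamma>) * \<kappa>' \<mu>))"
    "c < dim_col (shift_mat ws (ladd \<beta> \<gamma>) (\<lambda>\<mu>. \<kappa> (ladd \<mu> \<gamma>) * \<kappa>' \<mu>))"
  then have rc: "r < N" "c < N" by (auto simp: shift_mat_def)
  let ?\<mu> = "ws ! c"
  let ?t = "\<lambda>k. (if ws ! r = ladd (ws ! k) \<beta> then of_int (\<kappa> (ws ! k)) else 0) *
    (if ws ! k = ladd ?\<mu> \<gamma> then of_int (\<kappa>' ?\<mu>) else 0) :: complex"
  have sum: "(shift_mat ws \<beta> \<kappa> * shift_mat ws \<gamma> \<kappa>') $$ (r, c) = (\<Sum>k\<in>{0..<N}. ?t k)"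
    using rc by (simp add: shift_mat_def scalar_prod_def)
  have "(\<Sum>k\<in>{0..<N}. ?t k) =
      (if ws ! r = ladd (ladd ?\<mu> \<gamma>) \<beta> then of_int (\<kappa> (ladd ?\<mu> \<gamma>) * \<kappa>' ?\<mu>) else 0)"
  proof (cases "\<kappa>' ?\<mu> = 0")
    case False
    with adm rc have "ladd ?\<mu> \<gamma> \<in> set ws" by (simp add: admissible_def)
    then obtain m where m: "m < N" "ws ! m = ladd ?\<mu> \<gamma>" by (auto simp: in_set_conv_nth)
    have "?t k = (if k = m then (if ws ! r = ladd (ladd ?\<mu> \<gamma>) \<beta> then
        of_int (\<kappa> (ladd ?\<mu> \<gamma>) * \<kappa>' ?\<mu>) else 0) else 0)" if "k \<in> {0..<N}" for k
      using that m distinct_ws nth_eq_iff_index_eq[of ws k m] by auto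
    then have "(\<Sum>k\<in>{0..<N}. ?t k) = (\<Sum>k\<in>{0..<N}. if k = m then (if ws ! r = ladd (ladd ?\<mu> \<gamma>) \<beta> then
        of_int (\<kappa> (ladd ?\<mu> \<gamma>) * \<kappa>' ?\<mu>) else 0) else 0)"
      by (intro sum.cong refl)
    then show ?thesis using m by simp
  qed simp
  then show "(shift_mat ws \<beta> \<kappa> * shift_mat ws \<gamma> \<kappa>') $$ (r, c) =
      shift_mat ws (ladd \<beta> \<gamma>) (\<lambda>\<mu>. \<kappa> (ladd \<mu> \<gamma>) * \<kappa>' \<mu>) $$ (r, c)"
    unfolding sum using rc by (simp add: shift_mat_def ladd_assoc ladd_commute[of \<gamma> \<beta>])
qed (simp_all add: shift_mat_def)

lemma shift_mat_bracket:
  assumes "admissible \<beta> \<kappa>" "admissible \<gamma> \<kappa>'"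
  shows "bracket (shift_mat ws \<beta> \<kappa>) (shift_mat ws \<gamma> \<kappa>') =
    shift_mat ws (ladd \<beta> \<gamma>) (comm_coef \<beta> \<kappa> \<gamma> \<kappa>')"
  unfolding bracket_def shift_mat_mult[OF assms(1)] shift_mat_mult[OF assms(2)] ladd_commute[of \<gamma> \<beta>]
  by (rule eq_matI) (auto simp: shift_mat_def comm_coef_def)

lemma shift_mat_ad:
  assumes "admissible \<beta> \<kappa>" "admissible \<gamma> \<kappa>'"
  shows "(bracket (shift_mat ws \<beta> \<kappa>) ^^ k) (shift_mat ws \<gamma> \<kappa>') =
      (case ad_coef \<beta> \<kappa> k (\<gamma>, \<kappa>') of (\<delta>, \<kappa>'') \<Rightarrow> shift_mat ws \<delta> \<kappa>'') \<and>
    (case ad_coef \<beta> \<kappa> k (\<gamma>, \<kappa>') of (\<delta>, \<kappa>'') \<Rightarrow> admissible \<delta> \<kappa>'')"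
proof (induction k)
  case 0
  then show ?case using assms by (simp add: ad_coef_def)
next
  case (Suc k)
  obtain \<delta> \<kappa>'' where eq: "ad_coef \<beta> \<kappa> k (\<gamma>, \<kappa>') = (\<delta>, \<kappa>'')" by fastforce
  then have "ad_coef \<beta> \<kappa> (Suc k) (\<gamma>, \<kappa>') = (ladd \<beta> \<delta>, comm_coef \<beta> \<kappa> \<delta> \<kappa>'')"
    by (simp add: ad_coef_def)
  moreover have "(bracket (shift_mat ws \<beta> \<kappa>) ^^ k) (shift_mat ws \<gamma> \<kappa>') = shift_mat ws \<delta> \<kappa>''"
    "admissible \<delta> \<kappa>''" using Suc eq by auto
  ultimately show ?case
    using shift_mat_bracket[OF assms(1)] admissible_comm[OF assms(1)] by auto
qed

lemma shift_mat_cong: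
  assumes "\<And>\<mu>. \<mu> \<in> set ws \<Longrightarrow> \<kappa> \<mu> = \<kappa>' \<mu>"
  shows "shift_mat ws \<beta> \<kappa> = shift_mat ws \<beta> \<kappa>'"
  unfolding shift_mat_def using assms by (intro cong_mat) auto

lemma shift_mat_0: "shift_mat ws \<beta> (\<lambda>_. 0) = 0\<^sub>m N N"
  by (rule eq_matI) (auto simp: shift_mat_def)

lemma shift_mat_smult: "of_int c \<cdot>\<^sub>m shift_mat ws \<beta> \<kappa> = shift_mat ws \<beta> (\<lambda>\<mu>. c * \<kappa> \<mu>)"
  by (rule eq_matI) (auto simp: shift_mat_def)

lemma shift_mat_eq_0:
  assumes "\<And>\<mu>. \<mu> \<in> set ws \<Longrightarrow> \<kappa> \<mu> = 0"
  shows "shift_mat ws \<beta> \<kappa> = 0\<^sub>m N N"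
  using shift_mat_cong[of \<kappa> "\<lambda>_. 0"] assms shift_mat_0 by simp

lemma root_list_cancel: "ladd (rt 1 i) (rt (-1) i) = zero_wt"
  by (rule nth_equalityI) (auto simp: root_list_def simp del: upt_Suc)

lemma zero_ladd: "ladd zero_wt (rt s i) = rt s i"
  using ladd_zero[of "rt s i"] by (simp add: ladd_commute)

lemma bracket_h_step:
  assumes "i \<in> I"
  shows "bracket (shift_mat ws zero_wt (\<lambda>\<mu>. coord \<mu> i)) (shift_mat ws (rt s j) (sc s j)) =
    of_int (s * cartan X j i) \<cdot>\<^sub>m shift_mat ws (rt s j) (sc s j)"
  unfolding shift_mat_bracket[OF admissible_zero admissible_step] shift_mat_smult zero_ladd
  using assms by (intro shift_mat_cong)
    (simp add: comm_coef_def ladd_zero length_ws coord_ladd coord_root_list algebra_simps)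

end

text \<open>The relations \<open>ef\<close> and \<open>serre\<close> are integer identities at each
  weight. By \<open>parent\<close>, every weight after the first lies one simple root below an
  earlier one; this connectedness yields irreducibility.\<close>

locale weight_representation = weight_list +
  assumes ef: "\<And>i j \<mu>. i \<in> {1..lie_rank X} \<Longrightarrow> j \<in> {1..lie_rank X} \<Longrightarrow> \<mu> \<in> set ws \<Longrightarrow>
      comm_coef (root_list X 1 i) (step_coef X ws 1 i) (root_list X (-1) j) (step_coef X ws (-1) j) \<mu> =
        (if i = j then coord \<mu> i else 0)"
    and serre: "\<And>s i j \<mu>. s = 1 \<or> s = -1 \<Longrightarrow> i \<in> {1..lie_rank X} \<Longrightarrow> j \<in> {1..lie_rank X} \<Longrightarrow>
      i \<noteq> j \<Longrightarrow> \<mu> \<in> set ws \<Longrightarrow>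
      snd (ad_coef (root_list X s i) (step_coef X ws s i) (nat (1 - cartan X j i))
        (root_list X s j, step_coef X ws s j)) \<mu> = 0"
    and parent: "\<And>c. 0 < c \<Longrightarrow> c < length ws \<Longrightarrow>
      \<exists>i\<in>{1..lie_rank X}. \<exists>r<c. ws ! r = ladd (ws ! c) (root_list X 1 i)"
    and nonempty: "ws \<noteq> []"
begin

abbreviation "V \<equiv> weight_rep X ws"

lemma is_rep_V: "is_rep X V"
proof -
  have ad: "(bracket (shift_mat ws (rt s i) (sc s i)) ^^ nat (1 - cartan X j i))
      (shift_mat ws (rt s j) (sc s j)) = 0\<^sub>m N N"
    if "s = 1 \<or> s = -1" "i \<in> I" "j \<in> I" "i \<noteq> j" for s i j
    using shift_mat_ad[OF admissible_step[of s i] admissible_step[of s j], of "nat (1 - cartan X j i)"]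
      shift_mat_eq_0[of "snd (ad_coef (rt s i) (sc s i) (nat (1 - cartan X j i)) (rt s j, sc s j))"]
      serre[OF that] unfolding case_prod_beta by metis
  have ef': "bracket (shift_mat ws (rt 1 i) (sc 1 i)) (shift_mat ws (rt (-1) j) (sc (-1) j)) =
      (if i = j then shift_mat ws zero_wt (\<lambda>\<mu>. coord \<mu> i) else 0\<^sub>m N N)"
    if "i \<in> I" "j \<in> I" for i j
  proof (cases "i = j")
    case True
    then show ?thesis
      unfolding shift_mat_bracket[OF admissible_step admissible_step] using ef[OF that]
      by (auto simp: root_list_cancel intro!: shift_mat_cong)
  next
    case False
    then show ?thesis
      unfolding shift_mat_bracket[OF admissible_step admissible_step] using ef[OF that]
      by (auto intro!: shift_mat_eq_0)
  qed
  have hh: "bracket (shift_mat ws zero_wt (\<lambda>\<mu>. coord \<mu> i)) (shift_mat ws zero_wt (\<lambda>\<mu>. coord \<mu> j)) = 0\<^sub>m N N"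
    for i j
    unfolding shift_mat_bracket[OF admissible_zero admissible_zero]
    by (rule shift_mat_eq_0) (simp add: comm_coef_def ladd_zero length_ws)
  show ?thesis
    unfolding is_rep_def
    using ad[of 1] ad[of "-1"] ef' hh bracket_h_step[of _ 1] bracket_h_step[of _ "-1"]
    by (simp add: weight_rep_def)
qed

lemma shift_mat_unit:
  assumes "c < N" "r < N" "ws ! r = ladd (ws ! c) \<beta>"
  shows "shift_mat ws \<beta> \<kappa> *\<^sub>v unit_vec N c = of_int (\<kappa> (ws ! c)) \<cdot>\<^sub>v unit_vec N r"
proof (rule eq_vecI)
  fix k assume "k < dim_vec (of_int (\<kappa> (ws ! c)) \<cdot>\<^sub>v (unit_vec N r :: complex vec))"
  then have k: "k < N" by simp
  then have "ws ! k = ladd (ws ! c) \<beta> \<longleftrightarrow> k = r"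
    using assms distinct_ws nth_eq_iff_index_eq[of ws k r] by metis
  then show "(shift_mat ws \<beta> \<kappa> *\<^sub>v unit_vec N c) $ k = (of_int (\<kappa> (ws ! c)) \<cdot>\<^sub>v unit_vec N r) $ k"
    using k assms by (simp add: shift_mat_def)
qed (simp add: shift_mat_def)

lemma shift_mat_zero_mult:
  assumes "v \<in> carrier_vec N"
  shows "shift_mat ws zero_wt \<kappa> *\<^sub>v v = vec N (\<lambda>r. of_int (\<kappa> (ws ! r)) * v $ r)"
proof (rule eq_vecI)
  fix r assume "r < dim_vec (vec N (\<lambda>r. of_int (\<kappa> (ws ! r)) * v $ r))"
  then have r: "r < N" by simp
  have "(shift_mat ws zero_wt \<kappa> *\<^sub>v v) $ r =
      (\<Sum>c\<in>{0..<N}. (if ws ! r = ladd (ws ! c) zero_wt then of_int (\<kappa> (ws ! c)) else 0) * v $ c)"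
    using r assms by (simp add: shift_mat_def scalar_prod_def)
  also have "\<dots> = (\<Sum>c\<in>{0..<N}. if c = r then of_int (\<kappa> (ws ! r)) * v $ r else 0)"
    using r distinct_ws by (intro sum.cong refl) (auto simp: ladd_zero length_ws nth_eq_iff_index_eq)
  finally show "(shift_mat ws zero_wt \<kappa> *\<^sub>v v) $ r = vec N (\<lambda>r. of_int (\<kappa> (ws ! r)) * v $ r) $ r"
    using r by simp
qed (simp add: shift_mat_def)

text \<open>A nonzero vector of a subrepresentation with minimal support is supported on one weight:
  otherwise some \<open>h\<^sub>i - c\<close> shrinks its support.\<close>

lemma subrep_contains_unit:
  assumes W: "is_subrep X V W" and "W \<noteq> {0\<^sub>v N}"
  obtains c where "c < N" "unit_vec N c \<in> W"
proof -
  let ?supp = "\<lambda>v :: complex vec. {r. r < N \<and> v $ r \<noteq> 0}"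
  have W_carrier: "W \<subseteq> carrier_vec N"
    and W_add: "\<And>v w. v \<in> W \<Longrightarrow> w \<in> W \<Longrightarrow> v + w \<in> W"
    and W_smult: "\<And>c v. v \<in> W \<Longrightarrow> c \<cdot>\<^sub>v v \<in> W"
    and W_h: "\<And>i v. i \<in> I \<Longrightarrow> v \<in> W \<Longrightarrow> shift_mat ws zero_wt (\<lambda>\<mu>. coord \<mu> i) *\<^sub>v v \<in> W"
    and W_0: "0\<^sub>v N \<in> W"
    using W by (auto simp: is_subrep_def weight_rep_def)
  have "\<exists>v. v \<in> W \<and> v \<noteq> 0\<^sub>v N" using assms(2) W_0 by auto
  then obtain v where v: "v \<in> W" "v \<noteq> 0\<^sub>v N"
    and min: "\<And>w. w \<in> W \<and> w \<noteq> 0\<^sub>v N \<Longrightarrow> card (?supp v) \<le> card (?supp w)"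
    using ex_has_least_nat[of "\<lambda>v. v \<in> W \<and> v \<noteq> 0\<^sub>v N" _ "\<lambda>v. card (?supp v)"] by blast
  have vc: "v \<in> carrier_vec N" using v W_carrier by auto
  obtain c where c: "c < N" "v $ c \<noteq> 0"
    using v(2) vc by (metis carrier_vecD eq_vecI index_zero_vec)
  have single: "v $ d = 0" if d: "d < N" "d \<noteq> c" for d
  proof (rule ccontr)
    assume vd: "v $ d \<noteq> 0"
    have ne: "ws ! c \<noteq> ws ! d" using distinct_ws c d by (simp add: nth_eq_iff_index_eq)
    have len: "length (ws ! c) = lie_rank X" "length (ws ! d) = lie_rank X"
      using length_ws c d by auto
    obtain k where k: "k < lie_rank X" "ws ! c ! k \<noteq> ws ! d ! k"
      using ne len by (metis nth_equalityI)
    define i where "i = Suc k"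
    have i: "i \<in> I" "coord (ws ! c) i \<noteq> coord (ws ! d) i" using k by (auto simp: i_def coord_def)
    define u where "u = shift_mat ws zero_wt (\<lambda>\<mu>. coord \<mu> i) *\<^sub>v v + (- of_int (coord (ws ! c) i)) \<cdot>\<^sub>v v"
    have u_index: "u $ r = of_int (coord (ws ! r) i - coord (ws ! c) i) * v $ r" if "r < N" for r
      using that vc by (simp add: u_def shift_mat_zero_mult algebra_simps)
    have "u \<in> W" unfolding u_def by (intro W_add W_h W_smult v i)
    moreover have "u $ d \<noteq> 0" using u_index[OF d(1)] i(2) vd by simp
    then have "u \<noteq> 0\<^sub>v N" using d by auto
    moreover have "?supp u \<subset> ?supp v"
    proof
      show "?supp u \<subseteq> ?supp v" using u_index by auto
      show "?supp u \<noteq> ?supp v" using u_index[OF c(1)] c by auto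
    qed
    then have "card (?supp u) < card (?supp v)" by (intro psubset_card_mono) auto
    ultimately show False using min[of u] by simp
  qed
  have "unit_vec N c = (1 / v $ c) \<cdot>\<^sub>v v"
    using vc c single by (intro eq_vecI) auto
  then show thesis using that[OF c(1)] W_smult[OF v(1)] by metis
qed

text \<open>A step between two listed weights has coefficient 1 or 2, so it can be divided
  out.\<close>

lemma subrep_unit_step:
  assumes W: "is_subrep X V W" and s: "s = 1 \<or> s = -1" and i: "i \<in> I"
    and c: "c < N" and r: "r < N" "ws ! r = ladd (ws ! c) (rt s i)" and cW: "unit_vec N c \<in> W"
  shows "unit_vec N r \<in> W"
proof -
  have k: "sc s i (ws ! c) \<noteq> 0" using r by (simp add: step_coef_def flip: r(2))
  have "shift_mat ws (rt s i) (sc s i) *\<^sub>v unit_vec N c \<in> W"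
    using W s i cW by (auto simp: is_subrep_def weight_rep_def)
  then have "of_int (sc s i (ws ! c)) \<cdot>\<^sub>v unit_vec N r \<in> W"
    unfolding shift_mat_unit[OF c r] .
  then have "(1 / of_int (sc s i (ws ! c))) \<cdot>\<^sub>v (of_int (sc s i (ws ! c)) \<cdot>\<^sub>v unit_vec N r) \<in> W"
    using W by (auto simp: is_subrep_def)
  then show ?thesis using k by (simp add: smult_smult_assoc)
qed

lemma ladd_root_list_cancel:
  assumes "length \<mu> = lie_rank X"
  shows "ladd (ladd \<mu> (rt 1 i)) (rt (-1) i) = \<mu>"
  using assms by (simp add: ladd_assoc root_list_cancel ladd_zero)

text \<open>From one basis vector, raising along \<open>parent\<close> reaches the highest weight
  vector, and lowering along the same links reaches all the others.\<close>

lemma irreducible_V: "irreducible_rep X V"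
  unfolding irreducible_rep_def
proof (intro conjI allI impI)
  show "is_rep X V" by (rule is_rep_V)
  show "rep_dim V > 0" using nonempty by (simp add: weight_rep_def)
  fix W assume W: "is_subrep X V W"
  show "W = {0\<^sub>v (rep_dim V)} \<or> W = carrier_vec (rep_dim V)"
  proof (cases "W = {0\<^sub>v N}")
    case False
    with W obtain c where c: "c < N" "unit_vec N c \<in> W" by (rule subrep_contains_unit)
    have down: "unit_vec N c \<in> W \<Longrightarrow> unit_vec N 0 \<in> W" if "c < N" for c
      using that
    proof (induction c rule: less_induct)
      case (less c)
      show ?case
      proof (cases "c = 0")
        case False
        then obtain i r where ir: "i \<in> I" "r < c" "ws ! r = ladd (ws ! c) (rt 1 i)"
          using parent[of c] less.prems by blast
        then have "unit_vec N r \<in> W"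
          using subrep_unit_step[OF W _ ir(1) less.prems(2) _ ir(3) less.prems(1)] less.prems by auto
        then show ?thesis using less.IH[OF ir(2)] ir less.prems by simp
      qed (use less in simp)
    qed
    have 0: "unit_vec N 0 \<in> W" by (rule down[OF c])
    have all: "unit_vec N c \<in> W" if "c < N" for c
      using that
    proof (induction c rule: less_induct)
      case (less c)
      show ?case
      proof (cases "c = 0")
        case False
        then obtain i r where ir: "i \<in> I" "r < c" "ws ! r = ladd (ws ! c) (rt 1 i)"
          using parent[of c] less.prems by blast
        have "ws ! c = ladd (ws ! r) (rt (-1) i)"
          unfolding ir(3) using ladd_root_list_cancel length_ws less.prems by simp
        then show ?thesis
          using subrep_unit_step[OF W _ ir(1) _ less.prems _ less.IH[OF ir(2)], of "-1"] ir less.prems by simp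
      qed (use 0 in simp)
    qed
    have "v \<in> W" if v: "v \<in> carrier_vec N" for v
    proof -
      have "vec N (\<lambda>r. if r < k then v $ r else 0) \<in> W" if "k \<le> N" for k
        using that
      proof (induction k)
        case 0
        have "vec N (\<lambda>r. if r < 0 then v $ r else 0) = 0\<^sub>v N" by auto
        then show ?case using W by (simp add: is_subrep_def weight_rep_def)
      next
        case (Suc k)
        have "vec N (\<lambda>r. if r < Suc k then v $ r else 0) =
            vec N (\<lambda>r. if r < k then v $ r else 0) + (v $ k) \<cdot>\<^sub>v unit_vec N k"
          using Suc.prems by (intro eq_vecI) (auto simp: less_Suc_eq)
        moreover have "(v $ k) \<cdot>\<^sub>v unit_vec N k \<in> W"
          using all[of k] Suc.prems W by (simp add: is_subrep_def)
        ultimately show ?case using Suc W by (simp add: is_subrep_def)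
      qed
      from this[of N] have "vec N (\<lambda>r. if r < N then v $ r else 0) \<in> W" by simp
      moreover have "vec N (\<lambda>r. if r < N then v $ r else 0) = v" using v by (intro eq_vecI) auto
      ultimately show ?thesis by simp
    qed
    moreover have "W \<subseteq> carrier_vec N" using W by (simp add: is_subrep_def weight_rep_def)
    ultimately show ?thesis by (auto simp: weight_rep_def)
  qed (simp add: weight_rep_def)
qed

lemma is_irrep_V:
  assumes top: "\<And>i. i \<in> I \<Longrightarrow> ladd (ws ! 0) (rt 1 i) \<notin> set ws"
    and lam: "\<And>i. i \<in> I \<Longrightarrow> lam i = real_of_int (coord (ws ! 0) i)"
  shows "is_irrep X lam V"
proof -
  have N: "0 < N" using nonempty by simp
  have "shift_mat ws (rt 1 i) (sc 1 i) *\<^sub>v unit_vec N 0 = 0\<^sub>v N" if i: "i \<in> I" for i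
  proof (rule eq_vecI)
    fix r assume "r < dim_vec (0\<^sub>v N :: complex vec)"
    then have "r < N" by simp
    then have "ws ! r \<noteq> ladd (ws ! 0) (rt 1 i)" using top[OF i] by (metis nth_mem)
    then show "(shift_mat ws (rt 1 i) (sc 1 i) *\<^sub>v unit_vec N 0) $ r = 0\<^sub>v N $ r"
      using \<open>r < N\<close> N by (simp add: shift_mat_def)
  qed (simp add: shift_mat_def)
  moreover have "shift_mat ws zero_wt (\<lambda>\<mu>. coord \<mu> i) *\<^sub>v unit_vec N 0 =
      complex_of_real (lam i) \<cdot>\<^sub>v unit_vec N 0" if i: "i \<in> I" for i
    using shift_mat_unit[OF N N, of zero_wt "\<lambda>\<mu>. coord \<mu> i"] lam[OF i] N
    by (simp add: ladd_zero length_ws)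
  moreover have "(unit_vec N 0 :: complex vec) \<noteq> 0\<^sub>v N"
    using N by (metis index_unit_vec(2) index_zero_vec(1) zero_neq_one)
  ultimately have "has_highest_weight X V lam"
    unfolding has_highest_weight_def
    by (intro bexI[of _ "unit_vec N 0"]) (simp_all add: weight_rep_def)
  then show ?thesis using irreducible_V by (simp add: is_irrep_def)
qed

end

section \<open>Minuscule weights and real structures\<close>

definition weight_of :: "cartan_type \<Rightarrow> int list \<Rightarrow> weight" where
  "weight_of X \<mu> = (\<lambda>j. if j \<in> {1..lie_rank X} then of_int (coord \<mu> j) else 0)"

abbreviation lneg :: "int list \<Rightarrow> int list" where
  "lneg \<equiv> map uminus"

lemma lneg_lneg [simp]: "lneg (lneg \<mu>) = \<mu>"
  by (simp add: comp_def)

lemma lneg_ladd: "lneg (ladd \<mu> \<nu>) = ladd (lneg \<mu>) (lneg \<nu>)"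
  by (rule nth_equalityI) auto

lemma lneg_root_list: "lneg (root_list X s i) = root_list X (- s) i"
  by (simp add: root_list_def comp_def)

lemma coord_lneg:
  assumes "length \<mu> = lie_rank X" "i \<in> {1..lie_rank X}"
  shows "coord (lneg \<mu>) i = - coord \<mu> i"
  using assms by (auto simp: coord_def)

lemma map_mult_root_list: "map ((*) s) (root_list X 1 i) = root_list X s i"
  by (simp add: root_list_def comp_def)

text \<open>The string through \<open>\<mu>\<close> in the direction of a simple root has length at most 2 in the minuscule
  case, so membership of its neighbours in the list can be read off the coordinate of \<open>\<mu>\<close>.\<close>

locale minuscule = weight_list +
  assumes simply_laced: "\<And>i j. i \<in> {1..lie_rank X} \<Longrightarrow> j \<in> {1..lie_rank X} \<Longrightarrow> i \<noteq> j \<Longrightarrow>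
      cartan X i j = cartan X j i \<and> (cartan X i j = 0 \<or> cartan X i j = -1)"
    and small: "\<And>\<mu> i. \<mu> \<in> set ws \<Longrightarrow> i \<in> {1..lie_rank X} \<Longrightarrow> coord \<mu> i \<in> {-1, 0, 1}"
    and closed: "\<And>\<mu> i. \<mu> \<in> set ws \<Longrightarrow> i \<in> {1..lie_rank X} \<Longrightarrow>
      ladd \<mu> (root_list X (- coord \<mu> i) i) \<in> set ws"
begin

lemma coord_step:
  assumes "\<mu> \<in> set ws" "j \<in> I"
  shows "coord (ladd \<mu> (rt s i)) j = coord \<mu> j + s * cartan X i j"
  using assms by (simp add: coord_ladd coord_root_list length_ws)

text \<open>A step by \<open>s\<close> times the root \<open>i\<close> changes the coordinate at
  \<open>i\<close> by \<open>2 * s\<close>. Both values lie between -1 and 1, so the step runs from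
  \<open>- s\<close> to \<open>s\<close>, and it is then the reflection.\<close>

lemma step_mem_iff:
  assumes \<mu>: "\<mu> \<in> set ws" and i: "i \<in> I" and s: "s = 1 \<or> s = -1"
  shows "ladd \<mu> (rt s i) \<in> set ws \<longleftrightarrow> coord \<mu> i = - s"
proof
  assume "ladd \<mu> (rt s i) \<in> set ws"
  then have "coord (ladd \<mu> (rt s i)) i \<in> {-1, 0, 1}" using i by (rule small)
  then have "coord \<mu> i + s * 2 \<in> {-1, 0, 1}" unfolding coord_step[OF \<mu> i] cartan_diag .
  then show "coord \<mu> i = - s" using small[OF \<mu> i] s by auto
next
  assume "coord \<mu> i = - s"
  then show "ladd \<mu> (rt s i) \<in> set ws" using closed[OF \<mu> i] by simp
qed

lemma sc_eq:
  assumes "\<mu> \<in> set ws" "i \<in> I" "s = 1 \<or> s = -1"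
  shows "sc s i \<mu> = (if coord \<mu> i = - s then 1 else 0)"
  unfolding step_coef_def step_mem_iff[OF assms] using assms(3) by auto

lemma sc_sc:
  assumes \<mu>: "\<mu> \<in> set ws" and i: "i \<in> I" and j: "j \<in> I" and s: "s = 1 \<or> s = -1" "t = 1 \<or> t = -1"
  shows "sc s i (ladd \<mu> (rt t j)) * sc t j \<mu> =
    (if coord \<mu> j = - t \<and> coord \<mu> i + t * cartan X j i = - s then 1 else 0)"
proof (cases "coord \<mu> j = - t")
  case True
  then have \<nu>: "ladd \<mu> (rt t j) \<in> set ws" using step_mem_iff[OF \<mu> j s(2)] by simp
  show ?thesis
    unfolding sc_eq[OF \<mu> j s(2)] sc_eq[OF \<nu> i s(1)] coord_step[OF \<mu> i] using True by simp
qed (simp add: sc_eq[OF \<mu> j s(2)])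

lemma sc_twice:
  assumes "\<mu> \<in> set ws" "i \<in> I" "s = 1 \<or> s = -1"
  shows "sc s i (ladd \<mu> (rt s i)) * sc s i \<mu> = 0"
  unfolding sc_sc[OF assms(1,2,2,3,3)] using assms(3) by (auto simp: cartan_diag)

text \<open>For distinct nodes with Cartan entry -1, either order of steps would need a coordinate
  of absolute value 2. With entry 0 the two orders have the same condition and cancel.\<close>

lemma ef_minuscule:
  assumes i: "i \<in> I" and j: "j \<in> I" and \<mu>: "\<mu> \<in> set ws"
  shows "comm_coef (rt 1 i) (sc 1 i) (rt (-1) j) (sc (-1) j) \<mu> = (if i = j then coord \<mu> i else 0)"
proof -
  have eq: "comm_coef (rt 1 i) (sc 1 i) (rt (-1) j) (sc (-1) j) \<mu> =
      (if coord \<mu> j = 1 \<and> coord \<mu> i - cartan X j i = -1 then 1 else 0) -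
      (if coord \<mu> i = -1 \<and> coord \<mu> j + cartan X i j = 1 then 1 else 0)"
    unfolding comm_coef_def using sc_sc[OF \<mu> i j, of 1 "-1"] sc_sc[OF \<mu> j i, of "-1" 1] by simp
  show ?thesis
  proof (cases "i = j")
    case True
    then show ?thesis unfolding eq using small[OF \<mu> i] by (auto simp: cartan_diag)
  next
    case False
    then show ?thesis unfolding eq using simply_laced[OF i j] small[OF \<mu> i] small[OF \<mu> j] by auto
  qed
qed

lemma serre_minuscule:
  assumes s: "s = 1 \<or> s = -1" and i: "i \<in> I" and j: "j \<in> I" and ij: "i \<noteq> j" and \<mu>: "\<mu> \<in> set ws"
  shows "snd (ad_coef (rt s i) (sc s i) (nat (1 - cartan X j i)) (rt s j, sc s j)) \<mu> = 0"
proof -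
  let ?\<beta> = "rt s i" and ?\<gamma> = "rt s j" and ?\<kappa> = "sc s i" and ?\<kappa>' = "sc s j"
  note sl = simply_laced[OF j i ij[symmetric]]
  consider "cartan X j i = 0" | "cartan X j i = -1" using sl by auto
  then show ?thesis
  proof cases
    case 1
    have "comm_coef ?\<beta> ?\<kappa> ?\<gamma> ?\<kappa>' \<mu> = 0"
      unfolding comm_coef_def sc_sc[OF \<mu> i j s s] sc_sc[OF \<mu> j i s s] using 1 sl by auto
    then show ?thesis using 1 by (simp add: ad_coef_def)
  next
    case 2
    have jii: "?\<kappa> (ladd (ladd \<mu> ?\<gamma>) ?\<beta>) * (?\<kappa> (ladd \<mu> ?\<gamma>) * ?\<kappa>' \<mu>) = 0"
    proof (cases "?\<kappa>' \<mu> = 0")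
      case False
      then have "ladd \<mu> ?\<gamma> \<in> set ws" by (simp add: step_coef_def split: if_splits)
      from sc_twice[OF this i s] show ?thesis by (simp only: mult.assoc[symmetric] mult_zero_left)
    qed simp
    \<comment> \<open>The first step puts the coordinate at \<open>i\<close> to \<open>s\<close> and
      the step along \<open>j\<close> lowers it to 0, but a second step along \<open>i\<close> would
      have to start at \<open>- s\<close>.\<close>
    have iji: "?\<kappa> (ladd (ladd \<mu> ?\<beta>) ?\<gamma>) * (?\<kappa>' (ladd \<mu> ?\<beta>) * ?\<kappa> \<mu>) = 0"
    proof (cases "?\<kappa> \<mu> = 0")
      case False
      then have \<nu>: "ladd \<mu> ?\<beta> \<in> set ws" and "coord \<mu> i = - s"
        using sc_eq[OF \<mu> i s] by (auto simp: step_coef_def split: if_splits)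
      then have "?\<kappa> (ladd (ladd \<mu> ?\<beta>) ?\<gamma>) * ?\<kappa>' (ladd \<mu> ?\<beta>) = 0"
        unfolding sc_sc[OF \<nu> i j s s] coord_step[OF \<mu> i] using 2 s by (auto simp: cartan_diag)
      then show ?thesis by (simp only: mult.assoc[symmetric] mult_zero_left)
    qed simp
    have iij: "?\<kappa>' (ladd (ladd \<mu> ?\<beta>) ?\<beta>) * (?\<kappa> (ladd \<mu> ?\<beta>) * ?\<kappa> \<mu>) = 0"
      using sc_twice[OF \<mu> i s] by simp
    have "nat (1 - cartan X j i) = Suc (Suc 0)" using 2 by simp
    then have "snd (ad_coef ?\<beta> ?\<kappa> (nat (1 - cartan X j i)) (?\<gamma>, ?\<kappa>')) \<mu> =
        comm_coef ?\<beta> ?\<kappa> (ladd ?\<beta> ?\<gamma>) (comm_coef ?\<beta> ?\<kappa> ?\<gamma> ?\<kappa>') \<mu>"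
      by (simp add: ad_coef_def)
    also have "\<dots> = ?\<kappa> (ladd (ladd \<mu> ?\<gamma>) ?\<beta>) * (?\<kappa> (ladd \<mu> ?\<gamma>) * ?\<kappa>' \<mu>)
        - 2 * (?\<kappa> (ladd (ladd \<mu> ?\<beta>) ?\<gamma>) * (?\<kappa>' (ladd \<mu> ?\<beta>) * ?\<kappa> \<mu>))
        + ?\<kappa>' (ladd (ladd \<mu> ?\<beta>) ?\<beta>) * (?\<kappa> (ladd \<mu> ?\<beta>) * ?\<kappa> \<mu>)"
    proof -
      have "ladd \<mu> (ladd ?\<beta> ?\<gamma>) = ladd (ladd \<mu> ?\<beta>) ?\<gamma>"
        "ladd (ladd \<mu> ?\<gamma>) ?\<beta> = ladd (ladd \<mu> ?\<beta>) ?\<gamma>"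
        by (simp_all only: ladd_assoc ladd_commute[of ?\<gamma> ?\<beta>])
      then show ?thesis unfolding comm_coef_def by (simp add: algebra_simps)
    qed
    finally show ?thesis unfolding jii iji iij by simp
  qed
qed

end

section \<open>Finite certificates for weights and Hodge data\<close>

definition dot :: "int list \<Rightarrow> int list \<Rightarrow> int" where
  "dot g \<mu> = sum_list (map2 (*) g \<mu>)"

text \<open>If \<open>g\<close> pairs to 2 with the compact simple roots and to 0 with the noncompact one, this is
  \<open>(-1)\<^sup>k\<close>, where \<open>k\<close> is the number of compact simple roots in \<open>\<lambda> - \<mu>\<close> and \<open>c = \<langle>g, \<lambda>\<rangle>\<close>.\<close>

definition parity_sign :: "int list \<Rightarrow> int \<Rightarrow> int list \<Rightarrow> int" where
  "parity_sign g c \<mu> = (if (c - dot g \<mu>) mod 4 = 0 then 1 else -1)"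

text \<open>The list \<open>os\<close> is the Weyl group orbit of the highest weight \<open>ws ! 0\<close>.\<close>

definition weights_check ::
    "cartan_type \<Rightarrow> (nat \<times> int list) list \<Rightarrow> int list list \<Rightarrow> int list list \<Rightarrow> bool" where
  "weights_check X roots ws os \<longleftrightarrow>
     roots = map (\<lambda>i. (i, root_list X 1 i)) [1..<Suc (lie_rank X)] \<and>
     distinct ws \<and> ws \<noteq> [] \<and> (\<forall>\<mu>\<in>set ws. length \<mu> = lie_rank X) \<and>
     (\<forall>c\<in>set [1..<length ws]. \<exists>(i, r)\<in>set roots. ladd (ws ! c) r \<in> set (take c ws)) \<and>
     (\<forall>(i, r)\<in>set roots. ladd (ws ! 0) r \<notin> set ws) \<and>
     ws ! 0 \<in> set os \<and> set os \<subseteq> set ws \<and>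
     (\<forall>\<mu>\<in>set os. \<forall>(i, r)\<in>set roots. ladd \<mu> (map ((*) (- coord \<mu> i)) r) \<in> set os) \<and>
     list_all (\<lambda>x. 0 \<le> x) (ws ! 0) \<and>
     (\<forall>\<mu>\<in>set os. list_all (\<lambda>x. x \<le> 0) \<mu> \<longrightarrow> \<mu> = lneg (ws ! 0))"

text \<open>The sign defines the antilinear map sending the vector of weight \<mu> to its sign times
  the vector of weight -\<mu>. The first clause makes it an involution, the second intertwines it
  with the real form, with sign 1 at the noncompact node \<open>k\<close>. The vector
  \<open>h\<close> is the grading element, and the counts give the extreme Hodge numbers.\<close>

definition hodge_check :: "nat \<Rightarrow> (nat \<times> int list) list \<Rightarrow> int list list \<Rightarrow> int list \<Rightarrow> int list \<Rightarrow> bool" where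
  "hodge_check k roots ws h g \<longleftrightarrow> (let \<sigma> = parity_sign g (dot g (ws ! 0)) in
     (\<forall>\<mu>\<in>set ws. lneg \<mu> \<in> set ws \<and> \<sigma> \<mu> * \<sigma> (lneg \<mu>) = 1) \<and>
     (\<forall>\<mu>\<in>set ws. \<forall>(i, r)\<in>set roots. ladd \<mu> r \<in> set ws \<longrightarrow>
        \<sigma> (ladd \<mu> r) = (if i = k then 1 else -1) * \<sigma> \<mu>)) \<and>
     length h = length (ws ! 0) \<and> dot h (ws ! 0) = -3 \<and>
     length (filter (\<lambda>\<mu>. dot h \<mu> = 3) ws) = 1 \<and> length (filter (\<lambda>\<mu>. dot h \<mu> = -3) ws) = 1 \<and>
     (\<forall>\<mu>\<in>set ws. -3 \<le> dot h \<mu> \<and> dot h \<mu> \<le> 3)"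

locale checked_weights = weight_list +
  fixes roots :: "(nat \<times> int list) list" and os :: "int list list"
  assumes check: "weights_check X roots ws os"
begin

lemma roots_eq: "set roots = {(i, rt 1 i) | i. i \<in> I}"
  using check by (auto simp: weights_check_def)

lemma nonempty_ws: "ws \<noteq> []"
  using check by (simp add: weights_check_def)

lemma top_mem: "ws ! 0 \<in> set ws"
  using nonempty_ws by simp

lemma parent_ws:
  assumes "0 < c" "c < length ws"
  shows "\<exists>i\<in>I. \<exists>r<c. ws ! r = ladd (ws ! c) (rt 1 i)"
proof -
  have "c \<in> set [1..<length ws]" using assms by simp
  with check obtain i r where "(i, r) \<in> set roots" "ladd (ws ! c) r \<in> set (take c ws)"
    unfolding weights_check_def by blast
  then have "i \<in> I" "ladd (ws ! c) (rt 1 i) \<in> set (take c ws)" by (auto simp: roots_eq)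
  moreover then obtain r where "r < c" "ws ! r = ladd (ws ! c) (rt 1 i)"
    by (auto simp: in_set_conv_nth)
  ultimately show ?thesis by blast
qed

lemma top_ws: "i \<in> I \<Longrightarrow> ladd (ws ! 0) (rt 1 i) \<notin> set ws"
  using check roots_eq unfolding weights_check_def by fast

lemma closed_os:
  assumes "\<mu> \<in> set os" "i \<in> I"
  shows "ladd \<mu> (rt (- coord \<mu> i) i) \<in> set os"
proof -
  have "\<forall>(i, r)\<in>set roots. ladd \<mu> (map ((*) (- coord \<mu> i)) r) \<in> set os"
    using check assms(1) unfolding weights_check_def by blast
  moreover have "(i, rt 1 i) \<in> set roots" using assms(2) by (auto simp: roots_eq)
  ultimately have "ladd \<mu> (map ((*) (- coord \<mu> i)) (rt 1 i)) \<in> set os" by blast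
  then show ?thesis unfolding map_mult_root_list .
qed

lemma length_os: "\<mu> \<in> set os \<Longrightarrow> length \<mu> = lie_rank X"
  using check length_ws by (auto simp: weights_check_def)

lemma top_os: "ws ! 0 \<in> set os"
  using check by (simp add: weights_check_def)

lemma simple_refl_weight_of:
  assumes "\<mu> \<in> set os" "i \<in> I"
  shows "simple_refl X i (weight_of X \<mu>) = weight_of X (ladd \<mu> (rt (- coord \<mu> i) i))"
proof (rule ext)
  fix j
  show "simple_refl X i (weight_of X \<mu>) j = weight_of X (ladd \<mu> (rt (- coord \<mu> i) i)) j"
  proof (cases "j \<in> I")
    case True
    then show ?thesis
      unfolding simple_refl_apply using assms
      by (simp add: weight_of_def simple_root_apply coord_ladd coord_root_list length_os)
  next
    case False
    then show ?thesis unfolding simple_refl_apply by (simp only: weight_of_def simple_root_apply if_False)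
  qed
qed

text \<open>The negative of tau of the highest weight lies in the listed orbit and is antidominant;
  by the check, the only such member is the negative of the highest weight.\<close>

lemma tau_top:
  assumes "finite_coroots X R"
  shows "tau X (weight_of X (ws ! 0)) = weight_of X (ws ! 0)"
proof -
  let ?lam = "weight_of X (ws ! 0)"
  have mem: "x \<in> set (ws ! 0) \<Longrightarrow> 0 \<le> x" for x
    using check by (simp add: weights_check_def list_all_iff)
  have "- tau X ?lam \<in> weight_of X ` set os"
    by (rule finite_coroots.tau_orbit[OF assms])
      (use top_os closed_os in \<open>auto simp: simple_refl_weight_of\<close>)
  then obtain \<mu> where \<mu>: "\<mu> \<in> set os" "- tau X ?lam = weight_of X \<mu>" by blast
  have "0 \<le> ?lam j" if "j \<in> I" for j
  proof -
    have "j - 1 < length (ws ! 0)" using that length_ws[OF top_mem] by auto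
    then have "0 \<le> coord (ws ! 0) j" unfolding coord_def by (intro mem nth_mem)
    then show ?thesis by (simp add: weight_of_def)
  qed
  then have "0 \<le> tau X ?lam j" if "j \<in> I" for j
    using finite_coroots.tau_nonneg[OF assms _ that] by blast
  moreover have "tau X ?lam j = - weight_of X \<mu> j" for j
    using fun_cong[OF \<mu>(2), of j] by simp
  ultimately have neg: "coord \<mu> j \<le> 0" if "j \<in> I" for j
    using that by (simp add: weight_of_def)
  have "list_all (\<lambda>x. x \<le> 0) \<mu>"
    unfolding list_all_iff
  proof
    fix x assume "x \<in> set \<mu>"
    then obtain k where "k < lie_rank X" "x = \<mu> ! k" using length_os[OF \<mu>(1)] by (auto simp: in_set_conv_nth)
    then show "x \<le> 0" using neg[of "Suc k"] by (simp add: coord_def)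
  qed
  then have eq: "\<mu> = lneg (ws ! 0)" using check \<mu>(1) by (simp add: weights_check_def)
  show ?thesis
  proof (rule ext)
    fix j
    have "tau X ?lam j = - weight_of X (lneg (ws ! 0)) j" using fun_cong[OF \<mu>(2), of j] eq by simp
    also have "\<dots> = ?lam j" using coord_lneg[OF length_ws[OF top_mem]] by (simp add: weight_of_def)
    finally show "tau X ?lam j = ?lam j" .
  qed
qed

end

locale calabi_yau_weights = weight_representation + checked_weights +
  fixes k :: nat and h g :: "int list"
  assumes hodge_check: "hodge_check k roots ws h g"
    and grading: "\<And>i. i \<in> {1..lie_rank X} \<Longrightarrow> grading_element (X, k) i = of_int (coord h i)"
begin

abbreviation "\<sigma> \<equiv> parity_sign g (dot g (ws ! 0))"

lemma neg_ws: "\<mu> \<in> set ws \<Longrightarrow> lneg \<mu> \<in> set ws"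
  and \<sigma>_neg: "\<mu> \<in> set ws \<Longrightarrow> \<sigma> \<mu> * \<sigma> (lneg \<mu>) = 1"
  using hodge_check unfolding hodge_check_def Let_def by blast+

lemma \<sigma>_step:
  assumes "\<mu> \<in> set ws" "i \<in> I" "ladd \<mu> (rt 1 i) \<in> set ws"
  shows "\<sigma> (ladd \<mu> (rt 1 i)) = (if i = k then 1 else -1) * \<sigma> \<mu>"
proof -
  have "(i, rt 1 i) \<in> set roots" using assms(2) by (auto simp: roots_eq)
  then show ?thesis using hodge_check assms(1,3) unfolding hodge_check_def Let_def by blast
qed

lemma \<sigma>_step':
  assumes "\<mu> \<in> set ws" "i \<in> I" "s = 1 \<or> s = -1" "ladd \<mu> (rt s i) \<in> set ws"
  shows "\<sigma> (ladd \<mu> (rt s i)) = (if i = k then 1 else -1) * \<sigma> \<mu>"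
proof (cases "s = 1")
  case True
  then show ?thesis using \<sigma>_step assms by simp
next
  case False
  then have s: "s = -1" using assms(3) by simp
  have "ladd (ladd \<mu> (rt (-1) i)) (rt 1 i) = \<mu>"
    using ladd_zero[of \<mu>] length_ws[OF assms(1)]
    by (simp add: ladd_assoc root_list_cancel ladd_commute[of "rt (-1) i"])
  then show ?thesis using \<sigma>_step[of "ladd \<mu> (rt (-1) i)" i] assms unfolding s by auto
qed

text \<open>Negation reverses strings and keeps their middles, so corresponding steps have equal
  coefficients.\<close>

lemma sc_neg: "sc (- s) i (lneg \<mu>) = sc s i \<mu>" if "\<mu> \<in> set ws" "i \<in> I"
proof -
  have "ladd (lneg \<mu>) (rt (- s) i) \<in> set ws \<longleftrightarrow> ladd \<mu> (rt s i) \<in> set ws"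
    unfolding lneg_root_list[symmetric] lneg_ladd[symmetric] using neg_ws lneg_lneg by metis
  then show ?thesis
    using coord_lneg[of \<mu> X i] that length_ws by (simp add: step_coef_def)
qed

definition neg_index :: "nat \<Rightarrow> nat" where
  "neg_index r = (SOME c. c < N \<and> ws ! c = lneg (ws ! r))"

lemma neg_index:
  assumes "r < N"
  shows "neg_index r < N" "ws ! neg_index r = lneg (ws ! r)"
proof -
  have "\<exists>c. c < N \<and> ws ! c = lneg (ws ! r)"
    using neg_ws[of "ws ! r"] assms by (auto simp: in_set_conv_nth)
  then have "neg_index r < N \<and> ws ! neg_index r = lneg (ws ! r)"
    unfolding neg_index_def by (rule someI_ex)
  then show "neg_index r < N" "ws ! neg_index r = lneg (ws ! r)" by auto
qed

lemma neg_index_neg_index: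
  assumes "r < N"
  shows "neg_index (neg_index r) = r"
proof -
  have "ws ! neg_index (neg_index r) = ws ! r" using assms neg_index by simp
  then show ?thesis
    using nth_eq_iff_index_eq[OF distinct_ws neg_index(1)[OF neg_index(1)[OF assms]] assms] by blast
qed

definition conj_map :: "complex vec \<Rightarrow> complex vec" where
  "conj_map v = vec N (\<lambda>r. of_int (\<sigma> (ws ! neg_index r)) * cnj (v $ neg_index r))"

text \<open>On the vector of weight \<mu> both sides are multiples of the vector of weight -(\<mu> +
  \<beta>), and \<open>eq\<close> compares the two factors. One computation thus covers raising,
  lowering and Cartan operators.\<close>

lemma conj_map_shift:
  assumes v: "v \<in> carrier_vec N"
    and eq: "\<And>\<mu>. \<mu> \<in> set ws \<Longrightarrow> ladd \<mu> \<beta> \<in> set ws \<Longrightarrow> \<sigma> (ladd \<mu> \<beta>) * \<kappa> \<mu> = \<theta> * \<sigma> \<mu> * \<kappa>' (lneg \<mu>)"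
  shows "conj_map (shift_mat ws \<beta> \<kappa> *\<^sub>v v) = of_int \<theta> \<cdot>\<^sub>v (shift_mat ws (lneg \<beta>) \<kappa>' *\<^sub>v conj_map v)"
proof (rule eq_vecI)
  fix r assume "r < dim_vec (of_int \<theta> \<cdot>\<^sub>v (shift_mat ws (lneg \<beta>) \<kappa>' *\<^sub>v conj_map v))"
  then have r: "r < N" by (simp add: shift_mat_def)
  let ?m = "neg_index r"
  have m: "?m < N" "ws ! ?m = lneg (ws ! r)" using neg_index[OF r] by auto
  have "conj_map (shift_mat ws \<beta> \<kappa> *\<^sub>v v) $ r = of_int (\<sigma> (ws ! ?m)) *
      cnj (\<Sum>c\<in>{0..<N}. (if ws ! ?m = ladd (ws ! c) \<beta> then of_int (\<kappa> (ws ! c)) else 0) * v $ c)"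
    using r m v by (simp add: conj_map_def shift_mat_def scalar_prod_def)
  also have "\<dots> = (\<Sum>c\<in>{0..<N}. if ws ! ?m = ladd (ws ! c) \<beta> then
      of_int (\<sigma> (ws ! ?m) * \<kappa> (ws ! c)) * cnj (v $ c) else 0)"
    unfolding cnj_sum sum_distrib_left by (intro sum.cong) auto
  also have "\<dots> = (\<Sum>d\<in>{0..<N}. of_int \<theta> * ((if ws ! r = ladd (ws ! d) (lneg \<beta>) then
      of_int (\<kappa>' (ws ! d)) else 0) * (of_int (\<sigma> (ws ! neg_index d)) * cnj (v $ neg_index d))))"
  proof (rule sum.reindex_bij_witness[of _ neg_index neg_index])
    fix c assume "c \<in> {0..<N}"
    then have c: "c < N" by simp
    have cond: "ws ! r = ladd (ws ! neg_index c) (lneg \<beta>) \<longleftrightarrow> ws ! ?m = ladd (ws ! c) \<beta>"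
      unfolding m neg_index(2)[OF c] lneg_ladd[symmetric] using lneg_lneg by metis
    show "of_int \<theta> * ((if ws ! r = ladd (ws ! neg_index c) (lneg \<beta>) then
        of_int (\<kappa>' (ws ! neg_index c)) else 0) *
        (of_int (\<sigma> (ws ! neg_index (neg_index c))) * cnj (v $ neg_index (neg_index c)))) =
      (if ws ! ?m = ladd (ws ! c) \<beta> then of_int (\<sigma> (ws ! ?m) * \<kappa> (ws ! c)) * cnj (v $ c) else 0)"
    proof (cases "ws ! ?m = ladd (ws ! c) \<beta>")
      case True
      then have e: "\<sigma> (ws ! ?m) * \<kappa> (ws ! c) = \<theta> * \<sigma> (ws ! c) * \<kappa>' (lneg (ws ! c))"
        using eq[of "ws ! c"] c m(1) nth_mem[of ?m ws] by simp
      have c1: "ws ! r = ladd (ws ! neg_index c) (lneg \<beta>)" using cond True by blast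
      show ?thesis
        unfolding if_P[OF c1] if_P[OF True] e
        unfolding neg_index_neg_index[OF c] neg_index(2)[OF c] by simp
    qed (simp add: cond)
  qed (simp_all add: neg_index neg_index_neg_index)
  also have "\<dots> = (of_int \<theta> \<cdot>\<^sub>v (shift_mat ws (lneg \<beta>) \<kappa>' *\<^sub>v conj_map v)) $ r"
    using r by (simp add: conj_map_def shift_mat_def scalar_prod_def sum_distrib_left)
  finally show "conj_map (shift_mat ws \<beta> \<kappa> *\<^sub>v v) $ r =
    (of_int \<theta> \<cdot>\<^sub>v (shift_mat ws (lneg \<beta>) \<kappa>' *\<^sub>v conj_map v)) $ r" .
qed (simp add: conj_map_def shift_mat_def)

lemma conj_map_step:
  assumes v: "v \<in> carrier_vec N" and i: "i \<in> I" and s: "s = 1 \<or> s = -1"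
  shows "conj_map (shift_mat ws (rt s i) (sc s i) *\<^sub>v v) =
    theta_sign (X, k) i \<cdot>\<^sub>v (shift_mat ws (rt (- s) i) (sc (- s) i) *\<^sub>v conj_map v)"
proof -
  have "theta_sign (X, k) i = of_int (if i = k then 1 else -1)" by (simp add: theta_sign_def)
  moreover have "conj_map (shift_mat ws (rt s i) (sc s i) *\<^sub>v v) = of_int (if i = k then 1 else -1) \<cdot>\<^sub>v
      (shift_mat ws (lneg (rt s i)) (sc (- s) i) *\<^sub>v conj_map v)"
    by (rule conj_map_shift[OF v]) (use \<sigma>_step'[OF _ i s] sc_neg[OF _ i] in simp)
  ultimately show ?thesis by (simp only: lneg_root_list)
qed

lemma conj_map_h:
  assumes v: "v \<in> carrier_vec N" and i: "i \<in> I"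
  shows "conj_map (shift_mat ws zero_wt (\<lambda>\<mu>. coord \<mu> i) *\<^sub>v v) =
    - (shift_mat ws zero_wt (\<lambda>\<mu>. coord \<mu> i) *\<^sub>v conj_map v)"
proof -
  have "conj_map (shift_mat ws zero_wt (\<lambda>\<mu>. coord \<mu> i) *\<^sub>v v) =
      of_int (-1) \<cdot>\<^sub>v (shift_mat ws (lneg zero_wt) (\<lambda>\<mu>. coord \<mu> i) *\<^sub>v conj_map v)"
    by (rule conj_map_shift[OF v]) (use i in \<open>simp add: ladd_zero length_ws coord_lneg\<close>)
  moreover have "of_int (-1) \<cdot>\<^sub>v w = - w" for w :: "complex vec" by (rule eq_vecI) auto
  ultimately show ?thesis by (simp only: map_replicate minus_zero)
qed

lemma is_real_rep_V: "is_real_rep (X, k) V"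
  unfolding is_real_rep_def
proof
  have J: "conj_map v \<in> carrier_vec N" for v by (simp add: conj_map_def)
  have JJ: "conj_map (conj_map v) = v" if v: "v \<in> carrier_vec N" for v
  proof (rule eq_vecI)
    fix r assume "r < dim_vec v"
    then have r: "r < N" using v by simp
    have "\<sigma> (ws ! r) * \<sigma> (lneg (ws ! r)) = 1" by (rule \<sigma>_neg) (use r in simp)
    then have "of_int (\<sigma> (lneg (ws ! r))) * (of_int (\<sigma> (ws ! r)) * x) = x" for x :: complex
      by (metis mult.assoc mult.commute mult_1 of_int_1 of_int_mult)
    then show "conj_map (conj_map v) $ r = v $ r"
      using r by (simp add: conj_map_def neg_index neg_index_neg_index)
  qed (use v in \<open>simp add: conj_map_def\<close>)
  have add: "conj_map (v + w) = conj_map v + conj_map w"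
    if "v \<in> carrier_vec N" "w \<in> carrier_vec N" for v w
    using that by (intro eq_vecI) (auto simp: conj_map_def neg_index algebra_simps)
  have smult: "conj_map (c \<cdot>\<^sub>v v) = cnj c \<cdot>\<^sub>v conj_map v" if "v \<in> carrier_vec N" for c v
    using that by (intro eq_vecI) (auto simp: conj_map_def neg_index)
  show "real_structure (X, k) V conj_map"
    unfolding real_structure_def
    using J JJ add smult conj_map_step[of _ _ 1] conj_map_step[of _ _ "-1"] conj_map_h
    by (simp add: weight_rep_def)
qed

lemma dot_eq_sum:
  assumes "length \<mu> = lie_rank X" "length \<nu> = lie_rank X"
  shows "dot \<mu> \<nu> = (\<Sum>i\<in>I. coord \<mu> i * coord \<nu> i)"
proof -
  have "dot \<mu> \<nu> = (\<Sum>i\<in>{0..<lie_rank X}. \<mu> ! i * \<nu> ! i)"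
    unfolding dot_def using assms by (simp add: sum_list_sum_nth)
  also have "\<dots> = (\<Sum>i\<in>I. coord \<mu> i * coord \<nu> i)"
    by (rule sum.reindex_bij_witness[of _ "\<lambda>i. i - 1" Suc]) (auto simp: coord_def)
  finally show ?thesis .
qed

lemma length_h: "length h = lie_rank X"
  using hodge_check length_ws[OF top_mem] by (simp add: hodge_check_def)

lemma pairing_grading:
  assumes "\<mu> \<in> set ws"
  shows "(\<Sum>i\<in>I. grading_element (X, k) i * of_int (coord \<mu> i)) = of_int (dot h \<mu>)"
  unfolding dot_eq_sum[OF length_h length_ws[OF assms]] using grading by simp

lemma E_val_weight_of:
  assumes "\<mu> \<in> set ws"
  shows "E_val (X, k) (weight_of X \<mu>) = of_int (dot h \<mu>)"
  unfolding E_val_def pairing_def pairing_grading[OF assms, symmetric] by (simp add: weight_of_def)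

lemma E_matrix_minus:
  "E_matrix (X, k) V - of_int m \<cdot>\<^sub>m 1\<^sub>m (rep_dim V) =
    mat N N (\<lambda>(r, c). if r = c then of_int (dot h (ws ! r) - m) else 0)"
proof (rule eq_matI)
  fix r c
  assume "r < dim_row (mat N N (\<lambda>(r, c). if r = c then of_int (dot h (ws ! r) - m) else 0 :: complex))"
    "c < dim_col (mat N N (\<lambda>(r, c). if r = c then of_int (dot h (ws ! r) - m) else 0 :: complex))"
  then have rc: "r < N" "c < N" by auto
  have "ws ! r = ladd (ws ! c) zero_wt \<longleftrightarrow> r = c"
    using rc distinct_ws by (simp add: ladd_zero length_ws nth_eq_iff_index_eq)
  then have "E_matrix (X, k) V $$ (r, c) = (if r = c then
      complex_of_real (\<Sum>i\<in>I. grading_element (X, k) i * of_int (coord (ws ! r) i)) else 0)"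
    using rc by (simp add: E_matrix_def weight_rep_def shift_mat_def)
  also have "\<dots> = (if r = c then of_int (dot h (ws ! r)) else 0)"
    using pairing_grading[OF nth_mem[OF rc(1)]] by (simp only: of_real_of_int_eq)
  finally have "E_matrix (X, k) V $$ (r, c) - (if r = c then of_int m else 0) =
      (if r = c then of_int (dot h (ws ! r) - m) else 0)" by simp
  moreover have "(E_matrix (X, k) V - of_int m \<cdot>\<^sub>m 1\<^sub>m (rep_dim V)) $$ (r, c) =
      E_matrix (X, k) V $$ (r, c) - (if r = c then of_int m else 0)"
    using rc by (simp add: weight_rep_def)
  ultimately show "(E_matrix (X, k) V - of_int m \<cdot>\<^sub>m 1\<^sub>m (rep_dim V)) $$ (r, c) =
      mat N N (\<lambda>(r, c). if r = c then of_int (dot h (ws ! r) - m) else 0) $$ (r, c)"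
    using rc by simp
qed (simp_all add: E_matrix_def weight_rep_def)

lemma E_eigenspace_dim_0:
  assumes "\<And>\<mu>. \<mu> \<in> set ws \<Longrightarrow> dot h \<mu> \<noteq> m"
  shows "E_eigenspace_dim (X, k) V m = 0"
  unfolding E_eigenspace_dim_def E_matrix_minus
  by (rule kernel_dim_diag_eq_0) (use assms in \<open>simp del: of_int_diff\<close>)

lemma E_eigenspace_dim_1:
  assumes "length (filter (\<lambda>\<mu>. dot h \<mu> = m) ws) = 1"
  shows "E_eigenspace_dim (X, k) V m = 1"
proof -
  have "card {r. r < N \<and> dot h (ws ! r) = m} = 1"
    using assms by (simp add: length_filter_conv_card)
  then obtain c where c: "{r. r < N \<and> dot h (ws ! r) = m} = {c}" by (auto simp: card_1_singleton_iff)
  show ?thesis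
    unfolding E_eigenspace_dim_def E_matrix_minus
  proof (rule kernel_dim_diag_eq_1)
    show "c < N" using c by blast
    fix r assume "r < N"
    then have "dot h (ws ! r) = m \<longleftrightarrow> r = c" using c by blast
    then show "complex_of_int (dot h (ws ! r) - m) = 0 \<longleftrightarrow> r = c" by (simp del: of_int_diff)
  qed
qed

theorem calabi_yau_level_3:
  assumes "finite_coroots X R"
  shows "calabi_yau (X, k) (weight_of X (ws ! 0))" "VHS_level (X, k) (weight_of X (ws ! 0)) = 3"
proof -
  let ?lam = "weight_of X (ws ! 0)"
  have tau: "tau X ?lam = ?lam" by (rule tau_top[OF assms])
  have irrep: "is_irrep X ?lam V"
    by (rule is_irrep_V) (use top_ws in \<open>simp_all add: weight_of_def\<close>)
  have hn: "hodge_number (X, k) V V r = E_eigenspace_dim (X, k) V (2 * r + 1)" for r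
    by (simp add: hodge_number_def is_real_rep_V)
  \<comment> \<open>The eigenvalue \<open>2 * p + 1\<close> is -3 at \<open>p = -2\<close> and 3 at
    \<open>p = 1\<close>.\<close>
  have "hodge_number (X, k) V V (-2) = 1" "hodge_number (X, k) V V 1 = 1"
    unfolding hn using hodge_check E_eigenspace_dim_1[of "-3"] E_eigenspace_dim_1[of 3]
    by (simp_all add: hodge_check_def)
  moreover have "-2 \<le> r \<and> r \<le> 1" if nz: "hodge_number (X, k) V V r \<noteq> 0" for r
  proof -
    obtain \<mu> where "\<mu> \<in> set ws" "dot h \<mu> = 2 * r + 1"
      using E_eigenspace_dim_0[of "2 * r + 1"] nz unfolding hn by blast
    moreover have "\<forall>\<mu>\<in>set ws. -3 \<le> dot h \<mu> \<and> dot h \<mu> \<le> 3"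
      using hodge_check unfolding hodge_check_def by blast
    ultimately have "-3 \<le> 2 * r + 1 \<and> 2 * r + 1 \<le> 3" by metis
    then show ?thesis by linarith
  qed
  ultimately show "calabi_yau (X, k) ?lam"
    unfolding calabi_yau_def fst_conv tau using irrep by blast
  have "dot h (ws ! 0) = -3" using hodge_check by (simp add: hodge_check_def)
  then show "VHS_level (X, k) ?lam = 3"
    unfolding VHS_level_def fst_conv tau E_val_weight_of[OF top_mem] by simp
qed

end

section \<open>The four Calabi-Yau variations\<close>

lemma weight_of_fund_weight:
  assumes "\<forall>i\<in>set [1..<Suc (lie_rank X)]. coord \<mu> i = (if i = m then 1 else 0)" "m \<in> {1..lie_rank X}"
  shows "weight_of X \<mu> = \<omega> m"
proof (rule ext)
  fix j
  show "weight_of X \<mu> j = \<omega> m j"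
  proof (cases "j \<in> {1..lie_rank X}")
    case True
    then have "j \<in> set [1..<Suc (lie_rank X)]" by auto
    with assms(1) have "coord \<mu> j = (if j = m then 1 else 0)" by blast
    then show ?thesis using True by (simp add: weight_of_def fund_weight_def)
  next
    case False
    then show ?thesis using assms(2) by (auto simp: weight_of_def fund_weight_def)
  qed
qed

lemma grading_of_list:
  assumes "\<forall>i\<in>set [1..<Suc (lie_rank X)]. grading_element (X, k) i = of_int (coord h i)"
    and "i \<in> {1..lie_rank X}"
  shows "grading_element (X, k) i = of_int (coord h i)"
proof -
  have "i \<in> set [1..<Suc (lie_rank X)]" using assms(2) by auto
  with assms(1) show ?thesis by blast
qed

lemma weight_list_check: "weights_check X roots ws os \<Longrightarrow> weight_list X ws"
  by unfold_locales (simp_all add: weights_check_def)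

lemma checked_weights_check: "weights_check X roots ws os \<Longrightarrow> checked_weights X ws roots os"
  by (simp add: checked_weights_def checked_weights_axioms_def weight_list_check)

text \<open>The weights of a minuscule representation form a single Weyl orbit, so the list of
  weights also serves as the orbit list.\<close>

lemma minuscule_calabi_yau:
  assumes X: "good_type X" "\<And>i. symmetrizer X i = 1"
    and laced: "\<And>i j. i \<noteq> j \<Longrightarrow> cartan X i j = 0 \<or> cartan X i j = -1"
    and wc: "weights_check X roots ws ws" and hc: "hodge_check k roots ws h g"
    and small: "\<forall>\<mu>\<in>set ws. list_all (\<lambda>x. x = -1 \<or> x = 0 \<or> x = 1) \<mu>"
    and grading: "\<forall>i\<in>set [1..<Suc (lie_rank X)]. grading_element (X, k) i = of_int (coord h i)"
  shows "calabi_yau (X, k) (weight_of X (ws ! 0)) \<and> VHS_level (X, k) (weight_of X (ws ! 0)) = 3"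
proof -
  interpret cw: checked_weights X ws roots ws by (rule checked_weights_check[OF wc])
  interpret mi: minuscule X ws
  proof
    fix i j assume "i \<in> {1..lie_rank X}" "j \<in> {1..lie_rank X}" "i \<noteq> j"
    then show "cartan X i j = cartan X j i \<and> (cartan X i j = 0 \<or> cartan X i j = -1)"
      using symmetrizer_sym[of i X j] laced[of i j] X(2) by simp
  next
    fix \<mu> i assume \<mu>: "\<mu> \<in> set ws" and i: "i \<in> {1..lie_rank X}"
    show "ladd \<mu> (root_list X (- coord \<mu> i) i) \<in> set ws" by (rule cw.closed_os[OF \<mu> i])
    have "i - 1 < length \<mu>" using i cw.length_ws[OF \<mu>] by auto
    then have "coord \<mu> i \<in> set \<mu>" by (simp add: coord_def)
    then show "coord \<mu> i \<in> {-1, 0, 1}" using small \<mu> by (auto simp: list_all_iff)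
  qed
  interpret weight_representation X ws
    by unfold_locales (fact mi.ef_minuscule mi.serre_minuscule cw.parent_ws cw.nonempty_ws)+
  interpret calabi_yau_weights X ws roots ws k h g
    by unfold_locales (fact hc, rule grading_of_list[OF grading])
  show ?thesis using calabi_yau_level_3[OF finite_coroots_simply_laced[OF X]] by blast
qed

definition roots_A5 :: "(nat \<times> int list) list" where
  "roots_A5 = [(1, [2, -1, 0, 0, 0]),
   (2, [-1, 2, -1, 0, 0]),
   (3, [0, -1, 2, -1, 0]),
   (4, [0, 0, -1, 2, -1]),
   (5, [0, 0, 0, -1, 2])]"

text \<open>The 20 weights of the third exterior power of the standard representation.\<close>

definition weights_A5 :: "int list list" where
  "weights_A5 =
  [[0, 0, 1, 0, 0],
   [0, 1, -1, 1, 0],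
   [1, -1, 0, 1, 0],
   [0, 1, 0, -1, 1],
   [1, -1, 1, -1, 1],
   [0, 1, 0, 0, -1],
   [-1, 0, 0, 1, 0],
   [1, 0, -1, 0, 1],
   [1, -1, 1, 0, -1],
   [-1, 0, 1, -1, 1],
   [1, 0, -1, 1, -1],
   [-1, 1, -1, 0, 1],
   [-1, 0, 1, 0, -1],
   [1, 0, 0, -1, 0],
   [0, -1, 0, 0, 1],
   [-1, 1, -1, 1, -1],
   [0, -1, 0, 1, -1],
   [-1, 1, 0, -1, 0],
   [0, -1, 1, -1, 0],
   [0, 0, -1, 0, 0]]"

lemma weights_check_A5: "weights_check (TypeA 5) roots_A5 weights_A5 weights_A5"
  by code_simp

text \<open>The two vectors are E and the sum of the positive coroots plus E, in coroot coordinates.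
  The sum of the positive coroots pairs to 2 with every simple root and E pairs to -2 with the
  noncompact one only, as \<open>parity_sign\<close> requires. The same recipe gives the vectors in
  the other three cases.\<close>

lemma hodge_check_A5: "hodge_check 3 roots_A5 weights_A5 [-1, -2, -3, -2, -1] [4, 6, 6, 6, 4]"
  by code_simp

definition roots_D6 :: "(nat \<times> int list) list" where
  "roots_D6 = [(1, [2, -1, 0, 0, 0, 0]),
   (2, [-1, 2, -1, 0, 0, 0]),
   (3, [0, -1, 2, -1, 0, 0]),
   (4, [0, 0, -1, 2, -1, -1]),
   (5, [0, 0, 0, -1, 2, 0]),
   (6, [0, 0, 0, -1, 0, 2])]"

text \<open>The 32 weights of a half-spin representation.\<close>

definition weights_D6 :: "int list list" where
  "weights_D6 =
  [[0, 0, 0, 0, 0, 1],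
   [0, 0, 0, 1, 0, -1],
   [0, 0, 1, -1, 1, 0],
   [0, 1, -1, 0, 1, 0],
   [0, 0, 1, 0, -1, 0],
   [1, -1, 0, 0, 1, 0],
   [0, 1, -1, 1, -1, 0],
   [1, -1, 0, 1, -1, 0],
   [0, 1, 0, -1, 0, 1],
   [-1, 0, 0, 0, 1, 0],
   [1, -1, 1, -1, 0, 1],
   [0, 1, 0, 0, 0, -1],
   [-1, 0, 0, 1, -1, 0],
   [1, 0, -1, 0, 0, 1],
   [1, -1, 1, 0, 0, -1],
   [-1, 0, 1, -1, 0, 1],
   [1, 0, -1, 1, 0, -1],
   [-1, 1, -1, 0, 0, 1],
   [-1, 0, 1, 0, 0, -1],
   [1, 0, 0, -1, 1, 0],
   [0, -1, 0, 0, 0, 1],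
   [-1, 1, -1, 1, 0, -1],
   [1, 0, 0, 0, -1, 0],
   [0, -1, 0, 1, 0, -1],
   [-1, 1, 0, -1, 1, 0],
   [0, -1, 1, -1, 1, 0],
   [-1, 1, 0, 0, -1, 0],
   [0, 0, -1, 0, 1, 0],
   [0, -1, 1, 0, -1, 0],
   [0, 0, -1, 1, -1, 0],
   [0, 0, 0, -1, 0, 1],
   [0, 0, 0, 0, 0, -1]]"

lemma weights_check_D6: "weights_check (TypeD 6) roots_D6 weights_D6 weights_D6"
  by code_simp

lemma hodge_check_D6: "hodge_check 6 roots_D6 weights_D6 [-1, -2, -3, -4, -2, -3] [9, 16, 21, 24, 13, 12]"
  by code_simp

definition roots_C3 :: "(nat \<times> int list) list" where
  "roots_C3 = [(1, [2, -1, 0]),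
   (2, [-1, 2, -1]),
   (3, [0, -2, 2])]"

text \<open>The weights of the primitive part of the third exterior power: 8 of the form
  \<plusminus>\<epsilon>\<open>\<^sub>1\<close>\<plusminus>\<epsilon>\<open>\<^sub>2\<close>\<plusminus>\<epsilon>\<open>\<^sub>3\<close>
  and 6 of the form \<plusminus>\<epsilon>\<open>\<^sub>i\<close>.\<close>

definition weights_C3 :: "int list list" where
  "weights_C3 =
  [[0, 0, 1],
   [0, 2, -1],
   [1, 0, 0],
   [2, -2, 1],
   [-1, 1, 0],
   [2, 0, -1],
   [0, -1, 1],
   [0, 1, -1],
   [-2, 0, 1],
   [1, -1, 0],
   [-2, 2, -1],
   [-1, 0, 0],
   [0, -2, 1],
   [0, 0, -1]]"

text \<open>Two Weyl orbits occur here. The coordinates at 2 and 3 are \<epsilon>-coefficient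
  difference 2 minus 3 and \<epsilon>-coefficient 3, so the parity filter keeps the 8 weights with
  all three coefficients \<plusminus>1 and drops the 6 others.\<close>

lemma weights_check_C3: "weights_check (TypeC 3) roots_C3 weights_C3 (filter (\<lambda>\<mu>. odd (coord \<mu> 3) \<and> even (coord \<mu> 2)) weights_C3)"
  by code_simp

lemma hodge_check_C3: "hodge_check 3 roots_C3 weights_C3 [-1, -2, -3] [4, 6, 6]"
  by code_simp

definition roots_E7 :: "(nat \<times> int list) list" where
  "roots_E7 = [(1, [2, 0, -1, 0, 0, 0, 0]),
   (2, [0, 2, 0, -1, 0, 0, 0]),
   (3, [-1, 0, 2, -1, 0, 0, 0]),
   (4, [0, -1, -1, 2, -1, 0, 0]),
   (5, [0, 0, 0, -1, 2, -1, 0]),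
   (6, [0, 0, 0, 0, -1, 2, -1]),
   (7, [0, 0, 0, 0, 0, -1, 2])]"

text \<open>The 56 weights of the smallest nontrivial representation.\<close>

definition weights_E7 :: "int list list" where
  "weights_E7 =
  [[0, 0, 0, 0, 0, 0, 1],
   [0, 0, 0, 0, 0, 1, -1],
   [0, 0, 0, 0, 1, -1, 0],
   [0, 0, 0, 1, -1, 0, 0],
   [0, 1, 1, -1, 0, 0, 0],
   [1, 1, -1, 0, 0, 0, 0],
   [0, -1, 1, 0, 0, 0, 0],
   [1, -1, -1, 1, 0, 0, 0],
   [-1, 1, 0, 0, 0, 0, 0],
   [1, 0, 0, -1, 1, 0, 0],
   [-1, -1, 0, 1, 0, 0, 0],
   [1, 0, 0, 0, -1, 1, 0],
   [-1, 0, 1, -1, 1, 0, 0],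
   [1, 0, 0, 0, 0, -1, 1],
   [0, 0, -1, 0, 1, 0, 0],
   [-1, 0, 1, 0, -1, 1, 0],
   [1, 0, 0, 0, 0, 0, -1],
   [0, 0, -1, 1, -1, 1, 0],
   [-1, 0, 1, 0, 0, -1, 1],
   [0, 1, 0, -1, 0, 1, 0],
   [0, 0, -1, 1, 0, -1, 1],
   [-1, 0, 1, 0, 0, 0, -1],
   [0, 1, 0, -1, 1, -1, 1],
   [0, 0, -1, 1, 0, 0, -1],
   [0, -1, 0, 0, 0, 1, 0],
   [0, 1, 0, 0, -1, 0, 1],
   [0, 1, 0, -1, 1, 0, -1],
   [0, -1, 0, 0, 1, -1, 1],
   [0, 1, 0, 0, -1, 1, -1],
   [0, -1, 0, 1, -1, 0, 1],
   [0, -1, 0, 0, 1, 0, -1],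
   [0, 1, 0, 0, 0, -1, 0],
   [0, 0, 1, -1, 0, 0, 1],
   [0, -1, 0, 1, -1, 1, -1],
   [1, 0, -1, 0, 0, 0, 1],
   [0, 0, 1, -1, 0, 1, -1],
   [0, -1, 0, 1, 0, -1, 0],
   [1, 0, -1, 0, 0, 1, -1],
   [0, 0, 1, -1, 1, -1, 0],
   [-1, 0, 0, 0, 0, 0, 1],
   [1, 0, -1, 0, 1, -1, 0],
   [0, 0, 1, 0, -1, 0, 0],
   [-1, 0, 0, 0, 0, 1, -1],
   [1, 0, -1, 1, -1, 0, 0],
   [-1, 0, 0, 0, 1, -1, 0],
   [1, 1, 0, -1, 0, 0, 0],
   [-1, 0, 0, 1, -1, 0, 0],
   [1, -1, 0, 0, 0, 0, 0],
   [-1, 1, 1, -1, 0, 0, 0],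
   [0, 1, -1, 0, 0, 0, 0],
   [-1, -1, 1, 0, 0, 0, 0],
   [0, -1, -1, 1, 0, 0, 0],
   [0, 0, 0, -1, 1, 0, 0],
   [0, 0, 0, 0, -1, 1, 0],
   [0, 0, 0, 0, 0, -1, 1],
   [0, 0, 0, 0, 0, 0, -1]]"

lemma weights_check_E7: "weights_check (TypeE7) roots_E7 weights_E7 weights_E7"
  by code_simp

lemma hodge_check_E7: "hodge_check 7 roots_E7 weights_E7 [-2, -3, -4, -6, -5, -4, -3] [32, 46, 62, 90, 70, 48, 24]"
  by code_simp

lemma calabi_yau_A5: "calabi_yau (dom_I 3 3) (\<omega> 3) \<and> VHS_level (dom_I 3 3) (\<omega> 3) = 3"
proof -
  have top: "weight_of (TypeA 5) (weights_A5 ! 0) = \<omega> 3"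
    by (rule weight_of_fund_weight) (code_simp, simp)
  have "\<forall>i\<in>set [1..<Suc (lie_rank (TypeA 5))]. grading_element (TypeA 5, 3) i = of_int (coord [-1, -2, -3, -2, -1] i)"
    using grading_element_A[of 3] by (simp add: coord_def upt_rec numeral_eq_Suc)
  from minuscule_calabi_yau[OF _ _ _ weights_check_A5 hodge_check_A5 _ this]
  have "calabi_yau (TypeA 5, 3) (weight_of (TypeA 5) (weights_A5 ! 0)) \<and>
      VHS_level (TypeA 5, 3) (weight_of (TypeA 5) (weights_A5 ! 0)) = 3"
    by (simp add: weights_A5_def)
  then show ?thesis unfolding top by (simp add: dom_I_def)
qed

lemma calabi_yau_D6: "calabi_yau (dom_II 6) (\<omega> 6) \<and> VHS_level (dom_II 6) (\<omega> 6) = 3"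
proof -
  have top: "weight_of (TypeD 6) (weights_D6 ! 0) = \<omega> 6"
    by (rule weight_of_fund_weight) (code_simp, simp)
  have "\<forall>i\<in>set [1..<Suc (lie_rank (TypeD 6))]. grading_element (TypeD 6, 6) i = of_int (coord [-1, -2, -3, -4, -2, -3] i)"
    using grading_element_D_last[of 6] by (simp add: coord_def upt_rec numeral_eq_Suc)
  from minuscule_calabi_yau[OF _ _ _ weights_check_D6 hodge_check_D6 _ this]
  have "calabi_yau (TypeD 6, 6) (weight_of (TypeD 6) (weights_D6 ! 0)) \<and>
      VHS_level (TypeD 6, 6) (weight_of (TypeD 6) (weights_D6 ! 0)) = 3"
    by (simp add: weights_D6_def)
  then show ?thesis unfolding top by (simp add: dom_II_def)
qed

lemma calabi_yau_E7: "calabi_yau dom_EVII (\<omega> 7) \<and> VHS_level dom_EVII (\<omega> 7) = 3"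
proof -
  have top: "weight_of (TypeE7) (weights_E7 ! 0) = \<omega> 7"
    by (rule weight_of_fund_weight) (code_simp, simp)
  have "\<forall>i\<in>set [1..<Suc (lie_rank (TypeE7))]. grading_element (TypeE7, 7) i = of_int (coord [-2, -3, -4, -6, -5, -4, -3] i)"
    unfolding grading_element_E7 by (simp add: coord_def upt_rec)
  from minuscule_calabi_yau[OF _ _ _ weights_check_E7 hodge_check_E7 _ this]
  have "calabi_yau (TypeE7, 7) (weight_of (TypeE7) (weights_E7 ! 0)) \<and>
      VHS_level (TypeE7, 7) (weight_of (TypeE7) (weights_E7 ! 0)) = 3"
    by (simp add: weights_E7_def)
  then show ?thesis unfolding top by (simp add: dom_EVII_def)
qed

text \<open>Strings of length 3 along the short simple roots put this case outside the minuscule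
  argument, so its relations are evaluated weight by weight.\<close>

lemma ef_C3:
  "\<forall>i\<in>set [1..<4]. \<forall>j\<in>set [1..<4]. \<forall>\<mu>\<in>set weights_C3.
     comm_coef (root_list (TypeC 3) 1 i) (step_coef (TypeC 3) weights_C3 1 i)
       (root_list (TypeC 3) (-1) j) (step_coef (TypeC 3) weights_C3 (-1) j) \<mu> =
     (if i = j then coord \<mu> i else 0)"
  by code_simp

lemma serre_C3_raising:
  "list_all (\<lambda>(i, j). \<forall>\<mu>\<in>set weights_C3.
     snd (ad_coef (root_list (TypeC 3) 1 i) (step_coef (TypeC 3) weights_C3 1 i)
       (nat (1 - cartan (TypeC 3) j i)) (root_list (TypeC 3) 1 j, step_coef (TypeC 3) weights_C3 1 j)) \<mu> = 0)
   [(1, 2), (1, 3), (2, 1), (2, 3), (3, 1), (3, 2)]"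
  by code_simp

lemma serre_C3_lowering:
  "list_all (\<lambda>(i, j). \<forall>\<mu>\<in>set weights_C3.
     snd (ad_coef (root_list (TypeC 3) (-1) i) (step_coef (TypeC 3) weights_C3 (-1) i)
       (nat (1 - cartan (TypeC 3) j i)) (root_list (TypeC 3) (-1) j, step_coef (TypeC 3) weights_C3 (-1) j)) \<mu> = 0)
   [(1, 2), (1, 3), (2, 1), (2, 3), (3, 1), (3, 2)]"
  by code_simp

lemma calabi_yau_C3: "calabi_yau (dom_III 3) (\<omega> 3) \<and> VHS_level (dom_III 3) (\<omega> 3) = 3"
proof -
  have top: "weight_of (TypeC 3) (weights_C3 ! 0) = \<omega> 3"
    by (rule weight_of_fund_weight) (code_simp, simp)
  have grading: "\<forall>i\<in>set [1..<Suc (lie_rank (TypeC 3))].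
      grading_element (TypeC 3, 3) i = of_int (coord [-1, -2, -3] i)"
    using grading_element_C[of 3] by (simp add: coord_def upt_rec numeral_eq_Suc)
  have index: "i \<in> set [1..<4]" if "i \<in> {1..lie_rank (TypeC 3)}" for i
    using that by auto
  interpret cw: checked_weights "TypeC 3" weights_C3 roots_C3 "filter (\<lambda>\<mu>. odd (coord \<mu> 3) \<and> even (coord \<mu> 2)) weights_C3"
    by (rule checked_weights_check[OF weights_check_C3])
  interpret weight_representation "TypeC 3" weights_C3
  proof
    fix i j \<mu> assume "i \<in> {1..lie_rank (TypeC 3)}" "j \<in> {1..lie_rank (TypeC 3)}" "\<mu> \<in> set weights_C3"
    then show "comm_coef (root_list (TypeC 3) 1 i) (step_coef (TypeC 3) weights_C3 1 i)
       (root_list (TypeC 3) (-1) j) (step_coef (TypeC 3) weights_C3 (-1) j) \<mu> =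
       (if i = j then coord \<mu> i else 0)"
      using ef_C3 index by blast
  next
    fix s :: int and i j \<mu> assume s: "s = 1 \<or> s = -1"
      and ij: "i \<in> {1..lie_rank (TypeC 3)}" "j \<in> {1..lie_rank (TypeC 3)}" "i \<noteq> j"
      and \<mu>: "\<mu> \<in> set weights_C3"
    have "{1..3::nat} = {1, 2, 3}" by auto
    then have "(i, j) \<in> set [(1, 2), (1, 3), (2, 1), (2, 3), (3, 1), (3, 2)]" using ij by auto
    then show "snd (ad_coef (root_list (TypeC 3) s i) (step_coef (TypeC 3) weights_C3 s i)
       (nat (1 - cartan (TypeC 3) j i)) (root_list (TypeC 3) s j, step_coef (TypeC 3) weights_C3 s j)) \<mu> = 0"
      using s serre_C3_raising serre_C3_lowering \<mu> unfolding list_all_iff by blast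
  qed (fact cw.parent_ws cw.nonempty_ws)+
  interpret calabi_yau_weights "TypeC 3" weights_C3 roots_C3 "filter (\<lambda>\<mu>. odd (coord \<mu> 3) \<and> even (coord \<mu> 2)) weights_C3" 3 "[-1, -2, -3]" "[4, 6, 6]"
    by unfold_locales (fact hodge_check_C3, rule grading_of_list[OF grading])
  show ?thesis
    using calabi_yau_level_3[OF finite_coroots_C] unfolding top by (simp add: dom_III_def)
qed

section \<open>The classification\<close>

lemma sum_fun_apply: "(\<Sum>i\<in>A. f i) x = (\<Sum>i\<in>A. f i x)"
  by (induction A rule: infinite_finite_induct) auto

lemma rho_apply: "i \<in> {1..lie_rank X} \<Longrightarrow> rho X i = 1"
  by (simp add: rho_def sum_fun_apply fund_weight_def)

lemma dominant_integral_apply: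
  assumes "lam = (\<Sum>i\<in>{1..lie_rank X}. real (m i) *\<^sub>W \<omega> i)"
  shows "lam j = (if j \<in> {1..lie_rank X} then real (m j) else 0)"
  by (simp add: assms sum_fun_apply wscale_def fund_weight_def if_distrib cong: if_cong)

text \<open>The dot action subtracts \<open>lam k + 1\<close> times the special simple root, on
  which E is -2.\<close>

lemma E_val_dot_refl:
  assumes k: "k \<in> {1..lie_rank X}" and row: "cartan_apply X (grading_element (X, k)) k = -2"
  shows "E_val (X, k) (dot_refl X k lam) = E_val (X, k) lam + 2 * (lam k + 1)"
proof -
  let ?h = "grading_element (X, k)"
  have add: "pairing X ?h (\<mu> + \<nu>) = pairing X ?h \<mu> + pairing X ?h \<nu>"
    and diff: "pairing X ?h (\<mu> - \<nu>) = pairing X ?h \<mu> - pairing X ?h \<nu>" for \<mu> \<nu>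
    by (simp_all add: pairing_def distrib_left right_diff_distrib sum.distrib sum_subtractf)
  show ?thesis
    unfolding E_val_def dot_refl_def fst_conv diff pairing_simple_refl row add
    using rho_apply[OF k] by simp
qed

text \<open>With \<open>w i = -E(\<omega>\<^sub>i)\<close> and \<open>k\<close> the special node, an infinitesimal normal function exists iff
  \<open>\<Sum>i\<noteq>k. w i * m i + (w k - 2) * m k \<le> 1\<close>.\<close>

locale normal_function_weight =
  fixes X :: cartan_type and k :: nat and w m :: "nat \<Rightarrow> nat" and lam :: weight
  assumes k: "k \<in> {1..lie_rank X}"
    and w_pos: "\<And>i. i \<in> {1..lie_rank X} \<Longrightarrow> w i \<ge> 1"
    and grading: "\<And>i. i \<in> {1..lie_rank X} \<Longrightarrow> grading_element (X, k) i = - real (w i)"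
    and row: "cartan_apply X (grading_element (X, k)) k = -2"
    and lam: "lam = (\<Sum>i\<in>{1..lie_rank X}. real (m i) *\<^sub>W \<omega> i)"
    and vhs: "odd_integer (E_val (X, k) lam)"
    and inf: "admits_inf_normal_function (X, k) lam"
begin

abbreviation "A \<equiv> {1..lie_rank X} - {k}"
abbreviation "W \<equiv> \<Sum>i\<in>A. w i * m i"

lemma E_val_lam: "E_val (X, k) lam = - real (W + w k * m k)"
proof -
  have "E_val (X, k) lam = (\<Sum>i\<in>{1..lie_rank X}. - real (w i * m i))"
    unfolding E_val_def pairing_def fst_conv
    by (intro sum.cong) (simp_all add: grading dominant_integral_apply[OF lam])
  also have "\<dots> = - real (\<Sum>i\<in>{1..lie_rank X}. w i * m i)" by (simp add: sum_negf)
  also have "(\<Sum>i\<in>{1..lie_rank X}. w i * m i) = W + w k * m k"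
    using sum.remove[OF _ k, of "\<lambda>i. w i * m i"] by simp
  finally show ?thesis .
qed

lemma odd_weight: "odd (W + w k * m k)"
proof -
  obtain z where z: "odd z" "- real (W + w k * m k) = of_int z"
    using vhs unfolding odd_integer_def E_val_lam by blast
  then have "z = - int (W + w k * m k)" by linarith
  with z(1) have "odd (int (W + w k * m k))" by (simp only: even_minus not_False_eq_True)
  then show ?thesis unfolding even_of_nat .
qed

lemma weight_bound: "W + w k * m k \<le> 2 * m k + 1"
proof -
  have "E_val (X, k) (dot_refl X k lam) \<ge> 1"
    using inf by (simp add: admits_inf_normal_function_def mu_def)
  then have "real (W + w k * m k) \<le> 2 * real (m k) + 1"
    unfolding E_val_dot_refl[OF k row] E_val_lam using dominant_integral_apply[OF lam, of k] k by simp
  then show ?thesis by linarith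
qed

lemma W_eq_0D:
  assumes "W = 0"
  shows "lam = real (m k) *\<^sub>W \<omega> k"
proof -
  have "m i = 0" if "i \<in> A" for i using assms w_pos[of i] that by force
  then show ?thesis
    using k by (auto simp: fun_eq_iff dominant_integral_apply[OF lam] wscale_def fund_weight_def)
qed

lemma W_eq_1D:
  assumes "W = 1"
  shows "\<exists>a\<in>A. w a = 1 \<and> lam = \<omega> a + real (m k) *\<^sub>W \<omega> k"
proof -
  have "finite A" by simp
  with assms obtain a where a: "a \<in> A" "w a * m a = 1" "\<forall>b\<in>A. a \<noteq> b \<longrightarrow> w b * m b = 0"
    using sum_eq_1_iff[of A "\<lambda>i. w i * m i"] by blast
  then have "w a = 1" "m a = 1" by auto
  moreover have "m b = 0" if "b \<in> A" "a \<noteq> b" for b using a(3) w_pos[of b] that by force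
  ultimately show ?thesis
    using a(1) k by (intro bexI[of _ a])
      (auto simp: fun_eq_iff dominant_integral_apply[OF lam] wscale_def fund_weight_def)
qed

text \<open>The special node contributes \<open>2 * m k\<close>, invisible to parity and equal to
  the slack in the bound; hence \<open>W\<close> is odd and at most 1.\<close>

lemma special_weight_2:
  assumes "w k = 2"
  shows "\<exists>a\<in>A. w a = 1 \<and> lam = \<omega> a + real (m k) *\<^sub>W \<omega> k"
proof -
  have "s = 1" if "odd (s + 2 * c)" "s + 2 * c \<le> 2 * c + 1" for s c :: nat using that by presburger
  then have "W = 1" using odd_weight weight_bound unfolding assms .
  then show ?thesis by (rule W_eq_1D)
qed

text \<open>If \<open>m k\<close> is positive, \<open>(w k - 2) * m k\<close> already uses up the
  bound 1, which forces \<open>w k = 3\<close>, \<open>m k = 1\<close> and \<open>W = 0\<close>.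
  Otherwise parity gives \<open>W = 1\<close>.\<close>

lemma special_weight_ge_3:
  assumes "w k \<ge> 3"
  shows "(w k = 3 \<and> lam = \<omega> k) \<or> (\<exists>a\<in>A. w a = 1 \<and> lam = \<omega> a)"
proof (cases "m k = 0")
  case True
  have "s = 1" if "odd (s + b * 0)" "s + b * 0 \<le> 2 * 0 + 1" for s b :: nat using that by presburger
  then have "W = 1" using odd_weight weight_bound unfolding True .
  then show ?thesis using W_eq_1D True by (auto simp: wscale_def plus_fun_def)
next
  case False
  obtain v where v: "w k = v + 3" using assms by (metis add.commute le_Suc_ex)
  have "W + v * m k + m k \<le> 1" using weight_bound unfolding v by (simp add: algebra_simps)
  moreover have "c = 1 \<and> s = 0 \<and> v = 0" if "s + v * c + c \<le> 1" "c \<noteq> 0" for s c :: nat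
    using that by (cases c) auto
  ultimately have "m k = 1" "W = 0" "v = 0" using False by blast+
  then show ?thesis using W_eq_0D v by (simp add: wscale_def)
qed

end

section \<open>The inequality in each family of domains\<close>

lemma std_weight_1:
  assumes "lie_rank X \<ge> 1" "X = TypeD (lie_rank X) \<Longrightarrow> lie_rank X \<ge> 3"
  shows "std_weight X 1 = \<omega> 1"
  using assms by (auto simp: fun_eq_iff std_weight_def fund_weight_def)

lemma std_weight_A_last:
  assumes "n \<ge> 1"
  shows "std_weight (TypeA n) (Suc n) = - \<omega> n"
  using assms by (auto simp: fun_eq_iff std_weight_def fund_weight_def)

lemma std_weightsI: "k \<in> K \<Longrightarrow> std_weight X k \<in> std_weights X K" "k \<in> K \<Longrightarrow> - std_weight X k \<in> std_weights X K"
  by (auto simp: std_weights_def)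

lemma normal_function_I:
  assumes p: "p \<ge> 2" and lam: "dominant_integral (TypeA (2 * p - 1)) lam"
    and vhs: "odd_integer (E_val (dom_I p p) lam)" and level: "VHS_level (dom_I p p) lam \<ge> 3"
    and inf: "admits_inf_normal_function (dom_I p p) lam"
  shows "(p = 3 \<and> lam = \<omega> 3) \<or>
    (p = 2 \<and> (\<exists>a::nat. lam = \<omega> 1 + real a *\<^sub>W \<omega> 2 \<or> lam = \<omega> 3 + real a *\<^sub>W \<omega> 2))"
proof -
  have D: "dom_I p p = (TypeA (2 * p - 1), p)" by (simp add: dom_I_def mult_2)
  obtain m where m: "lam = (\<Sum>i\<in>{1..lie_rank (TypeA (2 * p - 1))}. real (m i) *\<^sub>W \<omega> i)"
    using lam unfolding dominant_integral_def by blast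
  let ?w = "\<lambda>i. if i \<le> p then i else 2 * p - i"
  have p1: "p \<ge> 1" and pI: "p \<in> {1..2 * p - 1}" using p by auto
  interpret normal_function_weight "TypeA (2 * p - 1)" p ?w m lam
  proof
    show "cartan_apply (TypeA (2 * p - 1)) (grading_element (TypeA (2 * p - 1), p)) p = - 2"
      unfolding cartan_apply_A[OF pI] grading_element_A[OF p1] using p by (simp add: of_nat_diff)
    fix i assume "i \<in> {1..lie_rank (TypeA (2 * p - 1))}"
    then show "grading_element (TypeA (2 * p - 1), p) i = - real (?w i)"
      unfolding grading_element_A[OF p1] using p by (auto simp: of_nat_diff)
  qed (use p m vhs inf D in auto)
  show ?thesis
  proof (cases "p = 2")
    case True
    have "\<exists>a\<in>A. ?w a = 1 \<and> lam = \<omega> a + real (m p) *\<^sub>W \<omega> p"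
      by (rule special_weight_2) (use True in simp)
    then obtain a where a: "a \<in> {1..2 * p - 1} - {p}" "lam = \<omega> a + real (m p) *\<^sub>W \<omega> p"
      unfolding lie_rank.simps by blast
    then have "a = 1 \<or> a = 3" using True by auto
    then show ?thesis using a True by blast
  next
    case False
    then have "p \<ge> 3" using p by simp
    then have "(?w p = 3 \<and> lam = \<omega> p) \<or> (\<exists>a\<in>A. ?w a = 1 \<and> lam = \<omega> a)"
      by (intro special_weight_ge_3) simp
    then consider "p = 3" "lam = \<omega> 3"
      | a where "a \<in> {1..2 * p - 1} - {p}" "?w a = 1" "lam = \<omega> a"
      unfolding lie_rank.simps if_P[OF order_refl] by blast
    then show ?thesis
    proof cases
      case 2
      \<comment> \<open>The two ends of the diagram carry \<epsilon>\<open>\<^sub>1\<close> and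
        -\<epsilon>\<open>\<^sub>2\<^sub>p\<close>, the standard representation and its
        dual.\<close>
      then have "a = 1 \<or> a = 2 * p - 1" by (auto split: if_splits)
      then have "lam = std_weight (TypeA (2 * p - 1)) 1 \<or>
          lam = - std_weight (TypeA (2 * p - 1)) (Suc (2 * p - 1))"
        using 2 p std_weight_1[of "TypeA (2 * p - 1)"] std_weight_A_last[of "2 * p - 1"] by auto
      then have "lam \<in> std_weights (TypeA (2 * p - 1)) {1..Suc (2 * p - 1)}"
        by (auto intro!: std_weightsI)
      then show ?thesis using VHS_level_A[OF p1] level unfolding D by fastforce
    qed simp
  qed
qed

text \<open>The special node has weight \<open>r\<close> and the other spin node
  \<open>r - 1\<close>. For \<open>r = 2\<close> both nodes 1 and 3 have weight 1, giving two
  families; for larger \<open>r\<close> only the vector node 1 does, and the level excludes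
  it.\<close>

lemma normal_function_II:
  assumes r: "r \<ge> 2" and lam: "dominant_integral (TypeD (2 * r)) lam"
    and vhs: "odd_integer (E_val (dom_II (2 * r)) lam)" and level: "VHS_level (dom_II (2 * r)) lam \<ge> 3"
    and inf: "admits_inf_normal_function (dom_II (2 * r)) lam"
  shows "(r = 3 \<and> lam = \<omega> 6) \<or>
    (r = 2 \<and> (\<exists>a::nat. lam = \<omega> 1 + real a *\<^sub>W \<omega> 4 \<or> lam = \<omega> 3 + real a *\<^sub>W \<omega> 4))"
proof -
  let ?X = "TypeD (2 * r)"
  have D: "dom_II (2 * r) = (?X, 2 * r)" by (simp add: dom_II_def)
  obtain m where m: "lam = (\<Sum>i\<in>{1..lie_rank ?X}. real (m i) *\<^sub>W \<omega> i)"
    using lam unfolding dominant_integral_def by blast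
  let ?w = "\<lambda>i. if i + 2 \<le> 2 * r then i else if i + 1 = 2 * r then r - 1 else r"
  have n: "2 * r \<ge> 4" and nI: "2 * r \<in> {1..2 * r}" using r by auto
  interpret normal_function_weight ?X "2 * r" ?w m lam
  proof
    show "cartan_apply ?X (grading_element (?X, 2 * r)) (2 * r) = - 2"
      unfolding cartan_apply_D[OF nI n] grading_element_D_last[OF n] using r by (simp add: of_nat_diff)
    fix i assume "i \<in> {1..lie_rank ?X}"
    then show "grading_element (?X, 2 * r) i = - real (?w i)"
      unfolding grading_element_D_last[OF n] using r by (auto simp: of_nat_diff)
  qed (use r m vhs inf D in auto)
  show ?thesis
  proof (cases "r = 2")
    case True
    have "\<exists>a\<in>A. ?w a = 1 \<and> lam = \<omega> a + real (m (2 * r)) *\<^sub>W \<omega> (2 * r)"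
      by (rule special_weight_2) (use True in simp)
    then obtain a where a: "a \<in> {1..2 * r} - {2 * r}" "?w a = 1"
      "lam = \<omega> a + real (m (2 * r)) *\<^sub>W \<omega> (2 * r)"
      unfolding lie_rank.simps by blast
    then have "a = 1 \<or> a = 3" using True by (auto split: if_splits)
    moreover have "2 * r = 4" using True by simp
    ultimately show ?thesis using a(3) True by metis
  next
    case False
    then have "r \<ge> 3" using r by simp
    then have "(?w (2 * r) = 3 \<and> lam = \<omega> (2 * r)) \<or> (\<exists>a\<in>A. ?w a = 1 \<and> lam = \<omega> a)"
      by (intro special_weight_ge_3) simp
    moreover have "?w (2 * r) = r" "r = 3 \<Longrightarrow> 2 * r = 6" by auto
    ultimately consider "r = 3" "lam = \<omega> 6"
      | a where "a \<in> {1..2 * r} - {2 * r}" "?w a = 1" "lam = \<omega> a"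
      unfolding lie_rank.simps by metis
    then show ?thesis
    proof cases
      case 2
      then have "a = 1" using \<open>r \<ge> 3\<close> by (auto split: if_splits)
      then have "lam = std_weight ?X 1" using 2 r std_weight_1[of ?X] by auto
      then have "lam \<in> std_weights ?X {1..2 * r}" using r by (auto intro!: std_weightsI)
      then show ?thesis using VHS_level_D[OF n] level unfolding D by fastforce
    qed simp
  qed
qed

lemma normal_function_III:
  assumes n: "n \<ge> 1" and lam: "dominant_integral (TypeC n) lam"
    and vhs: "odd_integer (E_val (dom_III n) lam)" and level: "VHS_level (dom_III n) lam \<ge> 3"
    and inf: "admits_inf_normal_function (dom_III n) lam"
  shows "(n = 3 \<and> lam = \<omega> 3) \<or> (\<exists>a::nat. (n = 1 \<and> lam = real (2 * a + 1) *\<^sub>W \<omega> 1) \<or>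
    (n = 2 \<and> lam = \<omega> 1 + real a *\<^sub>W \<omega> 2))"
proof -
  have D: "dom_III n = (TypeC n, n)" by (simp add: dom_III_def)
  obtain m where m: "lam = (\<Sum>i\<in>{1..lie_rank (TypeC n)}. real (m i) *\<^sub>W \<omega> i)"
    using lam unfolding dominant_integral_def by blast
  have nI: "n \<in> {1..n}" using n by auto
  interpret normal_function_weight "TypeC n" n "\<lambda>i. i" m lam
  proof
    show "cartan_apply (TypeC n) (grading_element (TypeC n, n)) n = - 2"
      unfolding cartan_apply_C[OF nI] grading_element_C[OF n] using n by (simp add: of_nat_diff)
  qed (use n m vhs inf D grading_element_C[OF n] in auto)
  consider "n = 1" | "n = 2" | "n \<ge> 3" using n by linarith
  then show ?thesis
  proof cases
    case 1
    \<comment> \<open>In rank one \<open>A\<close> is empty, so \<open>W = 0\<close> and parity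
      makes \<open>m 1\<close> odd.\<close>
    then have "lam = real (m 1) *\<^sub>W \<omega> 1" "odd (m 1)" using W_eq_0D odd_weight by auto
    then show ?thesis using 1 by (auto elim!: oddE)
  next
    case 2
    have "\<exists>a\<in>A. a = 1 \<and> lam = \<omega> a + real (m n) *\<^sub>W \<omega> n" by (rule special_weight_2) (rule 2)
    then show ?thesis using 2 by blast
  next
    case 3
    then have "(n = 3 \<and> lam = \<omega> n) \<or> (\<exists>a\<in>A. a = 1 \<and> lam = \<omega> a)" by (rule special_weight_ge_3)
    then consider "n = 3" "lam = \<omega> 3" | "lam = \<omega> 1" by blast
    then show ?thesis
    proof cases
      case 2
      then have "lam = std_weight (TypeC n) 1" using n std_weight_1[of "TypeC n"] by simp
      then have "lam \<in> std_weights (TypeC n) {1..n}" using n by (auto intro!: std_weightsI)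
      then show ?thesis using VHS_level_C[OF n] level unfolding D by fastforce
    qed simp
  qed
qed

text \<open>The special node has weight 2, and the spin node is the only one of weight 1.\<close>

lemma normal_function_IV_odd:
  assumes n: "n \<ge> 3" and lam: "dominant_integral (TypeB n) lam"
    and vhs: "odd_integer (E_val (TypeB n, 1) lam)"
    and inf: "admits_inf_normal_function (TypeB n, 1) lam"
  shows "\<exists>a::nat. lam = real a *\<^sub>W \<omega> 1 + \<omega> n"
proof -
  obtain m where m: "lam = (\<Sum>i\<in>{1..lie_rank (TypeB n)}. real (m i) *\<^sub>W \<omega> i)"
    using lam unfolding dominant_integral_def by blast
  let ?w = "\<lambda>i. if i = n then 1 else 2 :: nat"
  have n2: "n \<ge> 2" and nI: "1 \<in> {1..n}" using n by auto
  interpret normal_function_weight "TypeB n" 1 ?w m lam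
  proof
    show "cartan_apply (TypeB n) (grading_element (TypeB n, 1)) 1 = - 2"
      unfolding cartan_apply_B[OF nI n2] grading_element_B[OF n2] using n by simp
    fix i assume "i \<in> {1..lie_rank (TypeB n)}"
    then show "grading_element (TypeB n, 1) i = - real (?w i)"
      unfolding grading_element_B[OF n2] by simp
  qed (use n m vhs inf in auto)
  have "\<exists>a\<in>A. ?w a = 1 \<and> lam = \<omega> a + real (m 1) *\<^sub>W \<omega> 1" by (rule special_weight_2) (use n in simp)
  then have "lam = real (m 1) *\<^sub>W \<omega> 1 + \<omega> n" by (auto simp: add.commute split: if_splits)
  then show ?thesis by blast
qed

lemma normal_function_IV_even:
  assumes n: "n \<ge> 4" and lam: "dominant_integral (TypeD n) lam"
    and vhs: "odd_integer (E_val (TypeD n, 1) lam)"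
    and inf: "admits_inf_normal_function (TypeD n, 1) lam"
  shows "\<exists>a::nat. lam = real a *\<^sub>W \<omega> 1 + \<omega> (n - 1) \<or> lam = real a *\<^sub>W \<omega> 1 + \<omega> n"
proof -
  obtain m where m: "lam = (\<Sum>i\<in>{1..lie_rank (TypeD n)}. real (m i) *\<^sub>W \<omega> i)"
    using lam unfolding dominant_integral_def by blast
  let ?w = "\<lambda>i. if i + 2 \<le> n then 2 else 1 :: nat"
  have nI: "1 \<in> {1..n}" using n by auto
  interpret normal_function_weight "TypeD n" 1 ?w m lam
  proof
    show "cartan_apply (TypeD n) (grading_element (TypeD n, 1)) 1 = - 2"
      unfolding cartan_apply_D[OF nI n] grading_element_D_first[OF n] using n by simp
    fix i assume "i \<in> {1..lie_rank (TypeD n)}"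
    then show "grading_element (TypeD n, 1) i = - real (?w i)"
      unfolding grading_element_D_first[OF n] by simp
  qed (use n m vhs inf in auto)
  have "\<exists>a\<in>A. ?w a = 1 \<and> lam = \<omega> a + real (m 1) *\<^sub>W \<omega> 1" by (rule special_weight_2) (use n in simp)
  then obtain a where a: "a \<in> A" "?w a = 1" "lam = \<omega> a + real (m 1) *\<^sub>W \<omega> 1" by blast
  have "\<not> a + 2 \<le> n"
  proof
    assume "a + 2 \<le> n"
    with a(2) show False unfolding if_P[OF \<open>a + 2 \<le> n\<close>] by simp
  qed
  moreover have "a \<le> n" using a(1) by simp
  ultimately have "a = n - 1 \<or> a = n" by arith
  then show ?thesis using a(3) by (metis add.commute)
qed

text \<open>Every node has weight at least 2 and the special one has weight 3, which leaves a single
  solution.\<close>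

lemma normal_function_EVII:
  assumes lam: "dominant_integral TypeE7 lam"
    and vhs: "odd_integer (E_val dom_EVII lam)"
    and inf: "admits_inf_normal_function dom_EVII lam"
  shows "lam = \<omega> 7"
proof -
  obtain m where m: "lam = (\<Sum>i\<in>{1..lie_rank TypeE7}. real (m i) *\<^sub>W \<omega> i)"
    using lam unfolding dominant_integral_def by blast
  let ?w = "\<lambda>i::nat. if i = 1 then 2 else if i = 2 then 3 else if i = 3 then 4 else if i = 4 then 6
    else if i = 5 then 5 else if i = 6 then 4 else 3 :: nat"
  interpret normal_function_weight TypeE7 7 ?w m lam
  proof
    show "cartan_apply TypeE7 (grading_element (TypeE7, 7)) 7 = - 2"
      unfolding cartan_apply_E7 grading_element_E7 by simp
    fix i assume "i \<in> {1..lie_rank TypeE7}"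
    then show "grading_element (TypeE7, 7) i = - real (?w i)"
      by (auto simp: grading_element_E7)
  qed (use m vhs inf in \<open>auto simp: dom_EVII_def\<close>)
  have "(?w 7 = 3 \<and> lam = \<omega> 7) \<or> (\<exists>a\<in>A. ?w a = 1 \<and> lam = \<omega> a)"
    by (rule special_weight_ge_3) simp
  moreover have "?w a \<noteq> 1" for a by simp
  ultimately show ?thesis by blast
qed

theorem mainTheorem1:
  fixes D :: hs_domain and lam :: weight
  assumes tube: "D \<in> tube_type_domains"
    and vhs: "defines_VHS D lam"
    and level: "odd_integer (VHS_level D lam)" "VHS_level D lam \<ge> 3"
    and inf: "admits_inf_normal_function D lam"
  shows
    "(VHS_level D lam = 3 \<and> calabi_yau D lam \<and>
        (D, lam) \<in> {(dom_I 3 3, \<omega> 3), (dom_II 6, \<omega> 6), (dom_III 3, \<omega> 3), (dom_EVII, \<omega> 7)}) \<or>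
     (\<exists>a::nat.
        (D = dom_I 2 2 \<and> (lam = \<omega> 1 + real a *\<^sub>W \<omega> 2 \<or> lam = \<omega> 3 + real a *\<^sub>W \<omega> 2)) \<or>
        (D = dom_II 4 \<and> (lam = \<omega> 1 + real a *\<^sub>W \<omega> 4 \<or> lam = \<omega> 3 + real a *\<^sub>W \<omega> 4)) \<or>
        (D = dom_III 1 \<and> lam = real (2 * a + 1) *\<^sub>W \<omega> 1) \<or>
        (D = dom_III 2 \<and> lam = \<omega> 1 + real a *\<^sub>W \<omega> 2) \<or>
        (\<exists>n\<ge>3. D = dom_IV (2 * n - 1) \<and> lam = real a *\<^sub>W \<omega> 1 + \<omega> n) \<or>
        (\<exists>n\<ge>4. D = dom_IV (2 * n - 2) \<and>
           (lam = real a *\<^sub>W \<omega> 1 + \<omega> (n - 1) \<or> lam = real a *\<^sub>W \<omega> 1 + \<omega> n)))"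
proof -
  have dom: "dominant_integral (fst D) lam" and odd: "odd_integer (E_val D lam)"
    using vhs by (auto simp: defines_VHS_def)
  from tube consider
      p where "D = dom_I p p" "p \<ge> 2"
    | r where "D = dom_II (2 * r)" "r \<ge> 2"
    | n where "D = dom_III n" "n \<ge> 1"
    | n where "D = dom_IV (2 * n - 1)" "n \<ge> 3"
    | n where "D = dom_IV (2 * n - 2)" "n \<ge> 4"
    | "D = dom_EVII"
    unfolding tube_type_domains_def by blast
  then show ?thesis
  proof cases
    case (1 p)
    have "fst D = TypeA (2 * p - 1)" using 1 by (simp add: dom_I_def mult_2)
    with normal_function_I[of p lam] dom odd level inf 1 show ?thesis
      using calabi_yau_A5 by auto
  next
    case (2 r)
    have "fst D = TypeD (2 * r)" using 2 by (simp add: dom_II_def)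
    with normal_function_II[of r lam] dom odd level inf 2 show ?thesis
      using calabi_yau_D6 by auto
  next
    case (3 n)
    have "fst D = TypeC n" using 3 by (simp add: dom_III_def)
    with normal_function_III[of n lam] dom odd level inf 3 show ?thesis
      using calabi_yau_C3 by auto
  next
    case (4 n)
    have "odd (2 * n - 1)" "(2 * n - 1 + 1) div 2 = n" using 4 by auto
    then have "D = (TypeB n, 1)" unfolding 4(1) dom_IV_def by simp
    then obtain a :: nat where "lam = real a *\<^sub>W \<omega> 1 + \<omega> n"
      using normal_function_IV_odd[of n lam] dom odd inf 4(2) by auto
    then show ?thesis using 4 by blast
  next
    case (5 n)
    have "even (2 * n - 2)" "(2 * n - 2 + 2) div 2 = n" using 5 by auto
    then have "D = (TypeD n, 1)" unfolding 5(1) dom_IV_def by simp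
    then obtain a :: nat where "lam = real a *\<^sub>W \<omega> 1 + \<omega> (n - 1) \<or> lam = real a *\<^sub>W \<omega> 1 + \<omega> n"
      using normal_function_IV_even[of n lam] dom odd inf 5(2) by auto
    then show ?thesis using 5 by blast
  next
    case 6
    with normal_function_EVII[of lam] dom odd inf show ?thesis
      using calabi_yau_E7 by (auto simp: dom_EVII_def)
  qed
qed

end
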